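(* Let $E=\mathbb{F}_2^4=E_1\oplus E_2$ with $\dim E_1=\dim E_2=2$, and let $M=(E,r)$ be a $q$-matroid of rank $2$ such that each of the minors $M|_{E_1}$, $M/E_2$, $M|_{E_2}$, $M/E_1$ is isomorphic to $U_{1,2}$ over $\mathbb{F}_2$ and such that $M$ has exactly four circuits of dimension $2$. Then $M$ is a smallest non-representable $q$-matroid: $M$ is not representable, and every $q$-matroid (over any field) whose ground space has dimension at most $3$ is representable.
   Context: A $q$-matroid is a pair $(E,r)$, where $E$ is a finite-dimensional vector space over a field and $r$ is an integer-valued function on the set $\mathcal{L}(E)$ of subspaces of $E$ such that: (R1) $0\le r(A)\le\dim A$ for all $A$; (R2) $A\subseteq B$ implies $r(A)\le r(B)$; (R3) $r(A+B)+r(A\cap B)\le r(A)+r(B)$ for all $A,B$. Its rank is $r(E)$ and its dimension is $\dim E$. A subspace $A$ is independent if $r(A)=\dim A$ and dependent otherwise; a circuit is a dependent subspace all of whose proper subspaces are independent. The uniform $q$-matroid $U_{k,n}$ has an $n$-dimensional ground space and rank function $r(A)=\min\{\dim A,k\}$. Two $q$-matroids $(E_1,r_1)$, $(E_2,r_2)$ over the same field are isomorphic if there is a lattice isomorphism $\varphi:\mathcal{L}(E_1)\to\mathcal{L}(E_2)$ with $r_1(A)=r_2(\varphi(A))$ for all $A\subseteq E_1$. For $X\subseteq E$, the restriction $M|_X$ has ground space $X$ and rank function $A\mapsto r(A)$; the contraction $M/X$ has ground space $E/X$ and rank function $A/X\mapsto r(A)-r(X)$ for $X\subseteq A\subseteq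 E$. A $q$-matroid $M=(E,r)$ of rank $k=r(E)$ with $E=K^n$ (after choosing a basis) over a field $K$ is representable if there exists a $k\times n$ matrix $G$ over some extension field $L/K$ such that for every subspace $A\subseteq E$ and every matrix $Y$ over $K$ with column space $A$, $r(A)$ equals the rank of $GY$ over $L$. *)

theory Defs
  imports
    "Jordan_Normal_Form.DL_Rank"
    "HOL-Algebra.AbelCoset"
    "HOL-Library.Z2"
    "HOL-Computational_Algebra.Fraction_Field"
begin

text \<open>
  The base field is the universe of a type of class \<open>field\<close>, viewed as the record \<open>class_ring\<close>;
  vector spaces over it are the \<open>module\<close> records of the library, so that a subspace or a quotient
  of a vector space is again such a record.
\<close>

type_synonym ('k, 'v) vs = "('k, 'v) module"

definition subspaces :: "('k::field, 'v) vs \<Rightarrow> 'v set set" where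
  "subspaces V = {A. VectorSpace.subspace class_ring A V}"

definition sdim :: "('k::field, 'v) vs \<Rightarrow> 'v set \<Rightarrow> nat" where
  "sdim V A = vectorspace.dim class_ring (V\<lparr>carrier := A\<rparr>)"

text \<open>
  Scalar multiplication on \<open>V / X\<close> sends the coset \<open>C\<close> to \<open>X + a C\<close>; the summand \<open>X\<close> only matters
  for \<open>a = 0\<close>, where \<open>a C\<close> is \<open>{0}\<close> instead of a coset. The components \<open>mult\<close> and \<open>one\<close> of a
  \<open>module\<close> record are irrelevant.
\<close>

definition quotient_space :: "('k::field, 'v) vs \<Rightarrow> 'v set \<Rightarrow> ('k, 'v set) vs" where
  "quotient_space V X =
     \<lparr>carrier = a_rcosets\<^bsub>V\<^esub> X, mult = undefined, one = undefined, zero = X,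
      add = (\<lambda>C D. C <+>\<^bsub>V\<^esub> D),
      smult = (\<lambda>a C. X <+>\<^bsub>V\<^esub> ((\<lambda>v. a \<odot>\<^bsub>V\<^esub> v) ` C))\<rparr>"

subsection \<open>q-matroids\<close>

text \<open>Only the values of \<open>rk\<close> on subspaces of the ground space are meaningful.\<close>

record ('k, 'v) qmatroid =
  ground :: "('k, 'v) vs"
  rk :: "'v set \<Rightarrow> int"

locale q_matroid =
  vectorspace "class_ring :: 'k ring" "ground M"
  for M :: "('k::field, 'v) qmatroid" +
  assumes fin_dim: "fin_dim"
    and R1: "A \<in> subspaces (ground M) \<Longrightarrow> 0 \<le> rk M A \<and> rk M A \<le> int (sdim (ground M) A)"
    and R2: "A \<in> subspaces (ground M) \<Longrightarrow> B \<in> subspaces (ground M) \<Longrightarrow> A \<subseteq> B \<Longrightarrow>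
               rk M A \<le> rk M B"
    and R3: "A \<in> subspaces (ground M) \<Longrightarrow> B \<in> subspaces (ground M) \<Longrightarrow>
               rk M (A <+>\<^bsub>ground M\<^esub> B) + rk M (A \<inter> B) \<le> rk M A + rk M B"

definition qrank :: "('k::field, 'v) qmatroid \<Rightarrow> int" where
  "qrank M = rk M (carrier (ground M))"

definition qdim :: "('k::field, 'v) qmatroid \<Rightarrow> nat" where
  "qdim M = vectorspace.dim class_ring (ground M)"

definition indep :: "('k::field, 'v) qmatroid \<Rightarrow> 'v set \<Rightarrow> bool" where
  "indep M A \<longleftrightarrow> A \<in> subspaces (ground M) \<and> rk M A = int (sdim (ground M) A)"

definition dependent :: "('k::field, 'v) qmatroid \<Rightarrow> 'v set \<Rightarrow> bool" where
  "dependent M A \<longleftrightarrow> A \<in> subspaces (ground M) \<and> \<not> indep M A"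

definition circuit :: "('k::field, 'v) qmatroid \<Rightarrow> 'v set \<Rightarrow> bool" where
  "circuit M C \<longleftrightarrow> dependent M C \<and> (\<forall>A \<in> subspaces (ground M). A \<subset> C \<longrightarrow> indep M A)"

definition uniform :: "'k::field itself \<Rightarrow> nat \<Rightarrow> nat \<Rightarrow> ('k, 'k vec) qmatroid" where
  "uniform _ k n =
     \<lparr>ground = module_vec TYPE('k) n,
      rk = (\<lambda>A. min (int (sdim (module_vec TYPE('k) n) A)) (int k))\<rparr>"

definition qiso :: "('k::field, 'v) qmatroid \<Rightarrow> ('k, 'w) qmatroid \<Rightarrow> bool" where
  "qiso M N \<longleftrightarrow>
     (\<exists>\<phi>. bij_betw \<phi> (subspaces (ground M)) (subspaces (ground N)) \<and>
        (\<forall>A \<in> subspaces (ground M). \<forall>B \<in> subspaces (ground M).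
           \<phi> (A \<inter> B) = \<phi> A \<inter> \<phi> B \<and>
           \<phi> (A <+>\<^bsub>ground M\<^esub> B) = \<phi> A <+>\<^bsub>ground N\<^esub> \<phi> B) \<and>
        (\<forall>A \<in> subspaces (ground M). rk M A = rk N (\<phi> A)))"

definition restriction :: "('k::field, 'v) qmatroid \<Rightarrow> 'v set \<Rightarrow> ('k, 'v) qmatroid" where
  "restriction M X = \<lparr>ground = (ground M)\<lparr>carrier := X\<rparr>, rk = rk M\<rparr>"

text \<open>
  A subspace of \<open>E / X\<close> is a set of cosets, and the subspace \<open>A\<close> of \<open>E\<close> above it is their union,
  that is, \<open>\<Union> (A / X) = A\<close> for \<open>X \<subseteq> A\<close>.
\<close>

definition contraction :: "('k::field, 'v) qmatroid \<Rightarrow> 'v set \<Rightarrow> ('k, 'v set) qmatroid" where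
  "contraction M X =
     \<lparr>ground = quotient_space (ground M) X, rk = (\<lambda>B. rk M (\<Union> B) - rk M X)\<rparr>"

subsection \<open>Representability\<close>

text \<open>
  Matrices over a field \<open>L\<close> that is given by a record; \<open>func_space\<close> over \<open>{..<m}\<close> is the space
  \<open>L\<^sup>m\<close>. The matrix product and rank of the library need a field that fills a whole type.
\<close>

definition mat_mult :: "'l ring \<Rightarrow> 'l mat \<Rightarrow> 'l mat \<Rightarrow> 'l mat" where
  "mat_mult L A B =
     mat (dim_row A) (dim_col B)
       (\<lambda>(i, j). \<Oplus>\<^bsub>L\<^esub>l\<in>{..<dim_col A}. A $$ (i, l) \<otimes>\<^bsub>L\<^esub> B $$ (l, j))"

definition mat_rank :: "'l ring \<Rightarrow> 'l mat \<Rightarrow> nat" where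
  "mat_rank L A =
     (let W = ring.func_space L {..<dim_row A};
          C = {\<lambda>i\<in>{..<dim_row A}. A $$ (i, j) |j. j < dim_col A}
      in vectorspace.dim L (W\<lparr>carrier := LinearCombinations.module.span L W C\<rparr>))"

text \<open>
  \<open>representable TYPE('l) M\<close>: the q-matroid \<open>M\<close> is represented by a matrix over some extension
  field \<open>L\<close> of the base field whose elements are taken from \<open>'l\<close>. Since HOL cannot quantify over
  types, the type from which \<open>L\<close> is drawn is a parameter. The extension \<open>L / K\<close> is given by a
  homomorphism of fields \<open>h\<close>, and the choice of a basis by a linear isomorphism \<open>\<phi>\<close> from the
  ground space onto \<open>K\<^sup>n\<close>.
\<close>

definition representable :: "'l itself \<Rightarrow> ('k::field, 'v) qmatroid \<Rightarrow> bool" where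
  "representable _ M \<longleftrightarrow>
     (let n = qdim M; k = nat (qrank M) in
      \<exists>(L :: 'l ring) h \<phi> G.
        field L \<and> h \<in> Ring.ring_hom (class_ring :: 'k ring) L \<and>
        linear_map class_ring (ground M) (module_vec TYPE('k) n) \<phi> \<and>
        bij_betw \<phi> (carrier (ground M)) (carrier_vec n) \<and>
        G \<in> carrier_mat k n \<and> elements_mat G \<subseteq> carrier L \<and>
        (\<forall>A \<in> subspaces (ground M). \<forall>m. \<forall>Y \<in> carrier_mat n m.
           vec_space.col_space n Y = \<phi> ` A \<longrightarrow>
           rk M A = int (mat_rank L (mat_mult L G (map_mat h Y)))))"

end

theory Submission
  imports Defs "HOL-Computational_Algebra.Polynomial_Factorial"
begin

text \<open>
  A matrix \<open>G\<close> with \<open>k\<close> rows over an extension \<open>L\<close> of \<open>K\<close>, together with coordinates on the ground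
  space \<open>E\<close>, induces a map \<open>\<gamma>\<close> from \<open>E\<close> to \<open>L\<^sup>k\<close> that is linear along the embedding of \<open>K\<close>
  into \<open>L\<close>. It represents a q-matroid if and only if the rank of every subspace \<open>A\<close> is the dimension
  over \<open>L\<close> of the span of \<open>\<gamma> ` A\<close> (lemma \<open>representable_iff\<close>). Both halves of the theorem work with
  such maps.

  The q-matroid with four circuits. If \<open>M\<close> has rank 2 and is represented by \<open>\<gamma>\<close>, then
  \<open>D u v = det (\<gamma> u, \<gamma> v)\<close> is biadditive, and it vanishes if and only if \<open>u\<close> and \<open>v\<close> span a subspace of
  rank at most 1 (\<open>representation_form\<close>). The conditions on the minors say that \<open>M\<close> has no loops and
  that \<open>E1\<close> and \<open>E2\<close> are flats of rank 1; they force the circuits of dimension 2, which are the planes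
  of rank 1, to meet pairwise in zero (\<open>lines_meet\<close>). Hence every such circuit other than \<open>E1\<close> and \<open>E2\<close>
  is the graph of an isomorphism \<open>T\<close> from \<open>E1\<close> to \<open>E2\<close>. Since \<open>D\<close> vanishes on \<open>E1\<close> and \<open>E2\<close>, the graph
  of a linear map \<open>T\<close> has rank 1 if and only if \<open>D x (T y) + D (T x) y = 0\<close> for all \<open>x\<close> and \<open>y\<close> in \<open>E1\<close>.
  This condition is additive in \<open>T\<close>, so its solutions form a vector space over the field with two
  elements. The solution 0 gives \<open>E1\<close>, and together with \<open>E2\<close> there are \<open>2\<^sup>s + 1\<close> circuits of
  dimension 2 for some \<open>s\<close>. This is never four; concretely, two isomorphisms \<open>T\<close> and \<open>T'\<close> give rise to
  a fifth circuit, the graph of \<open>T + T'\<close> (\<open>fifth_line\<close>).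

  Small dimensions. In dimension at most 3 the rank is 0, full, 1, or one less than full. A q-matroid of
  rank 1 is determined by its space \<open>W\<close> of loops: the rank of \<open>A\<close> is 0 if and only if \<open>A\<close> lies in \<open>W\<close>
  (\<open>loop_space\<close>). A q-matroid of corank 1 is determined by its unique circuit \<open>Z\<close>: the rank of \<open>A\<close> is
  \<open>dim A - 1\<close> if \<open>A\<close> contains \<open>Z\<close> and \<open>dim A\<close> otherwise (\<open>unique_circuit\<close>). Over the field \<open>K(t)\<close> of
  rational functions the powers of \<open>t\<close> are linearly independent over \<open>K\<close>. With powers of \<open>t\<close> as
  entries one therefore finds a functional that vanishes on exactly the vectors of \<open>W\<close>, and a vector
  that lies in the extension of \<open>A\<close> to \<open>K(t)\<close> if and only if \<open>A\<close> contains \<open>Z\<close>. The first represents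
  rank 1; a matrix whose kernel is spanned by the second represents corank 1. These two
  constructions work in every dimension (\<open>representable_rank_1\<close>, \<open>representable_corank_1\<close>).
\<close>

section \<open>Dimensions of spans\<close>

context vectorspace
begin

text \<open>
  Dimensions are attached to generating sets and not only to subspaces, because the rank of a
  matrix is the dimension of the span of its columns.
\<close>
definition span_dim :: "'c set \<Rightarrow> nat" where
  "span_dim S = vectorspace.dim K (span_vs S)"

lemma span_le_span:
  assumes "S \<subseteq> span T" "T \<subseteq> carrier V"
  shows "span S \<subseteq> span T"
  using span_is_subset[OF assms(1) span_is_submodule[OF assms(2)]] .

lemma span_submodule:
  assumes "submodule K A V"
  shows "span A = A"
  using span_is_subset[OF subset_refl assms] in_own_span[OF submodule.subset[OF assms]] by blast

lemma span_dim_submodule: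
  assumes "submodule K A V"
  shows "span_dim A = vectorspace.dim K (vs A)"
  unfolding span_dim_def span_submodule[OF assms] ..

lemma span_dim_cong: "span S = span T \<Longrightarrow> span_dim S = span_dim T"
  unfolding span_dim_def by simp

lemma span_dim_carrier: "span_dim (carrier V) = dim"
proof -
  have "submodule K (carrier V) V"
    by (rule submodule.intro) (auto intro: module_axioms)
  then show ?thesis
    by (simp add: span_dim_submodule)
qed

lemma span_dim_lin_indpt:
  assumes "finite U" "U \<subseteq> carrier V" "lin_indpt U"
  shows "span_dim U = card U"
proof -
  have m: "maximal U (\<lambda>T. T \<subseteq> U \<and> lin_indpt T)"
    using assms unfolding maximal_def by auto
  show ?thesis
    unfolding span_dim_def by (rule dim_span[OF assms(2,1) m])
qed

lemma basis_of_span: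
  assumes "fin_dim" "S \<subseteq> carrier V"
  obtains U where "U \<subseteq> S" "finite U" "lin_indpt U" "span U = span S" "card U = span_dim S"
proof -
  have "\<exists>U. finite U \<and> maximal U (\<lambda>T. T \<subseteq> S \<and> lin_indpt T)"
  proof (rule maximal_exists)
    fix T assume "T \<subseteq> S \<and> lin_indpt T"
    then show "finite T \<and> card T \<le> dim"
      using li_le_dim[OF assms(1), of T] fin_dim_li_fin[OF assms(1)] assms(2) by auto
  next
    show "{} \<subseteq> S \<and> lin_indpt {}"
      by (auto simp: lin_dep_def)
  qed
  then obtain U where fU: "finite U" and mU: "maximal U (\<lambda>T. T \<subseteq> S \<and> lin_indpt T)" by blast
  from mU have U: "U \<subseteq> S" "lin_indpt U" by (auto simp: maximal_def)
  have UV: "U \<subseteq> carrier V" using U assms by auto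
  have "S \<subseteq> span U"
  proof
    fix s assume s: "s \<in> S"
    show "s \<in> span U"
    proof (cases "s \<in> U")
      case True then show ?thesis using in_own_span[OF UV] by auto
    next
      case False
      have "lin_dep (U \<union> {s})"
        using mU False s U unfolding maximal_def by auto
      then show ?thesis using lin_dep_iff_in_span[OF UV U(2) _ False] s assms by auto
    qed
  qed
  then have "span S \<subseteq> span U" using span_le_span UV by blast
  moreover have "span U \<subseteq> span S" using span_is_monotone[OF U(1)] .
  ultimately have eq: "span U = span S" by simp
  have "card U = span_dim S"
    using span_dim_lin_indpt[OF fU UV U(2)] span_dim_cong[OF eq] by simp
  then show ?thesis using that U fU eq by blast
qed

lemma span_dim_le_card:
  assumes "fin_dim" "S \<subseteq> carrier V" "finite S"
  shows "span_dim S \<le> card S"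
proof -
  obtain U where "U \<subseteq> S" "card U = span_dim S" using basis_of_span[OF assms(1,2)] .
  then show ?thesis using card_mono[OF assms(3)] by metis
qed

lemma extend_basis:
  assumes "fin_dim" "S \<subseteq> carrier V" "T \<subseteq> carrier V" "S \<subseteq> span T"
  obtains U C where "U \<subseteq> S" "finite U" "finite C" "C \<subseteq> span T" "U \<inter> C = {}"
    "lin_indpt (U \<union> C)" "span U = span S" "span (U \<union> C) = span T"
    "card U = span_dim S" "card U + card C = span_dim T"
proof -
  obtain U where U: "U \<subseteq> S" "finite U" "lin_indpt U" "span U = span S" "card U = span_dim S"
    using basis_of_span[OF assms(1,2)] .
  obtain B where B: "B \<subseteq> T" "finite B" "lin_indpt B" "span B = span T" "card B = span_dim T"
    using basis_of_span[OF assms(1,3)] .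
  have BV: "B \<subseteq> carrier V" and UV: "U \<subseteq> carrier V" using assms U B by auto
  obtain C where C: "finite C" "C \<subseteq> carrier V" "C \<subseteq> span B" "C \<inter> U = {}"
      "int (card C) \<le> int (card B) - int (card U)" "span (U \<union> C) = span B"
    using replacement[OF U(2) B(2) BV U(3)] subset_trans[OF U(1) assms(4)] unfolding B(4) by blast
  have f: "finite (U \<union> C)" "U \<union> C \<subseteq> carrier V" using U C UV by auto
  have cUC: "card (U \<union> C) = card U + card C" using card_Un_disjoint[OF U(2) C(1)] C(4) by auto
  have "span_dim (U \<union> C) = card B" using span_dim_cong[of "U \<union> C" T] C(6) B(4,5) by simp
  moreover have "span_dim (U \<union> C) \<le> card (U \<union> C)" using span_dim_le_card[OF assms(1) f(2,1)] .
  ultimately have eq: "card (U \<union> C) = card B" "span_dim (U \<union> C) = card (U \<union> C)"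
    using cUC C(5) by auto
  have "lin_indpt (U \<union> C)"
    using full_dim_span[OF f(2,1)] eq(2) unfolding span_dim_def by simp
  moreover have "U \<inter> C = {}" using C(4) by auto
  ultimately show ?thesis using that[of U C] U C B eq cUC by auto
qed

lemma span_dim_mono:
  assumes "fin_dim" "S \<subseteq> carrier V" "T \<subseteq> carrier V" "S \<subseteq> span T"
  shows "span_dim S \<le> span_dim T"
proof -
  obtain U C :: "'c set" where "card U = span_dim S" "card U + card C = span_dim T"
    by (rule extend_basis[OF assms])
  then show ?thesis by simp
qed

lemma span_dim_le_dim:
  assumes "fin_dim" "S \<subseteq> carrier V"
  shows "span_dim S \<le> dim"
  using span_dim_mono[OF assms(1,2) subset_refl] in_own_span[OF subset_refl] assms(2)
  unfolding span_dim_carrier by blast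

lemma span_dim_Un:
  assumes fd: "fin_dim" and S: "S \<subseteq> carrier V" and T: "T \<subseteq> carrier V"
  shows "span_dim (S \<union> T) \<le> span_dim S + span_dim T"
proof -
  obtain U where U: "U \<subseteq> S" "finite U" "span U = span S" "card U = span_dim S"
    using basis_of_span[OF fd S] .
  obtain B where B: "B \<subseteq> T" "finite B" "span B = span T" "card B = span_dim T"
    using basis_of_span[OF fd T] .
  have UB: "U \<union> B \<subseteq> carrier V" using S T U B by auto
  have "S \<union> T \<subseteq> span (U \<union> B)"
    using in_own_span[OF S] in_own_span[OF T] U(3) B(3)
      span_is_monotone[of U "U \<union> B"] span_is_monotone[of B "U \<union> B"] by auto
  then have "span_dim (S \<union> T) \<le> span_dim (U \<union> B)"
    using span_dim_mono[OF fd _ UB] S T by auto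
  also have "\<dots> \<le> card (U \<union> B)" using span_dim_le_card[OF fd UB] U B by auto
  also have "\<dots> \<le> card U + card B" by (rule card_Un_le)
  finally show ?thesis using U B by simp
qed

lemma span_dim_eq_0_iff:
  assumes "fin_dim" "S \<subseteq> carrier V"
  shows "span_dim S = 0 \<longleftrightarrow> S \<subseteq> {\<zero>\<^bsub>V\<^esub>}"
proof
  assume 0: "span_dim S = 0"
  obtain U where U: "finite U" "span U = span S" "card U = span_dim S"
    using basis_of_span[OF assms] .
  then have "span S = {\<zero>\<^bsub>V\<^esub>}" using 0 span_empty by auto
  then show "S \<subseteq> {\<zero>\<^bsub>V\<^esub>}" using in_own_span[OF assms(2)] by auto
next
  assume "S \<subseteq> {\<zero>\<^bsub>V\<^esub>}"
  then have "span_dim S \<le> span_dim {}"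
    using span_dim_mono[OF assms, of "{}"] span_empty by auto
  then show "span_dim S = 0" using span_dim_le_card[OF assms(1), of "{}"] by auto
qed

lemma span_dim_pair_le_1_iff:
  assumes fd: "fin_dim" and u: "u \<in> carrier V" and w: "w \<in> carrier V"
  shows "span_dim {u, w} \<le> 1 \<longleftrightarrow> u = \<zero>\<^bsub>V\<^esub> \<or> w \<in> span {u}"
proof
  assume *: "u = \<zero>\<^bsub>V\<^esub> \<or> w \<in> span {u}"
  obtain x where x: "x \<in> carrier V" "{u, w} \<subseteq> span {x}"
    using * that[OF u] that[OF w] span_zero[of "{w}"] span_self u w by auto
  have "span_dim {u, w} \<le> span_dim {x}"
    using span_dim_mono[OF fd _ _ x(2)] u w x by auto
  also have "\<dots> \<le> 1" using span_dim_le_card[OF fd, of "{x}"] x by auto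
  finally show "span_dim {u, w} \<le> 1" .
next
  assume le: "span_dim {u, w} \<le> 1"
  show "u = \<zero>\<^bsub>V\<^esub> \<or> w \<in> span {u}"
  proof (rule ccontr)
    assume n: "\<not> (u = \<zero>\<^bsub>V\<^esub> \<or> w \<in> span {u})"
    have e: "lin_indpt {}" by (auto simp: lin_dep_def)
    have lu: "lin_indpt {u}"
      using lin_dep_iff_in_span[of "{}" u] e u n span_empty by auto
    have wu: "w \<noteq> u" using n span_self[OF u] by auto
    have "lin_indpt ({u} \<union> {w})"
      using lin_dep_iff_in_span[OF _ lu w] u n wu by auto
    moreover have "{u} \<union> {w} = {u, w}" by auto
    ultimately have "span_dim {u, w} = 2"
      using span_dim_lin_indpt[of "{u, w}"] u w wu by auto
    then show False using le by simp
  qed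
qed

lemma span_singleton:
  assumes "u \<in> carrier V"
  shows "span {u} = {c \<odot>\<^bsub>V\<^esub> u | c. c \<in> carrier K}"
proof -
  have "lincomb a {u} = a u \<odot>\<^bsub>V\<^esub> u" if "a u \<in> carrier K" for a
    unfolding lincomb_def using that assms by simp
  then have "span {u} = {a u \<odot>\<^bsub>V\<^esub> u | a. a \<in> {u} \<rightarrow> carrier K}"
    using finite_span[of "{u}"] assms by fastforce
  also have "\<dots> = {c \<odot>\<^bsub>V\<^esub> u | c. c \<in> carrier K}"
    by (auto intro: exI[of _ "\<lambda>_. c" for c])
  finally show ?thesis .
qed

lemma submodule_eqI_span_dim:
  assumes "fin_dim" "submodule K A V" "submodule K B V" "A \<subseteq> B" "span_dim B \<le> span_dim A"
  shows "A = B"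
proof -
  have AV: "A \<subseteq> carrier V" "B \<subseteq> carrier V" 
    using submodule.subset[OF assms(2)] submodule.subset[OF assms(3)] by auto
  have "A \<subseteq> span B" using assms(4) in_own_span[OF AV(2)] by auto
  then obtain U C where UC: "finite C" "span U = span A" "span (U \<union> C) = span B"
    "card U = span_dim A" "card U + card C = span_dim B"
    by (rule extend_basis[OF assms(1) AV])
  then have "card C = 0" using assms(5) by linarith
  then have "C = {}" using UC(1) by simp
  then show ?thesis using UC span_submodule[OF assms(2)] span_submodule[OF assms(3)] by simp
qed

end

section \<open>Semilinear maps and images of spans\<close>

text \<open>
  A q-matroid and a representation of it live over different fields \<open>K\<close> and \<open>L\<close>. The map from the
  ground space to \<open>L\<^sup>k\<close> that a matrix over \<open>L\<close> induces is therefore linear only along the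
  homomorphism \<open>h\<close> from \<open>K\<close> to \<open>L\<close>.
\<close>
locale semilinear_map = V: vectorspace K V + W: vectorspace L W
  for K :: "('a, 'b) ring_scheme" and V :: "('a, 'c, 'd) module_scheme"
    and L :: "('e, 'f) ring_scheme" and W :: "('e, 'g, 'i) module_scheme" +
  fixes h :: "'a \<Rightarrow> 'e" and \<gamma> :: "'c \<Rightarrow> 'g"
  assumes h: "h \<in> Ring.ring_hom K L"
    and closed: "v \<in> carrier V \<Longrightarrow> \<gamma> v \<in> carrier W"
    and add: "v \<in> carrier V \<Longrightarrow> w \<in> carrier V \<Longrightarrow> \<gamma> (v \<oplus>\<^bsub>V\<^esub> w) = \<gamma> v \<oplus>\<^bsub>W\<^esub> \<gamma> w"
    and smult: "c \<in> carrier K \<Longrightarrow> v \<in> carrier V \<Longrightarrow> \<gamma> (c \<odot>\<^bsub>V\<^esub> v) = h c \<odot>\<^bsub>W\<^esub> \<gamma> v"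
begin

lemma zero: "\<gamma> \<zero>\<^bsub>V\<^esub> = \<zero>\<^bsub>W\<^esub>"
  using add[of "\<zero>\<^bsub>V\<^esub>" "\<zero>\<^bsub>V\<^esub>"] closed[of "\<zero>\<^bsub>V\<^esub>"] by simp

lemma image_span_subset:
  assumes S: "S \<subseteq> carrier V"
  shows "\<gamma> ` V.span S \<subseteq> W.span (\<gamma> ` S)"
proof -
  have gS: "\<gamma> ` S \<subseteq> carrier W" using S closed by auto
  have sub: "submodule L (W.span (\<gamma> ` S)) W" by (rule W.span_is_submodule[OF gS])
  have "submodule K {v \<in> carrier V. \<gamma> v \<in> W.span (\<gamma> ` S)} V"
  proof (rule submodule.intro)
    show "Module.module K V" by (rule V.module_axioms)
  next
    fix c v assume "c \<in> carrier K" "v \<in> {v \<in> carrier V. \<gamma> v \<in> W.span (\<gamma> ` S)}"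
    then show "c \<odot>\<^bsub>V\<^esub> v \<in> {v \<in> carrier V. \<gamma> v \<in> W.span (\<gamma> ` S)}"
      using smult submodule.smult_closed[OF sub] ring_hom_closed[OF h] by auto
  qed (use add zero submodule.m_closed[OF sub] submodule.zero_closed[OF sub] in auto)
  moreover have "S \<subseteq> {v \<in> carrier V. \<gamma> v \<in> W.span (\<gamma> ` S)}"
    using S W.in_own_span[OF gS] by auto
  ultimately show ?thesis using V.span_is_subset by blast
qed

lemma span_image_cong:
  assumes "S \<subseteq> carrier V" "T \<subseteq> carrier V" "V.span S = V.span T"
  shows "W.span (\<gamma> ` S) = W.span (\<gamma> ` T)"
proof -
  have "W.span (\<gamma> ` S) \<subseteq> W.span (\<gamma> ` T)"
    if "S \<subseteq> carrier V" "T \<subseteq> carrier V" "V.span S = V.span T" for S T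
  proof (rule W.span_le_span)
    show "\<gamma> ` S \<subseteq> W.span (\<gamma> ` T)"
      using image_span_subset[OF that(2)] that(3) V.in_own_span[OF that(1)] by auto
  qed (use that closed in auto)
  then show ?thesis using assms by blast
qed

text \<open>
  Passing from \<open>A\<close> to \<open>B\<close> takes \<open>dim B - dim A\<close> further generators, and each of them raises the
  rank of the image by at most one. This bounds the image rank of a large subspace from above and,
  read from right to left, that of a small subspace from below.
\<close>
lemma span_dim_image_increase:
  assumes fd: "V.fin_dim" "W.fin_dim" and AB: "A \<subseteq> carrier V" "B \<subseteq> carrier V" "A \<subseteq> V.span B"
  shows "W.span_dim (\<gamma> ` B) + V.span_dim A \<le> W.span_dim (\<gamma> ` A) + V.span_dim B"
proof -
  obtain U C where UC: "U \<subseteq> A" "finite C" "C \<subseteq> V.span B" "V.span U = V.span A"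
      "V.span (U \<union> C) = V.span B" "card U = V.span_dim A" "card U + card C = V.span_dim B"
    by (rule V.extend_basis[OF fd(1) AB])
  have car: "U \<subseteq> carrier V" "C \<subseteq> carrier V"
    using UC AB V.span_is_subset2[OF AB(2)] by auto
  have g: "\<gamma> ` U \<subseteq> carrier W" "\<gamma> ` C \<subseteq> carrier W" using car closed by auto
  have "W.span_dim (\<gamma> ` B) = W.span_dim (\<gamma> ` U \<union> \<gamma> ` C)"
    unfolding image_Un[symmetric]
    by (rule W.span_dim_cong[OF span_image_cong]) (use UC car AB in auto)
  also have "\<dots> \<le> W.span_dim (\<gamma> ` U) + W.span_dim (\<gamma> ` C)"
    by (rule W.span_dim_Un[OF fd(2) g])
  also have "W.span_dim (\<gamma> ` U) = W.span_dim (\<gamma> ` A)"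
    by (rule W.span_dim_cong[OF span_image_cong]) (use UC car AB in auto)
  also have "W.span_dim (\<gamma> ` C) \<le> card C"
    using W.span_dim_le_card[OF fd(2) g(2)] UC card_image_le[of C \<gamma>] by simp
  finally show ?thesis using UC by simp
qed

lemma span_dim_image_le:
  assumes fd: "V.fin_dim" "W.fin_dim" and A: "A \<subseteq> carrier V"
  shows "W.span_dim (\<gamma> ` A) \<le> V.span_dim A"
  using span_dim_image_increase[OF fd _ A, of "{}"] W.span_dim_eq_0_iff[OF fd(2), of "{}"] by simp

end

section \<open>Matrices over an extension field\<close>

definition (in ring) unit_fun :: "nat \<Rightarrow> nat \<Rightarrow> nat \<Rightarrow> 'a" where
  "unit_fun k i = (\<lambda>j\<in>{..<k}. if j = i then \<one> else \<zero>)"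

context field
begin

lemma func_space_vectorspace: "vectorspace R (func_space S)"
  unfolding vectorspace_def using func_space_is_module field_axioms by blast

lemma unit_fun_closed: "unit_fun k i \<in> carrier (func_space {..<k})"
  by (auto simp: unit_fun_def func_space_def)

text \<open>
  Induction on \<open>j\<close>, splitting off the coordinate with index \<open>j\<close>.
\<close>
lemma supported_in_span:
  assumes "f \<in> carrier (func_space {..<k})" "\<And>i. i < k \<Longrightarrow> j \<le> i \<Longrightarrow> f i = \<zero>"
  shows "f \<in> LinearCombinations.module.span R (func_space {..<k}) (unit_fun k ` {..<j})"
  using assms
proof (induction j arbitrary: f)
  interpret W: vectorspace R "func_space {..<k}" by (rule func_space_vectorspace)
  case 0
  then have "f = \<zero>\<^bsub>func_space {..<k}\<^esub>"
    by (auto simp: func_space_def PiE_def extensional_def restrict_def fun_eq_iff)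
  then show ?case using W.span_zero by simp
next
  interpret W: vectorspace R "func_space {..<k}" by (rule func_space_vectorspace)
  case (Suc j)
  have sub: "unit_fun k ` {..<Suc j} \<subseteq> carrier (func_space {..<k})"
    using unit_fun_closed by auto
  have f: "f \<in> {..<k} \<rightarrow>\<^sub>E carrier R" using Suc.prems(1) by (simp add: func_space_def)
  define g where "g = (\<lambda>i\<in>{..<k}. if i = j then \<zero> else f i)"
  have gc: "g \<in> carrier (func_space {..<k})"
    unfolding func_space_def partial_object.simps g_def restrict_PiE_iff
    using PiE_mem[OF f] by auto
  have "g i = \<zero>" if "i < k" "j \<le> i" for i
    using Suc.prems(2)[of i] that by (cases "i = j") (auto simp: g_def)
  then have "g \<in> W.span (unit_fun k ` {..<j})" using Suc.IH gc by blast
  then have g: "g \<in> W.span (unit_fun k ` {..<Suc j})"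
    using W.span_is_monotone[OF image_mono[of "{..<j}" "{..<Suc j}" "unit_fun k"]] by auto
  show ?case
  proof (cases "j < k")
    case True
    have u: "unit_fun k j \<in> W.span (unit_fun k ` {..<Suc j})"
      using W.in_own_span[OF sub] by auto
    have fj: "f j \<in> carrier R" using f True by auto
    have "f = g \<oplus>\<^bsub>func_space {..<k}\<^esub> (f j \<odot>\<^bsub>func_space {..<k}\<^esub> unit_fun k j)"
    proof
      fix i show "f i = (g \<oplus>\<^bsub>func_space {..<k}\<^esub> (f j \<odot>\<^bsub>func_space {..<k}\<^esub> unit_fun k j)) i"
        using fj True PiE_mem[OF f, of i] PiE_arb[OF f, of i]
        by (cases "i < k"; cases "i = j") (simp_all add: g_def unit_fun_def func_space_def)
    qed
    moreover have "f j \<odot>\<^bsub>func_space {..<k}\<^esub> unit_fun k j \<in> W.span (unit_fun k ` {..<Suc j})"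
      using submodule.smult_closed[OF W.span_is_submodule[OF sub] fj u] .
    ultimately show ?thesis
      using submodule.m_closed[OF W.span_is_submodule[OF sub] g] by metis
  next
    case False
    then have "f = g"
      using f by (auto simp: g_def fun_eq_iff PiE_def extensional_def)
    then show ?thesis using g by simp
  qed
qed

lemma func_space_span_unit_fun:
  "LinearCombinations.module.span R (func_space {..<k}) (unit_fun k ` {..<k}) = carrier (func_space {..<k})"
proof -
  interpret W: vectorspace R "func_space {..<k}" by (rule func_space_vectorspace)
  show ?thesis
    using supported_in_span[of _ k k] W.span_is_subset2[of "unit_fun k ` {..<k}"] unit_fun_closed
    by force
qed

lemma func_space_fin_dim:
  fixes k :: nat
  shows "vectorspace.fin_dim R (func_space {..<k})"
proof -
  interpret W: vectorspace R "func_space {..<k}" by (rule func_space_vectorspace)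
  show ?thesis unfolding W.fin_dim_def
  proof (intro exI conjI)
    show "unit_fun k ` {..<k} \<subseteq> carrier (func_space {..<k})"
      using unit_fun_closed by auto
    show "W.span (unit_fun k ` {..<k}) = carrier (func_space {..<k})"
      by (rule func_space_span_unit_fun)
  qed simp
qed

lemma span_dim_supported:
  assumes "S \<subseteq> carrier (func_space {..<k})" "\<And>f i. f \<in> S \<Longrightarrow> i < k \<Longrightarrow> j \<le> i \<Longrightarrow> f i = \<zero>"
  shows "vectorspace.span_dim R (func_space {..<k}) S \<le> j"
proof -
  interpret W: vectorspace R "func_space {..<k}" by (rule func_space_vectorspace)
  have u: "unit_fun k ` {..<j} \<subseteq> carrier (func_space {..<k})" using unit_fun_closed by auto
  have "W.span_dim S \<le> W.span_dim (unit_fun k ` {..<j})"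
    using W.span_dim_mono[OF func_space_fin_dim assms(1) u] supported_in_span assms by blast
  also have "\<dots> \<le> card (unit_fun k ` {..<j})"
    using W.span_dim_le_card[OF func_space_fin_dim u] by simp
  also have "\<dots> \<le> j" using card_image_le[of "{..<j}" "unit_fun k"] by simp
  finally show ?thesis .
qed

end

text \<open>
  Reading a vector as a function of its indices identifies the space of functions with a space of
  vectors, whose dimension is known.
\<close>
lemma dim_func_space_class_ring:
  "vectorspace.dim (class_ring :: 'l::field ring) (ring.func_space class_ring {..<k}) = k"
proof -
  note fs = ring.func_space_def[OF class_ring.ring_axioms]
  let ?T = "\<lambda>v :: 'l vec. \<lambda>i\<in>{..<k}. v $ i"
  have hom: "?T \<in> LinearCombinations.module_hom (class_ring :: 'l ring) (module_vec TYPE('l) k) (ring.func_space class_ring {..<k})"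
    unfolding LinearCombinations.module_hom_def fs module_vec_simps
      partial_object.simps ring.simps module.simps monoid.simps mem_Collect_eq
  proof (intro conjI allI impI Pi_I)
    fix v w :: "'l vec" assume "v \<in> carrier_vec k \<and> w \<in> carrier_vec k"
    then show "?T (v + w) = (\<lambda>i\<in>{..<k}. ?T v i + ?T w i)"
      by (intro restrict_ext) auto
  next
    fix c :: 'l and v :: "'l vec" assume "c \<in> UNIV \<and> v \<in> carrier_vec k"
    then show "?T (c \<cdot>\<^sub>v v) = (\<lambda>i\<in>{..<k}. c * ?T v i)"
      by (intro restrict_ext) auto
  next
    fix v :: "'l vec" show "?T v \<in> {..<k} \<rightarrow>\<^sub>E UNIV" by simp
  qed
  interpret W: vectorspace "class_ring :: 'l ring" "ring.func_space class_ring {..<k}"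
    by (rule field.func_space_vectorspace[OF class_field])
  interpret V: vec_space "TYPE('l)" k .
  interpret T: linear_map "class_ring :: 'l ring" "module_vec TYPE('l) k" "ring.func_space class_ring {..<k}" ?T
    by (rule linear_map.intro[OF vec_vs W.vectorspace_axioms])
      (rule mod_hom.intro[OF vec_module W.module_axioms mod_hom_axioms.intro[OF hom]])
  have "inj_on ?T (carrier (module_vec TYPE('l) k))"
  proof (rule inj_onI)
    fix v w assume vw: "v \<in> carrier (module_vec TYPE('l) k)" "w \<in> carrier (module_vec TYPE('l) k)" "?T v = ?T w"
    have "v $ i = w $ i" if "i < k" for i
      using fun_cong[OF vw(3), of i] that by simp
    then show "v = w" using vw(1,2) by (intro eq_vecI) (auto simp: module_vec_simps)
  qed
  moreover have "?T ` carrier (module_vec TYPE('l) k) = carrier (ring.func_space class_ring {..<k})"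
  proof (intro equalityI subsetI)
    fix f :: "nat \<Rightarrow> 'l" assume f: "f \<in> carrier (ring.func_space class_ring {..<k})"
    then have "f = ?T (vec k f)"
      using PiE_arb[of f "{..<k}"] by (auto simp: fs fun_eq_iff)
    then show "f \<in> ?T ` carrier (module_vec TYPE('l) k)"
      by (intro image_eqI[of _ _ "vec k f"]) (auto simp: module_vec_simps)
  next
    fix f assume "f \<in> ?T ` carrier (module_vec TYPE('l) k)"
    then obtain v where "f = ?T v" by auto
    then show "f \<in> carrier (ring.func_space class_ring {..<k})" unfolding fs by simp
  qed
  ultimately have "vectorspace.dim class_ring (module_vec TYPE('l) k)
      = vectorspace.dim (class_ring :: 'l ring) (ring.func_space class_ring {..<k})"
    by (rule linear_map.dim_eq[OF T.linear_map_axioms V.fin_dim])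
  then show ?thesis unfolding V.dim_is_n ..
qed

text \<open>
  The linear extension of \<open>h\<close> followed by \<open>G\<close>: the columns of \<open>G Y\<close> are the images under this
  map of the columns of \<open>Y\<close>.
\<close>
definition mat_map :: "'l ring \<Rightarrow> ('k \<Rightarrow> 'l) \<Rightarrow> 'l mat \<Rightarrow> 'k vec \<Rightarrow> nat \<Rightarrow> 'l" where
  "mat_map L h G x = (\<lambda>i\<in>{..<dim_row G}. \<Oplus>\<^bsub>L\<^esub>l\<in>{..<dim_col G}. G $$ (i, l) \<otimes>\<^bsub>L\<^esub> h (x $ l))"

lemma semilinear_mat_map:
  fixes L :: "'l ring" and h :: "'k::field \<Rightarrow> 'l"
  assumes L: "field L" and h: "h \<in> Ring.ring_hom class_ring L"
    and G: "G \<in> carrier_mat k n" "elements_mat G \<subseteq> carrier L"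
  shows "semilinear_map class_ring (module_vec TYPE('k) n) L (ring.func_space L {..<k}) h (mat_map L h G)"
proof -
  interpret L: field L by (rule L)
  interpret W: vectorspace L "L.func_space {..<k}" by (rule L.func_space_vectorspace)
  interpret V: vec_space "TYPE('k)" n .
  have hc: "h c \<in> carrier L" for c using ring_hom_closed[OF h] by simp
  have ha: "h (c + d) = h c \<oplus>\<^bsub>L\<^esub> h d" for c d using ring_hom_add[OF h] by simp
  have hm: "h (c * d) = h c \<otimes>\<^bsub>L\<^esub> h d" for c d using ring_hom_mult[OF h] by simp
  have Gc: "G $$ (i, l) \<in> carrier L" if "i < k" "l < n" for i l
    using elements_matI[OF G(1) that refl] G(2) by auto
  have d: "dim_row G = k" "dim_col G = n" using G by auto
  show ?thesis
  proof (unfold_locales)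
    show "h \<in> Ring.ring_hom class_ring L" by (rule h)
  next
    fix v assume "v \<in> carrier (module_vec TYPE('k) n)"
    show "mat_map L h G v \<in> carrier (L.func_space {..<k})"
      unfolding mat_map_def d L.func_space_def by (auto intro!: L.finsum_closed Gc hc)
  next
    fix v w assume vw: "v \<in> carrier (module_vec TYPE('k) n)" "w \<in> carrier (module_vec TYPE('k) n)"
    show "mat_map L h G (v \<oplus>\<^bsub>module_vec TYPE('k) n\<^esub> w)
        = mat_map L h G v \<oplus>\<^bsub>L.func_space {..<k}\<^esub> mat_map L h G w"
    proof
      fix i
      show "mat_map L h G (v \<oplus>\<^bsub>module_vec TYPE('k) n\<^esub> w) i
          = (mat_map L h G v \<oplus>\<^bsub>L.func_space {..<k}\<^esub> mat_map L h G w) i"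
      proof (cases "i < k")
        case True
        have "(\<Oplus>\<^bsub>L\<^esub>l\<in>{..<n}. G $$ (i, l) \<otimes>\<^bsub>L\<^esub> h ((v + w) $ l))
            = (\<Oplus>\<^bsub>L\<^esub>l\<in>{..<n}. G $$ (i, l) \<otimes>\<^bsub>L\<^esub> h (v $ l) \<oplus>\<^bsub>L\<^esub> G $$ (i, l) \<otimes>\<^bsub>L\<^esub> h (w $ l))"
          using vw True by (intro L.finsum_cong') (auto simp: module_vec_simps ha hc Gc L.r_distr)
        also have "\<dots> = (\<Oplus>\<^bsub>L\<^esub>l\<in>{..<n}. G $$ (i, l) \<otimes>\<^bsub>L\<^esub> h (v $ l))
            \<oplus>\<^bsub>L\<^esub> (\<Oplus>\<^bsub>L\<^esub>l\<in>{..<n}. G $$ (i, l) \<otimes>\<^bsub>L\<^esub> h (w $ l))"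
          using True by (intro L.finsum_addf) (auto simp: hc Gc)
        finally show ?thesis using True
          by (simp add: mat_map_def d L.func_space_def module_vec_simps)
      qed (simp add: mat_map_def d L.func_space_def)
    qed
  next
    fix c v assume cv: "c \<in> carrier (class_ring :: 'k ring)" "v \<in> carrier (module_vec TYPE('k) n)"
    show "mat_map L h G (c \<odot>\<^bsub>module_vec TYPE('k) n\<^esub> v)
        = h c \<odot>\<^bsub>L.func_space {..<k}\<^esub> mat_map L h G v"
    proof
      fix i
      show "mat_map L h G (c \<odot>\<^bsub>module_vec TYPE('k) n\<^esub> v) i
          = (h c \<odot>\<^bsub>L.func_space {..<k}\<^esub> mat_map L h G v) i"
      proof (cases "i < k")
        case True
        have "(\<Oplus>\<^bsub>L\<^esub>l\<in>{..<n}. G $$ (i, l) \<otimes>\<^bsub>L\<^esub> h ((c \<cdot>\<^sub>v v) $ l))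
            = (\<Oplus>\<^bsub>L\<^esub>l\<in>{..<n}. h c \<otimes>\<^bsub>L\<^esub> (G $$ (i, l) \<otimes>\<^bsub>L\<^esub> h (v $ l)))"
          using cv True by (intro L.finsum_cong') (auto simp: module_vec_simps hm hc Gc L.m_lcomm)
        also have "\<dots> = h c \<otimes>\<^bsub>L\<^esub> (\<Oplus>\<^bsub>L\<^esub>l\<in>{..<n}. G $$ (i, l) \<otimes>\<^bsub>L\<^esub> h (v $ l))"
          using True by (intro L.finsum_rdistr[symmetric]) (auto simp: hc Gc)
        finally show ?thesis using True
          by (simp add: mat_map_def d L.func_space_def module_vec_simps)
      qed (simp add: mat_map_def d L.func_space_def)
    qed
  qed
qed

text \<open>
  The \<open>L\<close>-span of the image of a set depends only on the \<open>K\<close>-span of the set, so the rank of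
  \<open>G Y\<close> depends only on the column space of \<open>Y\<close>.
\<close>
lemma mat_rank_mat_mult:
  fixes L :: "'l ring" and h :: "'k::field \<Rightarrow> 'l"
  assumes L: "field L" and h: "h \<in> Ring.ring_hom class_ring L"
    and G: "G \<in> carrier_mat k n" "elements_mat G \<subseteq> carrier L"
    and Y: "Y \<in> carrier_mat n m"
  shows "mat_rank L (mat_mult L G (map_mat h Y))
    = vectorspace.span_dim L (ring.func_space L {..<k}) (mat_map L h G ` vec_space.col_space n Y)"
proof -
  interpret L: field L by (rule L)
  interpret s: semilinear_map class_ring "module_vec TYPE('k) n" L "ring.func_space L {..<k}" h "mat_map L h G"
    by (rule semilinear_mat_map[OF L h G])
  interpret V: vec_space "TYPE('k)" n .
  have hc: "h c \<in> carrier L" for c using ring_hom_closed[OF h] by simp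
  have Gc: "G $$ (i, l) \<in> carrier L" if "i < k" "l < n" for i l
    using elements_matI[OF G(1) that refl] G(2) by auto
  have colY: "set (cols Y) \<subseteq> carrier_vec n" using Y cols_dim by blast
  have c: "{\<lambda>i\<in>{..<k}. mat_mult L G (map_mat h Y) $$ (i, j) |j. j < m} = mat_map L h G ` set (cols Y)"
  proof -
    have "(\<lambda>i\<in>{..<k}. mat_mult L G (map_mat h Y) $$ (i, j)) = mat_map L h G (col Y j)" if "j < m" for j
      using that G(1) Y hc Gc
      by (auto simp: mat_map_def mat_mult_def fun_eq_iff intro!: L.finsum_cong')
    then have "(\<lambda>j. \<lambda>i\<in>{..<k}. mat_mult L G (map_mat h Y) $$ (i, j)) ` {..<m}
        = (\<lambda>j. mat_map L h G (col Y j)) ` {..<m}"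
      by (intro image_cong) auto
    also have "\<dots> = mat_map L h G ` set (cols Y)"
      using Y by (auto simp: cols_def)
    finally show ?thesis by blast
  qed
  have "mat_rank L (mat_mult L G (map_mat h Y)) = s.W.span_dim (mat_map L h G ` set (cols Y))"
    unfolding mat_rank_def s.W.span_dim_def c[symmetric] using G Y by (simp add: mat_mult_def Let_def)
  also have "\<dots> = s.W.span_dim (mat_map L h G ` vec_space.col_space n Y)"
  proof (rule s.W.span_dim_cong[OF s.span_image_cong])
    show car: "set (cols Y) \<subseteq> carrier (module_vec TYPE('k) n)"
      using colY by (simp add: module_vec_simps)
    show "V.col_space Y \<subseteq> carrier (module_vec TYPE('k) n)"
      unfolding V.col_space_def by (rule s.V.span_is_subset2[OF car])
    show "s.V.span (set (cols Y)) = s.V.span (V.col_space Y)"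
      unfolding V.col_space_def by (rule s.V.span_submodule[OF s.V.span_is_submodule[OF car], symmetric])
  qed
  finally show ?thesis .
qed

lemma submodule_image:
  assumes "mod_hom R M N f" "submodule R A M"
  shows "submodule R (f ` A) N"
proof -
  interpret mod_hom R M N f by (rule assms)
  interpret A: submodule R A M by (rule assms)
  show ?thesis
  proof (rule submodule.intro)
    show "Module.module R N" by (rule N.module_axioms)
    show "f ` A \<subseteq> carrier N" using A.subset by auto
    show "\<zero>\<^bsub>N\<^esub> \<in> f ` A" using f0_is_0 A.zero_closed by (metis imageI)
  next
    fix v w assume "v \<in> f ` A" "w \<in> f ` A"
    then obtain x y where "x \<in> A" "y \<in> A" "v = f x" "w = f y" by auto
    then show "v \<oplus>\<^bsub>N\<^esub> w \<in> f ` A"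
      using f_add[of x y] A.subset A.m_closed by (metis imageI subsetD)
  next
    fix c v assume "c \<in> carrier R" "v \<in> f ` A"
    then obtain x where "x \<in> A" "v = f x" by auto
    then show "c \<odot>\<^bsub>N\<^esub> v \<in> f ` A"
      using f_smult[of c x] A.subset A.smult_closed \<open>c \<in> carrier R\<close> by (metis imageI subsetD)
  qed
qed

lemma ex_col_space:
  fixes A :: "'k::field vec set"
  assumes "submodule class_ring A (module_vec TYPE('k) n)"
  obtains m Y where "Y \<in> carrier_mat n m" "vec_space.col_space n Y = A"
proof -
  interpret V: vec_space "TYPE('k)" n .
  have A: "A \<subseteq> carrier_vec n" using submodule.subset[OF assms] by (simp add: module_vec_simps)
  obtain U where U: "U \<subseteq> A" "finite U" "V.span U = V.span A"
    using V.basis_of_span[OF V.fin_dim A] .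
  obtain us where us: "set us = U" using finite_list U(2) by blast
  have "cols (mat_of_cols n us) = us" using us U A by (intro cols_mat_of_cols) auto
  then have "V.col_space (mat_of_cols n us) = A"
    unfolding V.col_space_def using us U V.span_submodule[OF assms] by simp
  then show ?thesis using that mat_of_cols_carrier(1) by blast
qed

section \<open>Coordinates adapted to a subspace\<close>

text \<open>
  Extend a basis of \<open>A\<close> to a basis of \<open>V\<close> and number it so that the basis of \<open>A\<close> comes first.
\<close>
lemma adapted_coordinates:
  fixes V :: "('k::field, 'v) module"
  assumes V: "vectorspace class_ring V" and fd: "vectorspace.fin_dim class_ring V"
    and A: "submodule class_ring A V"
    and n: "n = vectorspace.dim class_ring V" and m: "m = vectorspace.span_dim class_ring V A"
  obtains \<phi> where "linear_map class_ring V (module_vec TYPE('k) n) \<phi>"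
    "bij_betw \<phi> (carrier V) (carrier_vec n)"
    "\<phi> ` A = {x \<in> carrier_vec n. \<forall>i<n. m \<le> i \<longrightarrow> x $ i = 0}" "m \<le> n"
proof -
  interpret V: vectorspace class_ring V by (rule V)
  have AV: "A \<subseteq> carrier V" using submodule.subset[OF A] .
  obtain U C where UC: "U \<subseteq> A" "finite U" "finite C" "C \<subseteq> V.span (carrier V)" "U \<inter> C = {}"
      "V.lin_indpt (U \<union> C)" "V.span U = V.span A" "V.span (U \<union> C) = V.span (carrier V)"
      "card U = V.span_dim A" "card U + card C = V.span_dim (carrier V)"
    by (rule V.extend_basis[OF fd AV subset_refl]) (use AV V.in_own_span[of "carrier V"] in auto)
  have cV: "V.span (carrier V) = carrier V"
    using V.span_is_subset2[of "carrier V"] V.in_own_span[of "carrier V"] by auto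
  have UV: "U \<subseteq> carrier V" and CV: "C \<subseteq> carrier V" using UC AV cV by auto
  let ?B = "U \<union> C"
  have B: "finite ?B" "?B \<subseteq> carrier V" using UC UV CV by auto
  have cards: "card U = m" "card U + card C = n" using UC m n V.span_dim_carrier by auto
  have "card U = card {..<m}" "card C = card {m..<n}" using cards by auto
  then obtain f g where fg: "bij_betw f U {..<m}" "bij_betw g C {m..<n}"
    using finite_same_card_bij[OF UC(2), of "{..<m}"] finite_same_card_bij[OF UC(3), of "{m..<n}"] by auto
  define idx where "idx = (\<lambda>b. if b \<in> U then f b else g b)"
  have mn: "m \<le> n" using cards by auto
  have "bij_betw idx ?B ({..<m} \<union> {m..<n})"
    unfolding idx_def by (rule bij_betw_disjoint_Un[OF fg UC(5)]) auto
  moreover have "{..<m} \<union> {m..<n} = {..<n}" using mn by auto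
  ultimately have idx: "bij_betw idx ?B {..<n}" by simp
  have idxn: "idx b < n" if "b \<in> ?B" for b using bij_betwE[OF idx] that by auto
  have idxU: "idx b < m \<longleftrightarrow> b \<in> U" if "b \<in> ?B" for b
    using bij_betwE[OF fg(1)] bij_betwE[OF fg(2)] that UC(5) by (auto simp: idx_def)
  define bvec where "bvec = the_inv_into ?B idx"
  have at: "bvec i \<in> ?B" "idx (bvec i) = i" if "i < n" for i
    using that idx f_the_inv_into_f_bij_betw[OF idx] the_inv_into_into[of idx ?B i ?B]
    by (auto simp: bvec_def bij_betw_def)
  \<comment> \<open>The inverse of the coordinate map is the easier one to write down.\<close>
  define \<psi> where "\<psi> x = V.lincomb (\<lambda>b. x $ idx b) ?B" for x :: "'k vec"
  have \<psi>V: "\<psi> x \<in> carrier V" for x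
    unfolding \<psi>_def using V.lincomb_closed[OF B(2)] by simp
  have \<psi>_add: "\<psi> (x + y) = \<psi> x \<oplus>\<^bsub>V\<^esub> \<psi> y" if "x \<in> carrier_vec n" "y \<in> carrier_vec n" for x y
  proof -
    have "\<psi> (x + y) = V.lincomb (\<lambda>b. x $ idx b \<oplus>\<^bsub>class_ring\<^esub> y $ idx b) ?B"
      unfolding \<psi>_def by (rule V.lincomb_cong[OF refl B(2)]) (use idxn that in auto)
    also have "\<dots> = \<psi> x \<oplus>\<^bsub>V\<^esub> \<psi> y"
      unfolding \<psi>_def by (rule V.lincomb_sum[OF B]) auto
    finally show ?thesis .
  qed
  have \<psi>_smult: "\<psi> (c \<cdot>\<^sub>v x) = c \<odot>\<^bsub>V\<^esub> \<psi> x" if "x \<in> carrier_vec n" for c x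
  proof -
    have "\<psi> (c \<cdot>\<^sub>v x) = V.lincomb (\<lambda>b. c \<otimes>\<^bsub>class_ring\<^esub> x $ idx b) ?B"
      unfolding \<psi>_def by (rule V.lincomb_cong[OF refl B(2)]) (use idxn that in auto)
    also have "\<dots> = c \<odot>\<^bsub>V\<^esub> \<psi> x"
      unfolding \<psi>_def by (rule V.lincomb_smult[OF B(2)]) auto
    finally show ?thesis .
  qed
  have \<psi>_vec: "\<psi> (vec n (\<lambda>i. a (bvec i))) = V.lincomb a ?B" for a
  proof -
    have "bvec (idx b) = b" if "b \<in> ?B" for b
      unfolding bvec_def using the_inv_into_f_f[of idx ?B b] idx that by (auto simp: bij_betw_def)
    then show ?thesis
      unfolding \<psi>_def by (intro V.lincomb_cong[OF refl B(2)]) (use idxn in auto)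
  qed
  have surj: "\<psi> ` carrier_vec n = carrier V"
  proof (intro equalityI subsetI)
    fix v assume "v \<in> carrier V"
    then have "v \<in> V.span ?B" using UC(8) cV by simp
    then obtain a where "V.lincomb a ?B = v" using V.finite_in_span[OF B] by auto
    then show "v \<in> \<psi> ` carrier_vec n"
      using \<psi>_vec[of a] by (intro image_eqI[of _ _ "vec n (\<lambda>i. a (bvec i))"]) auto
  qed (use \<psi>V in auto)
  have inj: "inj_on \<psi> (carrier_vec n)"
  proof (rule inj_onI)
    fix x y assume xy: "x \<in> carrier_vec n" "y \<in> carrier_vec n" "\<psi> x = \<psi> y"
    let ?d = "x + (- 1) \<cdot>\<^sub>v y"
    have "\<psi> ?d = \<psi> x \<oplus>\<^bsub>V\<^esub> (- 1) \<odot>\<^bsub>V\<^esub> \<psi> y" using xy by (simp add: \<psi>_add \<psi>_smult)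
    also have "\<dots> = 1 \<odot>\<^bsub>V\<^esub> \<psi> y \<oplus>\<^bsub>V\<^esub> (- 1) \<odot>\<^bsub>V\<^esub> \<psi> y"
      using V.smult_one[OF \<psi>V[of y]] xy by simp
    also have "\<dots> = (1 + (- 1)) \<odot>\<^bsub>V\<^esub> \<psi> y"
      using V.smult_l_distr[of 1 "- 1" "\<psi> y"] \<psi>V by simp
    also have "\<dots> = \<zero>\<^bsub>V\<^esub>" using V.lmult_0[OF \<psi>V[of y]] by simp
    finally have "V.lincomb (\<lambda>b. ?d $ idx b) ?B = \<zero>\<^bsub>V\<^esub>" unfolding \<psi>_def .
    then have "(\<lambda>b. ?d $ idx b) \<in> ?B \<rightarrow> {0}"
      using V.not_lindepD[OF UC(6) B(1) subset_refl, of "\<lambda>b. ?d $ idx b"] by simp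
    then have d: "?d $ idx b = 0" if "b \<in> ?B" for b using that by auto
    have "x $ i = y $ i" if "i < n" for i
      using d[OF at(1)[OF that]] at(2)[OF that] xy that by simp
    then show "x = y" using xy by (intro eq_vecI) auto
  qed
  have bij: "bij_betw \<psi> (carrier_vec n) (carrier V)" using inj surj by (simp add: bij_betw_def)
  define \<phi> where "\<phi> = the_inv_into (carrier_vec n) \<psi>"
  have \<phi>bij: "bij_betw \<phi> (carrier V) (carrier_vec n)"
    unfolding \<phi>_def by (rule bij_betw_the_inv_into[OF bij])
  have \<phi>c: "\<phi> v \<in> carrier_vec n" and \<psi>\<phi>: "\<psi> (\<phi> v) = v" if "v \<in> carrier V" for v
    using bij_betwE[OF \<phi>bij] f_the_inv_into_f_bij_betw[OF bij, of v] that by (auto simp: \<phi>_def)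
  have \<phi>\<psi>: "\<phi> (\<psi> x) = x" if "x \<in> carrier_vec n" for x
    unfolding \<phi>_def by (rule the_inv_into_f_f[OF inj that])
  have hom: "\<phi> \<in> LinearCombinations.module_hom class_ring V (module_vec TYPE('k) n)"
    unfolding LinearCombinations.module_hom_def module_vec_simps
  proof (intro CollectI conjI allI impI Pi_I)
    fix v w assume "v \<in> carrier V \<and> w \<in> carrier V"
    then show "\<phi> (v \<oplus>\<^bsub>V\<^esub> w) = \<phi> v + \<phi> w"
      using \<phi>\<psi>[of "\<phi> v + \<phi> w"] \<psi>_add[of "\<phi> v" "\<phi> w"] \<phi>c \<psi>\<phi> by simp
  next
    fix c :: 'k and v assume "c \<in> carrier class_ring \<and> v \<in> carrier V"
    then show "\<phi> (c \<odot>\<^bsub>V\<^esub> v) = c \<cdot>\<^sub>v \<phi> v"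
      using \<phi>\<psi>[of "c \<cdot>\<^sub>v \<phi> v"] \<psi>_smult[of "\<phi> v" c] \<phi>c \<psi>\<phi> by simp
  qed (rule \<phi>c)
  have lin: "linear_map class_ring V (module_vec TYPE('k) n) \<phi>"
    by (rule linear_map.intro[OF V vec_vs])
      (rule mod_hom.intro[OF V.module_axioms vec_module mod_hom_axioms.intro[OF hom]])
  have spA: "V.span U = A" using UC(7) V.span_submodule[OF A] by simp
  have "\<psi> ` {x \<in> carrier_vec n. \<forall>i<n. m \<le> i \<longrightarrow> x $ i = 0} = A"
  proof (intro equalityI subsetI)
    fix v assume "v \<in> \<psi> ` {x \<in> carrier_vec n. \<forall>i<n. m \<le> i \<longrightarrow> x $ i = 0}"
    then obtain x where x: "x \<in> carrier_vec n" "\<forall>i<n. m \<le> i \<longrightarrow> x $ i = 0" "v = \<psi> x" by auto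
    have "x $ idx b = 0" if "b \<in> C" for b
    proof -
      have "b \<notin> U" using UC(5) that by auto
      then show ?thesis using x(2) idxn[of b] idxU[of b] that by (simp add: not_less)
    qed
    then have "V.lincomb (\<lambda>b. x $ idx b) C = \<zero>\<^bsub>V\<^esub>"
      using V.lincomb_zero[OF CV, of "\<lambda>b. x $ idx b"] by simp
    then have "v = V.lincomb (\<lambda>b. x $ idx b) U"
      unfolding x(3) \<psi>_def using V.lincomb_union[OF UV CV UC(5) UC(2) UC(3), of "\<lambda>b. x $ idx b"] V.lincomb_closed[OF UV] by simp
    then show "v \<in> A" using V.finite_span[OF UC(2) UV] spA by auto
  next
    fix v assume "v \<in> A"
    then have "v \<in> V.span U" using spA by simp
    then obtain a where a: "V.lincomb a U = v" using V.finite_in_span[OF UC(2) UV] by auto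
    let ?a = "\<lambda>b. if b \<in> U then a b else 0"
    have "V.lincomb ?a U = v"
      unfolding a[symmetric] by (rule V.lincomb_cong[OF refl UV]) auto
    moreover have "V.lincomb ?a C = \<zero>\<^bsub>V\<^esub>"
    proof (rule V.lincomb_zero[OF CV], rule Pi_I)
      fix b assume "b \<in> C"
      then have "b \<notin> U" using UC(5) by auto
      then show "?a b \<in> {\<zero>\<^bsub>class_ring\<^esub>}" by simp
    qed
    ultimately have "V.lincomb ?a ?B = v"
      using V.lincomb_union[OF UV CV UC(5) UC(2) UC(3), of ?a] V.lincomb_closed[OF UV, of a] a by simp
    then have "v = \<psi> (vec n (\<lambda>i. ?a (bvec i)))" using \<psi>_vec[of ?a] by simp
    moreover have "bvec i \<notin> U" if "i < n" "m \<le> i" for i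
      using at[OF that(1)] idxU[of "bvec i"] that(2) by auto
    ultimately show "v \<in> \<psi> ` {x \<in> carrier_vec n. \<forall>i<n. m \<le> i \<longrightarrow> x $ i = 0}"
      by (intro image_eqI[of _ _ "vec n (\<lambda>i. ?a (bvec i))"]) auto
  qed
  then have "\<phi> ` A = \<phi> ` \<psi> ` {x \<in> carrier_vec n. \<forall>i<n. m \<le> i \<longrightarrow> x $ i = 0}" by simp
  also have "\<dots> = {x \<in> carrier_vec n. \<forall>i<n. m \<le> i \<longrightarrow> x $ i = 0}"
    unfolding image_image using \<phi>\<psi> by (auto simp: image_iff)
  finally show ?thesis using that lin \<phi>bij mn by blast
qed

section \<open>Sums and intersections of subspaces\<close>

context vectorspace
begin

lemma set_add_eq_span_Un:
  assumes "submodule K A V" "submodule K B V"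
  shows "A <+>\<^bsub>V\<^esub> B = span (A \<union> B)"
proof -
  have "span (A \<union> B) = submodule_sum A B"
    using span_union_is_sum[OF submodule.subset[OF assms(1)] submodule.subset[OF assms(2)]]
    by (simp add: span_submodule assms)
  then show ?thesis by (auto simp: submodule_sum_def set_add_def set_mult_def)
qed

lemma submodule_Int:
  assumes "submodule K A V" "submodule K B V"
  shows "submodule K (A \<inter> B) V"
  using assms unfolding submodule_def by auto

text \<open>
  The half of the dimension formula that needs linear independence: a basis of \<open>B\<close> stays independent
  when one adds the vectors \<open>C\<close> that extend a basis of \<open>A \<inter> B\<close> to a basis of \<open>A\<close>.
\<close>
lemma span_dim_Un_Int:
  assumes fd: "fin_dim" and A: "submodule K A V" and B: "submodule K B V"
  shows "span_dim A + span_dim B \<le> span_dim (A \<union> B) + span_dim (A \<inter> B)"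
proof -
  have AV: "A \<subseteq> carrier V" and BV: "B \<subseteq> carrier V" using submodule.subset A B by auto
  have IV: "A \<inter> B \<subseteq> carrier V" using AV by auto
  have "A \<inter> B \<subseteq> span A" using in_own_span[OF AV] by auto
  then obtain U C where UC: "U \<subseteq> A \<inter> B" "finite U" "finite C" "C \<subseteq> span A" "U \<inter> C = {}"
      "lin_indpt (U \<union> C)" "span U = span (A \<inter> B)"
      "card U = span_dim (A \<inter> B)" "card U + card C = span_dim A"
    by (rule extend_basis[OF fd IV AV])
  obtain D where D: "D \<subseteq> B" "finite D" "lin_indpt D" "span D = span B" "card D = span_dim B"
    by (rule basis_of_span[OF fd BV])
  have CA: "C \<subseteq> A" using UC(4) span_submodule[OF A] by simp
  have car: "U \<subseteq> carrier V" "C \<subseteq> carrier V" "D \<subseteq> carrier V" using UC CA D AV BV by auto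
  \<comment> \<open>A relation puts the part from \<open>C\<close> into \<open>A \<inter> B\<close>, where it is a combination of \<open>U\<close>.\<close>
  have key: "(\<forall>v\<in>C. a v = \<zero>\<^bsub>K\<^esub>) \<and> b \<in> D \<rightarrow> {\<zero>\<^bsub>K\<^esub>}"
    if ab: "a \<in> C \<rightarrow> carrier K" "b \<in> D \<rightarrow> carrier K" "lincomb a C \<oplus>\<^bsub>V\<^esub> lincomb b D = \<zero>\<^bsub>V\<^esub>" for a b
  proof -
    let ?w = "lincomb a C"
    have wb: "lincomb b D \<in> carrier V" "?w \<in> carrier V" using lincomb_closed car ab by auto
    have wA: "?w \<in> A" using span_is_subset[OF CA A] finite_span[OF UC(3) car(2)] ab by auto
    have bB: "lincomb b D \<in> B" using span_is_subset[OF D(1) B] finite_span[OF D(2) car(3)] ab by auto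
    have w: "\<ominus>\<^bsub>V\<^esub> ?w = lincomb b D" using M.minus_equality[of "lincomb b D" ?w] ab(3) wb M.a_comm by simp
    have nw: "\<ominus>\<^bsub>V\<^esub> ?w \<in> A"
      using submodule.smult_closed[OF A _ wA, of "\<ominus>\<^bsub>K\<^esub> \<one>\<^bsub>K\<^esub>"] smult_minus_1[OF wb(2)] by simp
    then have "\<ominus>\<^bsub>V\<^esub> ?w \<in> span U"
      using w bB UC(7) span_submodule[OF submodule_Int[OF A B]] by simp
    then obtain u where u: "u \<in> U \<rightarrow> carrier K" "lincomb u U = \<ominus>\<^bsub>V\<^esub> ?w"
      using finite_in_span[OF UC(2) car(1)] by auto
    let ?c = "\<lambda>v. if v \<in> U then u v else a v"
    have cc: "?c \<in> U \<union> C \<rightarrow> carrier K" using u ab UC(5) by auto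
    have "lincomb ?c (U \<union> C) = lincomb u U \<oplus>\<^bsub>V\<^esub> ?w"
      by (rule lincomb_union2[symmetric]) (use UC car ab u in auto)
    also have "\<dots> = \<zero>\<^bsub>V\<^esub>" unfolding u(2) using wb M.l_neg by simp
    finally have "?c \<in> U \<union> C \<rightarrow> {\<zero>\<^bsub>K\<^esub>}"
      using not_lindepD[OF UC(6) _ subset_refl cc] UC by auto
    note c0 = this
    have a0: "\<forall>v\<in>C. a v = \<zero>\<^bsub>K\<^esub>"
    proof
      fix v assume "v \<in> C"
      then have "v \<notin> U" "?c v = \<zero>\<^bsub>K\<^esub>" using UC(5) Pi_mem[OF c0, of v] by auto
      then show "a v = \<zero>\<^bsub>K\<^esub>" by simp
    qed
    then have "?w = \<zero>\<^bsub>V\<^esub>" using lincomb_zero[OF car(2)] by auto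
    then have "lincomb b D = \<zero>\<^bsub>V\<^esub>" using ab(3) M.l_zero[OF wb(1)] by simp
    then show ?thesis using a0 not_lindepD[OF D(3) D(2) subset_refl ab(2)] by auto
  qed
  have CD: "C \<inter> D = {}"
  proof (rule ccontr)
    assume "C \<inter> D \<noteq> {}"
    then obtain v where v: "v \<in> C" "v \<in> D" by auto
    then have "v \<in> A \<inter> B" using CA D by auto
    then have "v \<in> span U" using UC(7) in_own_span[OF IV] by auto
    moreover have "v \<notin> U" using v UC(5) by auto
    moreover have "lin_indpt U" using subset_li_is_li[OF UC(6)] by auto
    ultimately have "lin_dep (U \<union> {v})" using lin_dep_iff_in_span[OF car(1)] v car by auto
    then show False using supset_ld_is_ld[of "U \<union> {v}" "U \<union> C"] UC(6) v by auto
  qed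
  have f: "finite (C \<union> D)" "C \<union> D \<subseteq> carrier V" using UC D car by auto
  have "lin_indpt (C \<union> D)"
  proof (rule finite_lin_indpt2[OF f])
    fix a assume a: "a \<in> C \<union> D \<rightarrow> carrier K" "lincomb a (C \<union> D) = \<zero>\<^bsub>V\<^esub>"
    then have "lincomb a C \<oplus>\<^bsub>V\<^esub> lincomb a D = \<zero>\<^bsub>V\<^esub>" using lincomb_union[OF car(2) car(3) CD UC(3) D(2) a(1)] by simp
    then show "\<forall>v\<in>C \<union> D. a v = \<zero>\<^bsub>K\<^esub>" using key[of a a] a(1) by auto
  qed
  then have "card C + card D = span_dim (C \<union> D)"
    using span_dim_lin_indpt[OF f] card_Un_disjoint[OF UC(3) D(2) CD] by simp
  also have "\<dots> \<le> span_dim (A \<union> B)"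
    by (rule span_dim_mono[OF fd f(2)]) (use AV BV CA D in_own_span[of "A \<union> B"] in auto)
  finally show ?thesis using UC D by simp
qed

end

section \<open>Representability in terms of subspaces\<close>

text \<open>
  Every subspace is the column space of some matrix, so the matrices \<open>Y\<close> in the definition of
  representability can be traded for subspaces of the ground space.
\<close>
lemma representable_iff:
  fixes M :: "('k::field, 'v) qmatroid"
  assumes "vectorspace class_ring (ground M)"
  shows "representable TYPE('l) M \<longleftrightarrow>
    (\<exists>(L :: 'l ring) h \<phi> G. field L \<and> h \<in> Ring.ring_hom (class_ring :: 'k ring) L \<and>
        linear_map class_ring (ground M) (module_vec TYPE('k) (qdim M)) \<phi> \<and>
        bij_betw \<phi> (carrier (ground M)) (carrier_vec (qdim M)) \<and>
        G \<in> carrier_mat (nat (qrank M)) (qdim M) \<and> elements_mat G \<subseteq> carrier L \<and>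
        (\<forall>A \<in> subspaces (ground M). rk M A =
           int (vectorspace.span_dim L (ring.func_space L {..<nat (qrank M)}) (mat_map L h G ` \<phi> ` A))))"
proof -
  have key: "(\<forall>m. \<forall>Y \<in> carrier_mat (qdim M) m. vec_space.col_space (qdim M) Y = \<phi> ` A \<longrightarrow>
           rk M A = int (mat_rank L (mat_mult L G (map_mat h Y)))) \<longleftrightarrow>
      rk M A = int (vectorspace.span_dim L (ring.func_space L {..<nat (qrank M)}) (mat_map L h G ` \<phi> ` A))"
    if L: "field L" and h: "h \<in> Ring.ring_hom class_ring L"
      and \<phi>: "linear_map class_ring (ground M) (module_vec TYPE('k) (qdim M)) \<phi>"
      and G: "G \<in> carrier_mat (nat (qrank M)) (qdim M)" "elements_mat G \<subseteq> carrier L"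
      and A: "A \<in> subspaces (ground M)"
    for L :: "'l ring" and h \<phi> G A
  proof -
    have "submodule class_ring (\<phi> ` A) (module_vec TYPE('k) (qdim M))"
      using submodule_image linear_map.axioms(3)[OF \<phi>] A
      by (auto simp: subspaces_def VectorSpace.subspace_def)
    then obtain m Y where "Y \<in> carrier_mat (qdim M) m" "vec_space.col_space (qdim M) Y = \<phi> ` A"
      by (rule ex_col_space)
    then show ?thesis using mat_rank_mat_mult[OF L h G] by (intro iffI) auto
  qed
  show ?thesis
    by (simp only: representable_def Let_def key cong: conj_cong ball_cong)
qed

section \<open>Rank functions of q-matroids\<close>

context q_matroid
begin

lemma subspaces_iff: "A \<in> subspaces (ground M) \<longleftrightarrow> submodule class_ring A (ground M)"
  unfolding subspaces_def VectorSpace.subspace_def using vectorspace_axioms by auto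

lemma sdim_eq: "A \<in> subspaces (ground M) \<Longrightarrow> sdim (ground M) A = span_dim A"
  unfolding sdim_def subspaces_iff by (rule span_dim_submodule[symmetric])

lemma carrier_subspace: "carrier (ground M) \<in> subspaces (ground M)"
  unfolding subspaces_iff by (rule submodule.intro) (auto intro: module_axioms)

lemma span_subspace: "S \<subseteq> carrier (ground M) \<Longrightarrow> span S \<in> subspaces (ground M)"
  unfolding subspaces_iff by (rule span_is_submodule)

lemma subspace_subset: "A \<in> subspaces (ground M) \<Longrightarrow> A \<subseteq> carrier (ground M)"
  unfolding subspaces_iff by (rule submodule.subset)

lemma rk_submodular:
  assumes "A \<in> subspaces (ground M)" "B \<in> subspaces (ground M)"
  shows "rk M (span (A \<union> B)) + rk M (A \<inter> B) \<le> rk M A + rk M B"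
  using R3[OF assms] set_add_eq_span_Un assms by (simp add: subspaces_iff)

lemma rk_nonneg: "A \<in> subspaces (ground M) \<Longrightarrow> 0 \<le> rk M A"
  and rk_le: "A \<in> subspaces (ground M) \<Longrightarrow> rk M A \<le> int (span_dim A)"
  using R1 sdim_eq by auto

lemma rk_le_qrank: "A \<in> subspaces (ground M) \<Longrightarrow> rk M A \<le> qrank M"
  unfolding qrank_def using R2 carrier_subspace subspace_subset by blast

text \<open>
  Submodularity for \<open>A\<close> and a complement of \<open>A\<close> in \<open>B\<close>, whose rank is at most its dimension.
\<close>
lemma rk_increase:
  assumes A: "A \<in> subspaces (ground M)" and B: "B \<in> subspaces (ground M)" and AB: "A \<subseteq> B"
  shows "rk M B + int (span_dim A) \<le> rk M A + int (span_dim B)"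
proof -
  have car: "A \<subseteq> carrier (ground M)" "B \<subseteq> carrier (ground M)" using A B subspace_subset by auto
  have "A \<subseteq> span B" using AB in_own_span[OF car(2)] by auto
  then obtain U C where UC: "U \<subseteq> A" "finite C" "C \<subseteq> span B"
      "span (U \<union> C) = span B" "card U = span_dim A" "card U + card C = span_dim B"
    by (rule extend_basis[OF fin_dim car])
  have CV: "C \<subseteq> carrier (ground M)" using UC(3) span_is_subset2[OF car(2)] by auto
  let ?D = "span C"
  have D: "?D \<in> subspaces (ground M)" by (rule span_subspace[OF CV])
  have DV: "?D \<subseteq> carrier (ground M)" by (rule span_is_subset2[OF CV])
  have "U \<union> C \<subseteq> A \<union> ?D" using UC(1) in_own_span[OF CV] by auto
  then have sub: "B \<subseteq> span (A \<union> ?D)"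
    using span_is_monotone[of "U \<union> C" "A \<union> ?D"] UC(4) in_own_span[OF car(2)] by auto
  have "rk M B \<le> rk M (span (A \<union> ?D))"
    by (rule R2[OF B span_subspace sub]) (use car DV in auto)
  also have "\<dots> \<le> rk M A + rk M ?D"
    using rk_submodular[OF A D] rk_nonneg[of "A \<inter> ?D"] submodule_Int A D by (auto simp: subspaces_iff)
  also have "rk M ?D \<le> int (span_dim ?D)" by (rule rk_le[OF D])
  also have "span_dim ?D = span_dim C"
    by (rule span_dim_cong) (use span_submodule span_is_submodule[OF CV] in auto)
  also have "\<dots> \<le> card C" by (rule span_dim_le_card[OF fin_dim CV UC(2)])
  finally show ?thesis using UC by simp
qed

lemma qdim_eq: "qdim M = span_dim (carrier (ground M))"
  unfolding qdim_def span_dim_carrier ..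

lemma zero_subspace: "{\<zero>\<^bsub>ground M\<^esub>} \<in> subspaces (ground M)"
  using span_subspace[of "{}"] span_empty by simp

lemma rk_zero: "rk M {\<zero>\<^bsub>ground M\<^esub>} = 0"
  using rk_nonneg[OF zero_subspace] rk_le[OF zero_subspace] span_dim_eq_0_iff[OF fin_dim, of "{\<zero>\<^bsub>ground M\<^esub>}"]
  by auto

text \<open>
  By submodularity the sum of two subspaces of rank 0 has rank 0. Hence a subspace of rank 0 of
  largest dimension contains all the others.
\<close>
lemma loop_space:
  obtains W where "W \<in> subspaces (ground M)"
    "\<And>A. A \<in> subspaces (ground M) \<Longrightarrow> rk M A = 0 \<longleftrightarrow> A \<subseteq> W"
proof -
  let ?P = "\<lambda>A. A \<in> subspaces (ground M) \<and> rk M A = 0"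
  have "\<exists>W. ?P W \<and> (\<forall>A. ?P A \<longrightarrow> span_dim A \<le> span_dim W)"
  proof (rule ex_has_greatest_nat)
    show "?P {\<zero>\<^bsub>ground M\<^esub>}" using zero_subspace rk_zero by auto
    show "\<forall>A. ?P A \<longrightarrow> span_dim A < Suc dim"
      using span_dim_le_dim[OF fin_dim] subspace_subset by (auto simp: less_Suc_eq_le)
  qed
  then obtain W where W: "?P W" and max: "\<And>A. ?P A \<Longrightarrow> span_dim A \<le> span_dim W" by blast
  have "A \<subseteq> W" if A: "?P A" for A
  proof -
    let ?S = "span (W \<union> A)"
    have car: "W \<union> A \<subseteq> carrier (ground M)" using W A subspace_subset by auto
    have S: "?S \<in> subspaces (ground M)" by (rule span_subspace[OF car])
    have "W \<inter> A \<in> subspaces (ground M)" using W A submodule_Int by (auto simp: subspaces_iff)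
    then have "rk M ?S = 0"
      using rk_submodular[of W A] rk_nonneg[of "W \<inter> A"] rk_nonneg[OF S] W A by linarith
    then have "span_dim ?S \<le> span_dim W" using max S by blast
    moreover have sub: "W \<union> A \<subseteq> ?S" by (rule in_own_span[OF car])
    ultimately have "W = ?S"
      using submodule_eqI_span_dim[OF fin_dim, of W ?S] W S by (auto simp: subspaces_iff)
    then show ?thesis using sub by auto
  qed
  moreover have "rk M A = 0" if "A \<in> subspaces (ground M)" "A \<subseteq> W" for A
    using R2[of A W] rk_nonneg[of A] W that by auto
  ultimately show ?thesis using that[of W] W by blast
qed

text \<open>
  In corank 1 the nullity \<open>dim A - r A\<close> is 0 or 1. It is supermodular, since the rank is submodular and
  the dimension is modular, so the intersection of two dependent subspaces is dependent. Hence a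
  dependent subspace of smallest dimension lies in all the others.
\<close>
lemma unique_circuit:
  assumes corank: "qrank M + 1 = int (qdim M)"
  obtains Z where "Z \<in> subspaces (ground M)"
    "\<And>A. A \<in> subspaces (ground M) \<Longrightarrow> rk M A = int (span_dim A) - (if Z \<subseteq> A then 1 else 0)"
proof -
  let ?P = "\<lambda>A. A \<in> subspaces (ground M) \<and> rk M A < int (span_dim A)"
  let ?E = "carrier (ground M)"
  have nullity: "rk M A \<ge> int (span_dim A) - 1" if "A \<in> subspaces (ground M)" for A
    using rk_increase[OF that carrier_subspace subspace_subset[OF that]] corank
    by (simp add: qrank_def qdim_eq)
  have "?P ?E" using carrier_subspace corank by (simp add: qrank_def qdim_eq)
  then have "\<exists>Z. ?P Z \<and> (\<forall>A. ?P A \<longrightarrow> span_dim Z \<le> span_dim A)"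
    by (rule ex_has_least_nat)
  then obtain Z where Z: "?P Z" and min: "\<And>A. ?P A \<Longrightarrow> span_dim Z \<le> span_dim A" by blast
  have sub: "Z \<subseteq> A" if A: "?P A" for A
  proof -
    have I: "Z \<inter> A \<in> subspaces (ground M)" using Z A submodule_Int by (auto simp: subspaces_iff)
    have car: "Z \<union> A \<subseteq> ?E" using Z A subspace_subset by auto
    have S: "span (Z \<union> A) \<in> subspaces (ground M)" by (rule span_subspace[OF car])
    have "span_dim Z + span_dim A \<le> span_dim (Z \<union> A) + span_dim (Z \<inter> A)"
      using span_dim_Un_Int[OF fin_dim] Z A by (auto simp: subspaces_iff)
    moreover have "span_dim (span (Z \<union> A)) = span_dim (Z \<union> A)"
      by (rule span_dim_cong) (use span_submodule span_is_submodule[OF car] in auto)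
    ultimately have "?P (Z \<inter> A)"
      using rk_submodular[of Z A] nullity[OF S] Z A I by auto
    then have "span_dim Z \<le> span_dim (Z \<inter> A)" by (rule min)
    then have "Z \<inter> A = Z"
      using submodule_eqI_span_dim[OF fin_dim, of "Z \<inter> A" Z] I Z by (auto simp: subspaces_iff)
    then show ?thesis by auto
  qed
  have "?P A" if A: "A \<in> subspaces (ground M)" "Z \<subseteq> A" for A
    using rk_increase[of Z A] Z A by auto
  note up = this
  have "rk M A = int (span_dim A) - (if Z \<subseteq> A then 1 else 0)" if A: "A \<in> subspaces (ground M)" for A
  proof (cases "Z \<subseteq> A")
    case True
    then show ?thesis using up[OF A True] nullity[OF A] by simp
  next
    case False
    then have "\<not> ?P A" using sub by blast
    then show ?thesis using A rk_le[OF A] False by simp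
  qed
  then show ?thesis using that[of Z] Z by blast
qed

end

section \<open>Representations over the field of rational functions\<close>

lemma (in semilinear_map) semilinear_comp:
  assumes "linear_map K V' V \<phi>"
  shows "semilinear_map K V' L W h (\<gamma> \<circ> \<phi>)"
proof -
  interpret l: linear_map K V' V \<phi> by (rule assms)
  show ?thesis
    by unfold_locales (use h closed add smult l.T_im l.T_add l.T_smult in auto)
qed

abbreviation const_fract :: "'k::field \<Rightarrow> 'k poly fract" where
  "const_fract c \<equiv> to_fract [:c:]"

abbreviation indet_fract :: "'k::field poly fract" where
  "indet_fract \<equiv> to_fract (monom 1 1)"

lemma const_fract_hom: "(const_fract :: 'k::field \<Rightarrow> _) \<in> Ring.ring_hom class_ring class_ring"
proof (rule ring_hom_memI)
  fix a b :: 'k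
  have "to_fract [:a * b:] = to_fract ([:a:] * [:b:])" by simp
  then show "const_fract (a \<otimes>\<^bsub>class_ring\<^esub> b) = const_fract a \<otimes>\<^bsub>class_ring\<^esub> const_fract b"
    unfolding to_fract_mult by simp
  have "to_fract [:a + b:] = to_fract ([:a:] + [:b:])" by simp
  then show "const_fract (a \<oplus>\<^bsub>class_ring\<^esub> b) = const_fract a \<oplus>\<^bsub>class_ring\<^esub> const_fract b"
    unfolding to_fract_add by simp
next
  show "const_fract \<one>\<^bsub>class_ring\<^esub> = \<one>\<^bsub>class_ring\<^esub>"
    by (simp flip: one_pCons)
qed simp

text \<open>
  The sum is the image of the polynomial with coefficients \<open>a j\<close>.
\<close>
lemma indet_powers_independent:
  fixes a :: "nat \<Rightarrow> 'k::field"
  assumes "finite J"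
  shows "(\<Sum>j\<in>J. indet_fract ^ j * const_fract (a j)) = 0 \<longleftrightarrow> (\<forall>j\<in>J. a j = 0)"
proof -
  have pow: "(indet_fract :: 'k poly fract) ^ j = to_fract (monom 1 j)" for j
  proof (induction j)
    case (Suc j)
    have "(indet_fract :: 'k poly fract) ^ Suc j = to_fract (monom 1 1 * monom 1 j)"
      by (simp only: power_Suc Suc.IH to_fract_mult)
    then show ?case by (simp add: mult_monom)
  qed simp
  have "indet_fract ^ j * const_fract (a j) = to_fract (monom (a j) j)" for j
    unfolding pow to_fract_mult[symmetric] by (simp add: smult_monom mult.commute[of "monom _ _"])
  moreover have "(\<Sum>j\<in>J. to_fract (p j)) = to_fract (\<Sum>j\<in>J. p j)" for p :: "nat \<Rightarrow> 'k poly"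
    using assms by (induction J) auto
  ultimately have "(\<Sum>j\<in>J. indet_fract ^ j * const_fract (a j)) = to_fract (\<Sum>j\<in>J. monom (a j) j)"
    by simp
  moreover have "(\<Sum>j\<in>J. monom (a j) j) = 0 \<longleftrightarrow> (\<forall>j\<in>J. a j = 0)"
  proof
    assume 0: "(\<Sum>j\<in>J. monom (a j) j) = 0"
    show "\<forall>j\<in>J. a j = 0"
    proof
      fix i assume "i \<in> J"
      then have "a i = coeff (\<Sum>j\<in>J. monom (a j) j) i"
        using assms by (simp add: coeff_sum if_distrib sum.delta cong: if_cong)
      then show "a i = 0" using 0 by simp
    qed
  qed simp
  ultimately show ?thesis by (simp only: to_fract_eq_0_iff)
qed

lemma mat_map_class_ring:
  "mat_map (class_ring :: 'l::field ring) h G x = (\<lambda>i\<in>{..<dim_row G}. \<Sum>l<dim_col G. G $$ (i, l) * h (x $ l))"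
  unfolding mat_map_def by (simp add: class_ring_simps)

lemma func_space_class_ring_fin_dim:
  "vectorspace.fin_dim (class_ring :: 'l::field ring) (ring.func_space class_ring {..<k :: nat})"
  by (rule field.func_space_fin_dim[OF class_field])

lemma span_dim_supported_class_ring:
  fixes S :: "(nat \<Rightarrow> 'l::field) set"
  assumes "S \<subseteq> carrier (ring.func_space class_ring {..<k})"
    and "\<And>f i. f \<in> S \<Longrightarrow> i < k \<Longrightarrow> j \<le> i \<Longrightarrow> f i = 0"
  shows "vectorspace.span_dim class_ring (ring.func_space class_ring {..<k}) S \<le> j"
  using field.span_dim_supported[OF class_field assms(1), of j] assms(2) by simp

lemma span_dim_full:
  fixes S :: "(nat \<Rightarrow> 'l::field) set"
  assumes S: "S \<subseteq> carrier (ring.func_space class_ring {..<k})"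
    and u: "\<And>i. i < k \<Longrightarrow> ring.unit_fun class_ring k i \<in> LinearCombinations.module.span class_ring (ring.func_space class_ring {..<k}) S"
  shows "vectorspace.span_dim class_ring (ring.func_space class_ring {..<k}) S = k"
proof -
  interpret W: vectorspace "class_ring :: 'l ring" "ring.func_space class_ring {..<k}"
    by (rule field.func_space_vectorspace[OF class_field])
  note fd = func_space_class_ring_fin_dim
  let ?U = "ring.unit_fun (class_ring :: 'l ring) k ` {..<k}"
  have U: "?U \<subseteq> carrier (ring.func_space class_ring {..<k})"
    using field.unit_fun_closed[OF class_field] by blast
  have c: "carrier (ring.func_space (class_ring :: 'l ring) {..<k}) = W.span ?U"
    by (rule field.func_space_span_unit_fun[OF class_field, symmetric])
  have "W.span_dim (carrier (ring.func_space class_ring {..<k})) \<le> W.span_dim ?U"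
    by (rule W.span_dim_mono[OF fd subset_refl U]) (simp add: c)
  also have "\<dots> \<le> W.span_dim S"
    by (rule W.span_dim_mono[OF fd U S]) (use u in auto)
  finally show ?thesis
    using W.span_dim_le_dim[OF fd S] dim_func_space_class_ring[where 'l = 'l, of k]
    unfolding W.span_dim_carrier by simp
qed

lemma submodule_func_space_sum:
  fixes T :: "(nat \<Rightarrow> 'l::field) set"
  assumes T: "submodule class_ring T (ring.func_space class_ring {..<k})"
    and J: "finite J" "\<And>j. j \<in> J \<Longrightarrow> F j \<in> T"
  shows "(\<lambda>i\<in>{..<k}. \<Sum>j\<in>J. c j * F j i) \<in> T"
  using J
proof (induction J)
  case empty
  then show ?case
    using submodule.zero_closed[OF T] by (simp add: ring.func_space_def[OF class_ring.ring_axioms] restrict_def)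
next
  case (insert a J)
  let ?g = "\<lambda>i\<in>{..<k}. \<Sum>j\<in>J. c j * F j i"
  have "(c a \<odot>\<^bsub>ring.func_space class_ring {..<k}\<^esub> F a) \<oplus>\<^bsub>ring.func_space class_ring {..<k}\<^esub> ?g \<in> T"
  proof (intro submodule.m_closed[OF T] submodule.smult_closed[OF T])
    show "?g \<in> T" using insert.IH insert.prems by blast
    show "F a \<in> T" using insert.prems by blast
  qed simp
  moreover have "(c a \<odot>\<^bsub>ring.func_space class_ring {..<k}\<^esub> F a) \<oplus>\<^bsub>ring.func_space class_ring {..<k}\<^esub> ?g
      = (\<lambda>i\<in>{..<k}. \<Sum>j\<in>insert a J. c j * F j i)"
    unfolding ring.func_space_def[OF class_ring.ring_axioms] using insert
    by (simp cong: restrict_cong)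
  ultimately show ?case by (simp only:)
qed

context q_matroid
begin

lemma semilinear_coordinates:
  fixes G :: "'k poly fract mat"
  assumes "linear_map class_ring (ground M) (module_vec TYPE('k) (qdim M)) \<phi>"
    and "G \<in> carrier_mat k (qdim M)"
  shows "semilinear_map class_ring (ground M) class_ring (ring.func_space class_ring {..<k})
    const_fract (mat_map class_ring const_fract G \<circ> \<phi>)"
  by (rule semilinear_map.semilinear_comp[OF
      semilinear_mat_map[OF class_field const_fract_hom assms(2)] assms(1)]) simp

lemma representable_fractI:
  fixes G :: "'k poly fract mat"
  assumes "linear_map class_ring (ground M) (module_vec TYPE('k) (qdim M)) \<phi>"
    and "bij_betw \<phi> (carrier (ground M)) (carrier_vec (qdim M))"
    and "G \<in> carrier_mat k (qdim M)" and "k = nat (qrank M)"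
    and "\<And>A. A \<in> subspaces (ground M) \<Longrightarrow>
      rk M A = int (vectorspace.span_dim class_ring (ring.func_space class_ring {..<k})
        ((mat_map class_ring const_fract G \<circ> \<phi>) ` A))"
  shows "representable TYPE('k poly fract) M"
proof -
  have "\<forall>A \<in> subspaces (ground M). rk M A = int (vectorspace.span_dim class_ring
      (ring.func_space class_ring {..<nat (qrank M)}) (mat_map class_ring const_fract G ` \<phi> ` A))"
    using assms(4,5) by (simp add: image_comp)
  moreover have "elements_mat G \<subseteq> carrier class_ring" by simp
  ultimately show ?thesis
    unfolding representable_iff[OF vectorspace_axioms]
    using class_field const_fract_hom assms(1-4) by blast
qed

lemma representable_rank_0:
  assumes r: "qrank M = 0"
  shows "representable TYPE('k poly fract) M"
proof -
  obtain \<phi> where \<phi>: "linear_map class_ring (ground M) (module_vec TYPE('k) (qdim M)) \<phi>"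
      "bij_betw \<phi> (carrier (ground M)) (carrier_vec (qdim M))"
    by (rule adapted_coordinates[OF vectorspace_axioms fin_dim
        zero_subspace[unfolded subspaces_iff] qdim_def refl])
  define G :: "'k poly fract mat" where "G = 0\<^sub>m 0 (qdim M)"
  have G: "G \<in> carrier_mat 0 (qdim M)" by (simp add: G_def)
  interpret s: semilinear_map class_ring "ground M" class_ring "ring.func_space class_ring {..<0}"
    const_fract "mat_map class_ring const_fract G \<circ> \<phi>"
    by (rule semilinear_coordinates[OF \<phi>(1) G])
  show ?thesis
  proof (rule representable_fractI[OF \<phi> G])
    show "0 = nat (qrank M)" using r by simp
  next
    fix A assume A: "A \<in> subspaces (ground M)"
    have "(mat_map class_ring const_fract G \<circ> \<phi>) ` A \<subseteq> carrier (ring.func_space class_ring {..<0})"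
      using s.closed subspace_subset[OF A] by blast
    then have "s.W.span_dim ((mat_map class_ring const_fract G \<circ> \<phi>) ` A) \<le> 0"
      by (rule span_dim_supported_class_ring) auto
    then show "rk M A = int (s.W.span_dim ((mat_map class_ring const_fract G \<circ> \<phi>) ` A))"
      using rk_nonneg[OF A] rk_le_qrank[OF A] r by simp
  qed
qed

text \<open>
  The rank of \<open>A\<close> is 0 or 1 according to whether \<open>A\<close> lies in the space \<open>W\<close> of loops. In coordinates
  in which \<open>W\<close> is spanned by the first \<open>m\<close> unit vectors, the functional with coefficients
  \<open>0, \<dots>, 0, t\<^sup>m, \<dots>, t\<^sup>n\<^sup>-\<^sup>1\<close> vanishes on exactly \<open>W\<close>, because the powers of \<open>t\<close> are
  independent over \<open>K\<close>.
\<close>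
lemma representable_rank_1:
  assumes r: "qrank M = 1"
  shows "representable TYPE('k poly fract) M"
proof -
  obtain W where W: "W \<in> subspaces (ground M)"
    and loops: "\<And>A. A \<in> subspaces (ground M) \<Longrightarrow> rk M A = 0 \<longleftrightarrow> A \<subseteq> W"
    by (rule loop_space) blast
  define n where "n = qdim M"
  define m where "m = span_dim W"
  obtain \<phi> where \<phi>: "linear_map class_ring (ground M) (module_vec TYPE('k) n) \<phi>"
      "bij_betw \<phi> (carrier (ground M)) (carrier_vec n)"
      and \<phi>W: "\<phi> ` W = {x \<in> carrier_vec n. \<forall>i<n. m \<le> i \<longrightarrow> x $ i = 0}" and mn: "m \<le> n"
    by (rule adapted_coordinates[OF vectorspace_axioms fin_dim
        W[unfolded subspaces_iff] n_def[unfolded qdim_def] m_def])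
  define G :: "'k poly fract mat" where
    "G = mat 1 n (\<lambda>(i, j). if j < m then 0 else indet_fract ^ j)"
  have G: "G \<in> carrier_mat 1 n" by (simp add: G_def)
  define \<gamma> where "\<gamma> = mat_map class_ring const_fract G \<circ> \<phi>"
  interpret s: semilinear_map class_ring "ground M" class_ring "ring.func_space class_ring {..<1}"
    const_fract \<gamma>
    unfolding \<gamma>_def by (rule semilinear_coordinates[OF \<phi>(1)[unfolded n_def] G[unfolded n_def]])
  note fs = ring.func_space_def[OF class_ring.ring_axioms]
  note fd = func_space_class_ring_fin_dim
  have \<gamma>0: "\<gamma> v = \<zero>\<^bsub>ring.func_space class_ring {..<1}\<^esub> \<longleftrightarrow> v \<in> W" if v: "v \<in> carrier (ground M)" for v
  proof -
    have \<phi>v: "\<phi> v \<in> carrier_vec n" using bij_betwE[OF \<phi>(2)] v by blast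
    have "\<gamma> v = (\<lambda>i\<in>{..<1}. \<Sum>l<n. (if l < m then 0 else indet_fract ^ l) * const_fract (\<phi> v $ l))"
      unfolding \<gamma>_def comp_def mat_map_class_ring carrier_matD[OF G]
      by (intro restrict_ext) (auto simp: G_def)
    also have "(\<lambda>i. \<Sum>l<n. (if l < m then 0 else indet_fract ^ l) * const_fract (\<phi> v $ l))
        = (\<lambda>i. \<Sum>l\<in>{m..<n}. indet_fract ^ l * const_fract (\<phi> v $ l))"
      by (intro ext sum.mono_neutral_cong_right) auto
    finally have "\<gamma> v = \<zero>\<^bsub>ring.func_space class_ring {..<1}\<^esub>
        \<longleftrightarrow> (\<Sum>l\<in>{m..<n}. indet_fract ^ l * const_fract (\<phi> v $ l)) = 0"
      by (auto simp: fs fun_eq_iff)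
    also have "\<dots> \<longleftrightarrow> (\<forall>l\<in>{m..<n}. \<phi> v $ l = 0)"
      by (rule indet_powers_independent) simp
    also have "\<dots> \<longleftrightarrow> \<phi> v \<in> \<phi> ` W" unfolding \<phi>W using \<phi>v by auto
    also have "\<dots> \<longleftrightarrow> v \<in> W"
      using inj_on_image_mem_iff[OF bij_betw_imp_inj_on[OF \<phi>(2)] v subspace_subset[OF W]] .
    finally show ?thesis .
  qed
  show ?thesis
  proof (rule representable_fractI)
    show "linear_map class_ring (ground M) (module_vec TYPE('k) (qdim M)) \<phi>"
      "bij_betw \<phi> (carrier (ground M)) (carrier_vec (qdim M))" "G \<in> carrier_mat 1 (qdim M)"
      using \<phi> G by (simp_all add: n_def)
    show "1 = nat (qrank M)" using r by simp
  next
    fix A assume A: "A \<in> subspaces (ground M)"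
    have car: "\<gamma> ` A \<subseteq> carrier (ring.func_space class_ring {..<1})"
      using s.closed subspace_subset[OF A] by blast
    have le: "s.W.span_dim (\<gamma> ` A) \<le> 1"
      by (rule span_dim_supported_class_ring[OF car]) auto
    have "s.W.span_dim (\<gamma> ` A) = 0 \<longleftrightarrow> \<gamma> ` A \<subseteq> {\<zero>\<^bsub>ring.func_space class_ring {..<1}\<^esub>}"
      by (rule s.W.span_dim_eq_0_iff[OF fd car])
    also have "\<dots> \<longleftrightarrow> A \<subseteq> W" using \<gamma>0 subspace_subset[OF A] by blast
    also have "\<dots> \<longleftrightarrow> rk M A = 0" using loops[OF A] by simp
    finally show "rk M A = int (s.W.span_dim ((mat_map class_ring const_fract G \<circ> \<phi>) ` A))"
      using le rk_nonneg[OF A] rk_le_qrank[OF A] r unfolding \<gamma>_def[symmetric] by linarith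
  qed
qed

text \<open>
  The identity matrix works: both rank functions have full rank on the whole space, and since a rank
  grows no faster than the dimension, both of them must agree with the dimension everywhere.
\<close>
lemma representable_full_rank:
  assumes r: "qrank M = int (qdim M)"
  shows "representable TYPE('k poly fract) M"
proof -
  define n where "n = qdim M"
  obtain \<phi> where \<phi>: "linear_map class_ring (ground M) (module_vec TYPE('k) n) \<phi>"
      "bij_betw \<phi> (carrier (ground M)) (carrier_vec n)"
    by (rule adapted_coordinates[OF vectorspace_axioms fin_dim
        zero_subspace[unfolded subspaces_iff] n_def[unfolded qdim_def] refl])
  define G :: "'k poly fract mat" where "G = 1\<^sub>m n"
  have G: "G \<in> carrier_mat n n" by (simp add: G_def)
  define \<gamma> where "\<gamma> = mat_map class_ring const_fract G \<circ> \<phi>"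
  interpret s: semilinear_map class_ring "ground M" class_ring "ring.func_space class_ring {..<n}"
    const_fract \<gamma>
    unfolding \<gamma>_def by (rule semilinear_coordinates[OF \<phi>(1)[unfolded n_def] G[unfolded n_def], folded n_def])
  note fd = func_space_class_ring_fin_dim
  let ?E = "carrier (ground M)"
  have car: "\<gamma> ` ?E \<subseteq> carrier (ring.func_space class_ring {..<n})" using s.closed by blast
  have full: "s.W.span_dim (\<gamma> ` ?E) = n"
  proof (rule span_dim_full[OF car])
    fix i assume i: "i < n"
    have "unit_vec n i \<in> \<phi> ` ?E" using \<phi>(2) by (simp add: bij_betw_def)
    then obtain v where v: "v \<in> ?E" "\<phi> v = unit_vec n i" by auto
    have row: "(\<Sum>l<n. G $$ (j, l) * c l) = c j" if "j < n" for j c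
    proof -
      have "(\<Sum>l<n. G $$ (j, l) * c l) = (\<Sum>l<n. if l = j then c l else 0)"
        using that by (intro sum.cong) (auto simp: G_def)
      then show ?thesis using that by simp
    qed
    have c1: "const_fract (1 :: 'k) = 1" by (simp flip: one_pCons)
    have "\<gamma> v = ring.unit_fun class_ring n i"
      unfolding \<gamma>_def comp_def mat_map_class_ring v(2) ring.unit_fun_def[OF class_ring.ring_axioms]
        carrier_matD[OF G]
      using i by (intro restrict_ext) (auto simp: row c1)
    then have "ring.unit_fun class_ring n i \<in> \<gamma> ` ?E"
      using imageI[OF v(1), of \<gamma>] by simp
    then show "ring.unit_fun class_ring n i \<in> s.W.span (\<gamma> ` ?E)"
      using s.W.in_own_span[OF car] by blast
  qed
  show ?thesis
  proof (rule representable_fractI)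
    show "linear_map class_ring (ground M) (module_vec TYPE('k) (qdim M)) \<phi>"
      "bij_betw \<phi> (carrier (ground M)) (carrier_vec (qdim M))" "G \<in> carrier_mat n (qdim M)"
      using \<phi> G by (simp_all add: n_def)
    show "n = nat (qrank M)" using r by (simp add: n_def)
  next
    fix A assume A: "A \<in> subspaces (ground M)"
    note AE = subspace_subset[OF A]
    have "s.W.span_dim (\<gamma> ` ?E) + span_dim A \<le> s.W.span_dim (\<gamma> ` A) + span_dim ?E"
      by (rule s.span_dim_image_increase[OF fin_dim fd AE subset_refl]) (use AE in_own_span[OF subset_refl] in auto)
    moreover have "s.W.span_dim (\<gamma> ` A) \<le> span_dim A"
      by (rule s.span_dim_image_le[OF fin_dim fd AE])
    moreover have "rk M ?E + int (span_dim A) \<le> rk M A + int (span_dim ?E)"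
      by (rule rk_increase[OF A carrier_subspace AE])
    ultimately show "rk M A = int (s.W.span_dim ((mat_map class_ring const_fract G \<circ> \<phi>) ` A))"
      using full rk_le[OF A] r unfolding \<gamma>_def[symmetric] qrank_def[symmetric] qdim_eq[symmetric] n_def[symmetric]
      by linarith
  qed
qed

end

lemma linear_functional_coordinates:
  fixes g :: "'k::field vec \<Rightarrow> 'k"
  assumes add: "\<And>x y. x \<in> carrier_vec n \<Longrightarrow> y \<in> carrier_vec n \<Longrightarrow> g (x + y) = g x + g y"
    and smult: "\<And>c x. x \<in> carrier_vec n \<Longrightarrow> g (c \<cdot>\<^sub>v x) = c * g x"
    and x: "x \<in> carrier_vec n"
  shows "g x = (\<Sum>j<n. x $ j * g (unit_vec n j))"
proof -
  interpret V: vec_space "TYPE('k)" n .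
  let ?S = "{x \<in> carrier_vec n. g x = (\<Sum>j<n. x $ j * g (unit_vec n j))}"
  have g0: "g (0\<^sub>v n) = 0" using smult[of "0\<^sub>v n" 0] by simp
  have "submodule class_ring ?S (module_vec TYPE('k) n)"
  proof (rule submodule.intro)
    show "Module.module class_ring (module_vec TYPE('k) n)" by (rule vec_module)
  qed (auto simp: module_vec_simps add smult g0 distrib_right sum.distrib sum_distrib_left mult.assoc)
  moreover have "set (unit_vecs n) \<subseteq> ?S"
  proof -
    have u: "g (unit_vec n i) = (\<Sum>j<n. unit_vec n i $ j * g (unit_vec n j))" if "i < n" for i
    proof -
      have "(\<Sum>j<n. unit_vec n i $ j * g (unit_vec n j)) = (\<Sum>j<n. if j = i then g (unit_vec n j) else 0)"
        using that by (intro sum.cong) auto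
      then show ?thesis using that by simp
    qed
    show ?thesis
    proof
      fix y :: "'k vec" assume "y \<in> set (unit_vecs n)"
      then obtain i where i: "i < n" and y: "y = unit_vec n i"
        unfolding unit_vecs_def set_map set_upt by fastforce
      show "y \<in> ?S"
        unfolding y mem_Collect_eq by (rule conjI[OF unit_vec_carrier u[OF i]])
    qed
  qed
  ultimately have "carrier_vec n \<subseteq> ?S"
    using V.span_is_subset[of "set (unit_vecs n)" ?S] V.span_unit_vecs_is_carrier by simp
  then show ?thesis using x by blast
qed

lemma separating_functional:
  fixes V :: "('k::field, 'v) module"
  assumes V: "vectorspace class_ring V" and fd: "vectorspace.fin_dim class_ring V"
    and A: "submodule class_ring A V" and v: "v \<in> carrier V" "v \<notin> A"
  obtains f :: "'v \<Rightarrow> 'k" where "\<And>x y. x \<in> carrier V \<Longrightarrow> y \<in> carrier V \<Longrightarrow> f (x \<oplus>\<^bsub>V\<^esub> y) = f x + f y"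
    "\<And>c x. x \<in> carrier V \<Longrightarrow> f (c \<odot>\<^bsub>V\<^esub> x) = c * f x" "\<And>x. x \<in> A \<Longrightarrow> f x = 0" "f v \<noteq> 0"
proof -
  interpret V: vectorspace class_ring V by (rule V)
  let ?n = "V.dim" and ?m = "V.span_dim A"
  obtain \<phi> where lin: "linear_map class_ring V (module_vec TYPE('k) ?n) \<phi>"
      and bij: "bij_betw \<phi> (carrier V) (carrier_vec ?n)"
      and \<phi>A: "\<phi> ` A = {x \<in> carrier_vec ?n. \<forall>i<?n. ?m \<le> i \<longrightarrow> x $ i = 0}"
    by (rule adapted_coordinates[OF V fd A refl refl])
  interpret l: linear_map class_ring V "module_vec TYPE('k) ?n" \<phi> by (rule lin)
  have \<phi>c: "\<phi> x \<in> carrier_vec ?n" if "x \<in> carrier V" for x using bij_betwE[OF bij] that by blast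
  have "\<phi> v \<notin> \<phi> ` A"
    using inj_on_image_mem_iff[OF bij_betw_imp_inj_on[OF bij] v(1) submodule.subset[OF A]] v(2) by simp
  then obtain i where i: "i < ?n" "?m \<le> i" "\<phi> v $ i \<noteq> 0" unfolding \<phi>A using \<phi>c[OF v(1)] by auto
  show ?thesis
  proof (rule that[of "\<lambda>x. \<phi> x $ i"])
    fix x y assume "x \<in> carrier V" "y \<in> carrier V"
    then show "\<phi> (x \<oplus>\<^bsub>V\<^esub> y) $ i = \<phi> x $ i + \<phi> y $ i"
      using l.T_add[of x y] carrier_vecD[OF \<phi>c[of x]] carrier_vecD[OF \<phi>c[of y]] i(1)
      by (simp add: module_vec_simps)
  next
    fix c x assume "x \<in> carrier V"
    then show "\<phi> (c \<odot>\<^bsub>V\<^esub> x) $ i = c * \<phi> x $ i"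
      using l.T_smult[of c x] carrier_vecD[OF \<phi>c[of x]] i(1) by (simp add: module_vec_simps)
  next
    fix x assume "x \<in> A"
    then have "\<phi> x \<in> \<phi> ` A" by (rule imageI)
    then show "\<phi> x $ i = 0" unfolding \<phi>A using i by auto
  qed (rule i(3))
qed

context q_matroid
begin

text \<open>
  Let \<open>Z\<close> be the unique circuit and \<open>m\<close> its dimension, choose coordinates in which \<open>Z\<close> is spanned by
  the first \<open>m\<close> unit vectors, and let \<open>z = (1, t, \<dots>, t\<^sup>m\<^sup>-\<^sup>1, 0, \<dots>, 0)\<close>. The matrix \<open>G\<close> has
  kernel \<open>L z\<close>: its \<open>i\<close>-th row sends \<open>x\<close> to \<open>x\<^sub>i\<^sub>+\<^sub>1 - z\<^sub>i\<^sub>+\<^sub>1 x\<^sub>0\<close>.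

  If \<open>A\<close> contains \<open>Z\<close>, then it loses one dimension, because the image of \<open>Z\<close> is supported on the
  first \<open>m - 1\<close> coordinates. Otherwise \<open>A\<close> lies in the kernel \<open>H\<close> of a functional \<open>f\<close> over \<open>K\<close> that
  does not vanish on \<open>Z\<close>. The value of \<open>f\<close> at \<open>z\<close> is a combination of powers of \<open>t\<close> whose
  coefficients in \<open>K\<close> are not all zero, hence not zero. So \<open>z\<close> is not in the \<open>L\<close>-span of \<open>H\<close>,
  and the image of \<open>H\<close> still spans \<open>L\<^sup>n\<^sup>-\<^sup>1\<close>. As \<open>H\<close> has dimension \<open>n - 1\<close>, nothing is lost on \<open>H\<close>, nor
  on \<open>A\<close>.
\<close>
lemma representable_corank_1:
  assumes r: "qrank M + 1 = int (qdim M)"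
  shows "representable TYPE('k poly fract) M"
proof -
  obtain Z where Z: "Z \<in> subspaces (ground M)"
    and rk: "\<And>A. A \<in> subspaces (ground M) \<Longrightarrow> rk M A = int (span_dim A) - (if Z \<subseteq> A then 1 else 0)"
    by (rule unique_circuit[OF r]) blast
  let ?E = "carrier (ground M)"
  define n where "n = qdim M"
  define k where "k = n - 1"
  define m where "m = span_dim Z"
  have nk: "n = Suc k" and qr: "qrank M = int k"
    using r rk_nonneg[OF carrier_subspace] unfolding n_def k_def qrank_def by auto
  have m0: "0 < m"
    using rk[OF Z] rk_nonneg[OF Z] by (simp add: m_def)
  obtain \<phi> where \<phi>: "linear_map class_ring (ground M) (module_vec TYPE('k) n) \<phi>"
      "bij_betw \<phi> ?E (carrier_vec n)"
      and \<phi>Z: "\<phi> ` Z = {x \<in> carrier_vec n. \<forall>i<n. m \<le> i \<longrightarrow> x $ i = 0}" and mn: "m \<le> n"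
    by (rule adapted_coordinates[OF vectorspace_axioms fin_dim
        Z[unfolded subspaces_iff] n_def[unfolded qdim_def] m_def])
  interpret l: linear_map class_ring "ground M" "module_vec TYPE('k) n" \<phi> by (rule \<phi>(1))
  define z :: "nat \<Rightarrow> 'k poly fract" where "z j = (if j < m then indet_fract ^ j else 0)" for j
  define G :: "'k poly fract mat" where
    "G = mat k n (\<lambda>(i, j). if j = 0 then - z (Suc i) else if j = Suc i then 1 else 0)"
  have G: "G \<in> carrier_mat k n" by (simp add: G_def)
  define \<gamma> where "\<gamma> = mat_map class_ring const_fract G \<circ> \<phi>"
  interpret s: semilinear_map class_ring "ground M" class_ring "ring.func_space class_ring {..<k}"
    const_fract \<gamma>
    unfolding \<gamma>_def by (rule semilinear_coordinates[OF \<phi>(1)[unfolded n_def] G[unfolded n_def]])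
  note fd = func_space_class_ring_fin_dim
  have \<gamma>: "\<gamma> v i = const_fract (\<phi> v $ Suc i) - z (Suc i) * const_fract (\<phi> v $ 0)" if "i < k" for v i
  proof -
    let ?c = "\<lambda>j. const_fract (\<phi> v $ j)"
    have "\<gamma> v i = (\<Sum>j<Suc k. G $$ (i, j) * ?c j)"
      unfolding \<gamma>_def comp_def mat_map_class_ring carrier_matD[OF G] using that by (simp add: nk)
    also have "\<dots> = G $$ (i, 0) * ?c 0 + (\<Sum>j<k. G $$ (i, Suc j) * ?c (Suc j))"
      by (rule sum.lessThan_Suc_shift)
    also have "(\<Sum>j<k. G $$ (i, Suc j) * ?c (Suc j)) = (\<Sum>j<k. if j = i then ?c (Suc j) else 0)"
      using that by (intro sum.cong) (auto simp: G_def nk)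
    also have "\<dots> = ?c (Suc i)" using that by simp
    finally show ?thesis using that by (simp add: G_def nk)
  qed
  have car: "\<gamma> ` A \<subseteq> carrier (ring.func_space class_ring {..<k})" if "A \<subseteq> ?E" for A
    using s.closed that by blast
  define b where "b j = the_inv_into ?E \<phi> (unit_vec n j)" for j
  have b: "b j \<in> ?E" "\<phi> (b j) = unit_vec n j" for j
    using f_the_inv_into_f_bij_betw[OF \<phi>(2), of "unit_vec n j"]
      bspec[OF bij_betwE[OF bij_betw_the_inv_into[OF \<phi>(2)]], of "unit_vec n j"]
    by (auto simp: b_def)
  have c1: "const_fract (1 :: 'k) = 1" by (simp flip: one_pCons)
  have \<gamma>b0: "\<gamma> (b 0) i = - z (Suc i)" if "i < k" for i
    using that by (simp add: \<gamma> b nk c1)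
  have \<gamma>bS: "\<gamma> (b (Suc j)) i = (if i = j then 1 else 0)" if "i < k" "j < k" for i j
    using that by (simp add: \<gamma> b nk c1)
  have ext: "\<gamma> v \<in> extensional {..<k}" for v
    unfolding \<gamma>_def comp_def mat_map_def carrier_matD[OF G] by simp
  have \<gamma>_unit: "\<gamma> (b (Suc j)) = ring.unit_fun class_ring k j" if "j < k" for j
    by (rule extensionalityI[OF ext]) (simp_all add: ring.unit_fun_def[OF class_ring.ring_axioms] \<gamma>bS that)
  \<comment> \<open>The kernel contains \<open>z\<close>.\<close>
  have z_sum: "(\<Sum>j<n. z j * \<gamma> (b j) i) = 0" if "i < k" for i
  proof -
    have "(\<Sum>j<n. z j * \<gamma> (b j) i) = z 0 * \<gamma> (b 0) i + (\<Sum>j<k. z (Suc j) * \<gamma> (b (Suc j)) i)"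
      unfolding nk by (rule sum.lessThan_Suc_shift)
    also have "(\<Sum>j<k. z (Suc j) * \<gamma> (b (Suc j)) i) = (\<Sum>j<k. if j = i then z (Suc j) else 0)"
      using that by (intro sum.cong) (auto simp: \<gamma>bS)
    finally show ?thesis using that m0 by (simp add: \<gamma>b0 z_def)
  qed
  have full: "s.W.span_dim (\<gamma> ` H) = k"
    if H: "H = {v \<in> ?E. f v = 0}" and f_add: "\<And>x y. x \<in> ?E \<Longrightarrow> y \<in> ?E \<Longrightarrow> f (x \<oplus>\<^bsub>ground M\<^esub> y) = f x + f y"
      and f_smult: "\<And>c x. x \<in> ?E \<Longrightarrow> f (c \<odot>\<^bsub>ground M\<^esub> x) = c * f x"
      and f_b: "p < m" "f (b p) \<noteq> 0" for H and f :: "'v \<Rightarrow> 'k" and p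
  proof (rule span_dim_full)
    have HE: "H \<subseteq> ?E" using H by auto
    show "\<gamma> ` H \<subseteq> carrier (ring.func_space class_ring {..<k})" by (rule car[OF HE])
    let ?T = "s.W.span (\<gamma> ` H)"
    have T: "submodule class_ring ?T (ring.func_space class_ring {..<k})"
      by (rule s.W.span_is_submodule[OF car[OF HE]])
    let ?c = "\<lambda>j. const_fract (f (b j))"
    \<comment> \<open>Multiples of the vectors \<open>b j - (f (b j) / f (b p)) b p\<close>, which span \<open>H\<close>.\<close>
    define x where "x j = (f (b p) \<odot>\<^bsub>ground M\<^esub> b j) \<oplus>\<^bsub>ground M\<^esub> ((- f (b j)) \<odot>\<^bsub>ground M\<^esub> b p)" for j
    have xE: "x j \<in> ?E" for j using b by (simp add: x_def)
    have "f (x j) = 0" for j using b by (simp add: x_def f_add f_smult)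
    then have "x j \<in> H" for j using xE H by blast
    then have xT: "\<gamma> (x j) \<in> ?T" for j using s.W.in_own_span[OF car[OF HE]] by blast
    have \<gamma>x: "\<gamma> (x j) i = ?c p * \<gamma> (b j) i - ?c j * \<gamma> (b p) i" if "i < k" for i j
    proof -
      have "const_fract (- f (b j)) = - ?c j" by (simp flip: to_fract_uminus)
      then show ?thesis
        using that b s.add[of "f (b p) \<odot>\<^bsub>ground M\<^esub> b j" "(- f (b j)) \<odot>\<^bsub>ground M\<^esub> b p"]
          s.smult[of "f (b p)" "b j"] s.smult[of "- f (b j)" "b p"]
        by (simp add: x_def ring.func_space_def[OF class_ring.ring_axioms])
    qed
    define S where "S = (\<Sum>j<n. z j * ?c j)"
    have "S = (\<Sum>j\<in>{..<m}. indet_fract ^ j * ?c j)"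
      unfolding S_def z_def using mn by (intro sum.mono_neutral_cong_right) auto
    then have S0: "S \<noteq> 0" using f_b indet_powers_independent[of "{..<m}" "\<lambda>j. f (b j)"] by auto
    have cp: "?c p \<noteq> 0" using f_b by simp
    \<comment> \<open>Weighting the \<open>x j\<close> by \<open>z j\<close> kills the first terms by \<open>z_sum\<close> and leaves \<open>- S\<close> times \<open>\<gamma> (b p)\<close>.\<close>
    have "(\<lambda>i\<in>{..<k}. \<Sum>j<n. (- z j / S) * \<gamma> (x j) i) \<in> ?T"
      by (rule submodule_func_space_sum[OF T]) (use xT in auto)
    also have "(\<lambda>i\<in>{..<k}. \<Sum>j<n. (- z j / S) * \<gamma> (x j) i) = \<gamma> (b p)"
    proof (rule extensionalityI[OF _ ext])
      fix i assume "i \<in> {..<k}"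
      then have i: "i < k" by simp
      have "(\<Sum>j<n. (- z j / S) * \<gamma> (x j) i)
          = (\<Sum>j<n. (- ?c p / S) * (z j * \<gamma> (b j) i) + (\<gamma> (b p) i / S) * (z j * ?c j))"
        by (intro sum.cong refl) (simp add: \<gamma>x[OF i] S0 field_simps)
      also have "\<dots> = (- ?c p / S) * (\<Sum>j<n. z j * \<gamma> (b j) i) + (\<gamma> (b p) i / S) * S"
        unfolding sum.distrib sum_distrib_left[symmetric] S_def ..
      also have "\<dots> = \<gamma> (b p) i" using z_sum[OF i] S0 by simp
      finally show "(\<lambda>i\<in>{..<k}. \<Sum>j<n. (- z j / S) * \<gamma> (x j) i) i = \<gamma> (b p) i" using i by simp
    qed simp
    finally have bpT: "\<gamma> (b p) \<in> ?T" .
    fix j assume j: "j < k"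
    let ?F = "\<lambda>t. if t then \<gamma> (x (Suc j)) else \<gamma> (b p)"
    let ?d = "\<lambda>t. if t then 1 / ?c p else ?c (Suc j) / ?c p"
    have "(\<lambda>i\<in>{..<k}. \<Sum>t\<in>{True, False}. ?d t * ?F t i) \<in> ?T"
      by (rule submodule_func_space_sum[OF T]) (use xT bpT in auto)
    also have "(\<lambda>i\<in>{..<k}. \<Sum>t\<in>{True, False}. ?d t * ?F t i) = \<gamma> (b (Suc j))"
      by (rule extensionalityI[OF _ ext]) (use cp in \<open>auto simp: \<gamma>x field_simps\<close>)
    also have "\<dots> = ring.unit_fun class_ring k j" by (rule \<gamma>_unit[OF j])
    finally show "ring.unit_fun class_ring k j \<in> ?T" .
  qed
  have fullE: "s.W.span_dim (\<gamma> ` ?E) = k"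
  proof (rule span_dim_full[OF car[OF subset_refl]])
    fix j assume "j < k"
    then have "ring.unit_fun class_ring k j \<in> \<gamma> ` ?E"
      using imageI[OF b(1), of \<gamma> "Suc j"] \<gamma>_unit by simp
    then show "ring.unit_fun class_ring k j \<in> s.W.span (\<gamma> ` ?E)"
      using s.W.in_own_span[OF car[OF subset_refl]] by blast
  qed
  have spE: "A \<subseteq> span B" if "A \<subseteq> B" "B \<subseteq> ?E" for A B using in_own_span[OF that(2)] that(1) by blast
  have dE: "span_dim ?E = n" unfolding n_def qdim_eq ..
  have Z_le: "s.W.span_dim (\<gamma> ` Z) \<le> m - 1"
  proof (rule span_dim_supported_class_ring[OF car[OF subspace_subset[OF Z]]])
    fix g i assume g: "g \<in> \<gamma> ` Z" and i: "i < k" "m - 1 \<le> i"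
    then obtain v where v: "v \<in> Z" "g = \<gamma> v" by auto
    then have "\<phi> v \<in> \<phi> ` Z" by auto
    then have "\<phi> v $ Suc i = 0" unfolding \<phi>Z using i nk by auto
    moreover have "z (Suc i) = 0" using i(2) by (auto simp: z_def)
    ultimately show "g i = 0" using \<gamma>[OF i(1), of v] v(2) by simp
  qed
  show ?thesis
  proof (rule representable_fractI)
    show "linear_map class_ring (ground M) (module_vec TYPE('k) (qdim M)) \<phi>"
      "bij_betw \<phi> (carrier (ground M)) (carrier_vec (qdim M))" "G \<in> carrier_mat k (qdim M)"
      using \<phi> G by (simp_all add: n_def)
    show "k = nat (qrank M)" using qr by simp
  next
    fix A assume A: "A \<in> subspaces (ground M)"
    note AE = subspace_subset[OF A]
    have lower: "s.W.span_dim (\<gamma> ` ?E) + span_dim A \<le> s.W.span_dim (\<gamma> ` A) + span_dim ?E"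
      by (rule s.span_dim_image_increase[OF fin_dim fd AE subset_refl spE[OF AE subset_refl]])
    have upper: "s.W.span_dim (\<gamma> ` A) \<le> span_dim A"
      by (rule s.span_dim_image_le[OF fin_dim fd AE])
    have "rk M A = int (s.W.span_dim (\<gamma> ` A))"
    proof (cases "Z \<subseteq> A")
      case True
      have "s.W.span_dim (\<gamma> ` A) + span_dim Z \<le> s.W.span_dim (\<gamma> ` Z) + span_dim A"
        by (rule s.span_dim_image_increase[OF fin_dim fd subspace_subset[OF Z] AE spE[OF True AE]])
      then show ?thesis
        using True rk[OF A] Z_le lower m0 unfolding fullE dE nk m_def[symmetric] by auto
    next
      case False
      then obtain v where v: "v \<in> Z" "v \<notin> A" by auto
      have vE: "v \<in> ?E" using v subspace_subset[OF Z] by auto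
      obtain f :: "'v \<Rightarrow> 'k" where f: "\<And>x y. x \<in> ?E \<Longrightarrow> y \<in> ?E \<Longrightarrow> f (x \<oplus>\<^bsub>ground M\<^esub> y) = f x + f y"
          "\<And>c x. x \<in> ?E \<Longrightarrow> f (c \<odot>\<^bsub>ground M\<^esub> x) = c * f x" "\<And>x. x \<in> A \<Longrightarrow> f x = 0" "f v \<noteq> 0"
        by (rule separating_functional[OF vectorspace_axioms fin_dim A[unfolded subspaces_iff] vE v(2)]) blast
      have "\<exists>p<m. f (b p) \<noteq> 0"
      proof (rule ccontr)
        assume "\<not> (\<exists>p<m. f (b p) \<noteq> 0)"
        then have fb: "f (b p) = 0" if "p < m" for p using that by blast
        let ?g = "\<lambda>x. f (the_inv_into ?E \<phi> x)"
        have inv\<phi>: "the_inv_into ?E \<phi> x \<in> ?E" "\<phi> (the_inv_into ?E \<phi> x) = x" if "x \<in> carrier_vec n" for x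
          using f_the_inv_into_f_bij_betw[OF \<phi>(2), of x] bspec[OF bij_betwE[OF bij_betw_the_inv_into[OF \<phi>(2)]], of x] that
          by auto
        have \<phi>inv: "the_inv_into ?E \<phi> (\<phi> w) = w" if "w \<in> ?E" for w
          by (rule the_inv_into_f_f[OF bij_betw_imp_inj_on[OF \<phi>(2)] that])
        have g_add: "?g (x + y) = ?g x + ?g y" if "x \<in> carrier_vec n" "y \<in> carrier_vec n" for x y
        proof -
          let ?x = "the_inv_into ?E \<phi> x" and ?y = "the_inv_into ?E \<phi> y"
          have "\<phi> (?x \<oplus>\<^bsub>ground M\<^esub> ?y) = x + y"
            using l.T_add[of ?x ?y] inv\<phi> that by (simp add: module_vec_simps)
          then have "the_inv_into ?E \<phi> (x + y) = ?x \<oplus>\<^bsub>ground M\<^esub> ?y"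
            using \<phi>inv[of "?x \<oplus>\<^bsub>ground M\<^esub> ?y"] inv\<phi> that by simp
          then show ?thesis using f(1) inv\<phi> that by simp
        qed
        have g_smult: "?g (c \<cdot>\<^sub>v x) = c * ?g x" if "x \<in> carrier_vec n" for c x
        proof -
          let ?x = "the_inv_into ?E \<phi> x"
          have "\<phi> (c \<odot>\<^bsub>ground M\<^esub> ?x) = c \<cdot>\<^sub>v x"
            using l.T_smult[of c ?x] inv\<phi> that by (simp add: module_vec_simps)
          then have "the_inv_into ?E \<phi> (c \<cdot>\<^sub>v x) = c \<odot>\<^bsub>ground M\<^esub> ?x"
            using \<phi>inv[of "c \<odot>\<^bsub>ground M\<^esub> ?x"] inv\<phi> that by simp
          then show ?thesis using f(2) inv\<phi> that by simp
        qed
        have \<phi>v: "\<phi> v \<in> \<phi> ` Z" using v(1) by (rule imageI)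
        have "?g (\<phi> v) = (\<Sum>j<n. \<phi> v $ j * ?g (unit_vec n j))"
          by (rule linear_functional_coordinates[OF g_add g_smult]) (use \<phi>v \<phi>Z in auto)
        also have "\<dots> = 0"
        proof (rule sum.neutral, rule ballI)
          fix j assume "j \<in> {..<n}"
          then show "\<phi> v $ j * ?g (unit_vec n j) = 0"
            using \<phi>v fb[of j] unfolding \<phi>Z b_def by (cases "j < m") auto
        qed
        finally show False using f(4) \<phi>inv[OF vE] by simp
      qed
      then obtain p where p: "p < m" "f (b p) \<noteq> 0" by auto
      define H where "H = {v \<in> ?E. f v = 0}"
      have HE: "H \<subseteq> ?E" by (auto simp: H_def)
      have f0: "f \<zero>\<^bsub>ground M\<^esub> = 0" by (rule f(3)[OF submodule.zero_closed[OF A[unfolded subspaces_iff]]])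
      have H: "submodule class_ring H (ground M)"
        by (rule submodule.intro[OF module_axioms]) (auto simp: H_def f f0)
      have "H \<noteq> ?E" using f(4) vE by (auto simp: H_def)
      then have Hk: "span_dim H \<le> k"
        using submodule_eqI_span_dim[OF fin_dim H carrier_subspace[unfolded subspaces_iff] HE] dE nk by linarith
      have AH: "A \<subseteq> H" using AE f(3) by (auto simp: H_def)
      have "s.W.span_dim (\<gamma> ` H) + span_dim A \<le> s.W.span_dim (\<gamma> ` A) + span_dim H"
        by (rule s.span_dim_image_increase[OF fin_dim fd AE HE spE[OF AH HE]])
      then show ?thesis
        using Hk upper rk[OF A] False full[OF H_def f(1,2) p] by simp
    qed
    then show "rk M A = int (s.W.span_dim ((mat_map class_ring const_fract G \<circ> \<phi>) ` A))"
      unfolding \<gamma>_def .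
  qed
qed

text \<open>
  Up to dimension 3 every rank is 0, 1, full, or one less than full.
\<close>
lemma representable_dim_le_3:
  assumes "qdim M \<le> 3"
  shows "representable TYPE('k poly fract) M"
proof -
  have "0 \<le> qrank M" "qrank M \<le> int (qdim M)"
    using rk_nonneg[OF carrier_subspace] rk_le[OF carrier_subspace] by (auto simp: qrank_def qdim_eq)
  then have "qrank M = 0 \<or> qrank M = 1 \<or> qrank M + 1 = int (qdim M) \<or> qrank M = int (qdim M)"
    using assms by linarith
  then show ?thesis
    using representable_rank_0 representable_rank_1 representable_corank_1 representable_full_rank by blast
qed

end

section \<open>The alternating form of a representation of rank two\<close>

lemma (in field) det_eq_0_iff:
  assumes x: "x \<in> carrier (func_space {..<2::nat})" and y: "y \<in> carrier (func_space {..<2})"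
  shows "x 0 \<otimes> y 1 \<ominus> x 1 \<otimes> y 0 = \<zero> \<longleftrightarrow>
    x = \<zero>\<^bsub>func_space {..<2}\<^esub> \<or> y \<in> LinearCombinations.module.span R (func_space {..<2}) {x}"
proof -
  interpret W: vectorspace R "func_space {..<2::nat}" by (rule func_space_vectorspace)
  have lt2: "i < 2 \<longleftrightarrow> i = 0 \<or> i = 1" for i :: nat by auto
  have PiE: "x \<in> {..<2} \<rightarrow>\<^sub>E carrier R" "y \<in> {..<2} \<rightarrow>\<^sub>E carrier R"
    using x y by (simp_all add: func_space_def)
  have xc: "x 0 \<in> carrier R" "x 1 \<in> carrier R" and yc: "y 0 \<in> carrier R" "y 1 \<in> carrier R"
    using PiE_mem[OF PiE(1)] PiE_mem[OF PiE(2)] by simp_all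
  have ext: "x \<in> extensional {..<2}" "y \<in> extensional {..<2}"
    using PiE by (simp_all add: PiE_def)
  have span: "y \<in> W.span {x} \<longleftrightarrow> (\<exists>c\<in>carrier R. y 0 = c \<otimes> x 0 \<and> y 1 = c \<otimes> x 1)"
  proof -
    have "y = c \<odot>\<^bsub>func_space {..<2}\<^esub> x \<longleftrightarrow> y 0 = c \<otimes> x 0 \<and> y 1 = c \<otimes> x 1" for c
    proof
      assume "y 0 = c \<otimes> x 0 \<and> y 1 = c \<otimes> x 1"
      then show "y = c \<odot>\<^bsub>func_space {..<2}\<^esub> x"
        by (intro extensionalityI[OF ext(2)]) (auto simp: func_space_def lt2)
    qed (simp add: func_space_def)
    then show ?thesis unfolding W.span_singleton[OF x] by auto
  qed
  have zero: "x = \<zero>\<^bsub>func_space {..<2}\<^esub> \<longleftrightarrow> x 0 = \<zero> \<and> x 1 = \<zero>"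
  proof
    assume "x 0 = \<zero> \<and> x 1 = \<zero>"
    then show "x = \<zero>\<^bsub>func_space {..<2}\<^esub>"
      by (intro extensionalityI[OF ext(1)]) (auto simp: func_space_def lt2)
  qed (simp add: func_space_def)
  have det: "x 0 \<otimes> y 1 \<ominus> x 1 \<otimes> y 0 = \<zero> \<longleftrightarrow> x 0 \<otimes> y 1 = x 1 \<otimes> y 0"
    using xc yc by (simp add: minus_other_side)
  show ?thesis unfolding span zero det
  proof
    assume eq: "x 0 \<otimes> y 1 = x 1 \<otimes> y 0"
    have pivot: "p = (inv a \<otimes> p) \<otimes> a" "q = (inv a \<otimes> p) \<otimes> b" "inv a \<otimes> p \<in> carrier R"
      if "a \<in> carrier R" "a \<noteq> \<zero>" "b \<in> carrier R" "p \<in> carrier R" "q \<in> carrier R" "a \<otimes> q = b \<otimes> p"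
      for a b p q
    proof -
      have ia: "inv a \<in> carrier R" by (rule inverse_exists[OF that(1,2)])
      have cancel: "inv a \<otimes> (a \<otimes> c) = c" if "c \<in> carrier R" for c
        using that \<open>a \<in> carrier R\<close> \<open>a \<noteq> \<zero>\<close> ia field_Units by (simp flip: m_assoc)
      show "p = (inv a \<otimes> p) \<otimes> a"
        using cancel[OF that(4)] m_comm[OF that(4,1)] m_assoc[OF ia that(4,1)] by simp
      show "q = (inv a \<otimes> p) \<otimes> b"
        using cancel[OF that(5)] m_comm[OF that(4,3)] m_assoc[OF ia that(4,3)] that(6) by simp
      show "inv a \<otimes> p \<in> carrier R" using ia that(4) by simp
    qed
    show "x 0 = \<zero> \<and> x 1 = \<zero> \<or> (\<exists>c\<in>carrier R. y 0 = c \<otimes> x 0 \<and> y 1 = c \<otimes> x 1)"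
      using pivot[OF xc(1) _ xc(2) yc eq] pivot[OF xc(2) _ xc(1) yc(2,1) eq[symmetric]] by blast
  next
    assume "x 0 = \<zero> \<and> x 1 = \<zero> \<or> (\<exists>c\<in>carrier R. y 0 = c \<otimes> x 0 \<and> y 1 = c \<otimes> x 1)"
    then show "x 0 \<otimes> y 1 = x 1 \<otimes> y 0"
      using xc yc by (auto simp: m_ac)
  qed
qed

context q_matroid
begin

text \<open>
  Take for \<open>D u v\<close> the determinant of the matrix whose columns are the images of \<open>u\<close> and \<open>v\<close> in
  \<open>L\<^sup>2\<close>. It vanishes if and only if these images are proportional over \<open>L\<close>.
\<close>
lemma representation_form:
  assumes r: "qrank M = 2" and rep: "representable TYPE('l) M"
  obtains L :: "'l ring" and D :: "'v \<Rightarrow> 'v \<Rightarrow> 'l" where "abelian_group L"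
    "\<And>u v. u \<in> carrier (ground M) \<Longrightarrow> v \<in> carrier (ground M) \<Longrightarrow> D u v \<in> carrier L"
    "\<And>u v w. u \<in> carrier (ground M) \<Longrightarrow> v \<in> carrier (ground M) \<Longrightarrow> w \<in> carrier (ground M) \<Longrightarrow>
       D (u \<oplus>\<^bsub>ground M\<^esub> v) w = D u w \<oplus>\<^bsub>L\<^esub> D v w"
    "\<And>u v w. u \<in> carrier (ground M) \<Longrightarrow> v \<in> carrier (ground M) \<Longrightarrow> w \<in> carrier (ground M) \<Longrightarrow>
       D u (v \<oplus>\<^bsub>ground M\<^esub> w) = D u v \<oplus>\<^bsub>L\<^esub> D u w"
    "\<And>u v. u \<in> carrier (ground M) \<Longrightarrow> v \<in> carrier (ground M) \<Longrightarrow>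
       D u v = \<zero>\<^bsub>L\<^esub> \<longleftrightarrow> rk M (span {u, v}) \<le> 1"
proof -
  obtain L :: "'l ring" and h \<phi> G where L: "field L" and h: "h \<in> Ring.ring_hom (class_ring :: 'k ring) L"
      and \<phi>: "linear_map class_ring (ground M) (module_vec TYPE('k) (qdim M)) \<phi>"
      and G: "G \<in> carrier_mat 2 (qdim M)" "elements_mat G \<subseteq> carrier L"
      and rk: "\<And>A. A \<in> subspaces (ground M) \<Longrightarrow> rk M A =
           int (vectorspace.span_dim L (ring.func_space L {..<2}) (mat_map L h G ` \<phi> ` A))"
    using rep unfolding representable_iff[OF vectorspace_axioms] r by auto
  interpret L: field L by (rule L)
  define \<gamma> where "\<gamma> = mat_map L h G \<circ> \<phi>"
  interpret s: semilinear_map class_ring "ground M" L "L.func_space {..<2}" h \<gamma>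
    unfolding \<gamma>_def by (rule semilinear_map.semilinear_comp[OF semilinear_mat_map[OF L h G] \<phi>])
  let ?E = "carrier (ground M)"
  have c: "\<gamma> v 0 \<in> carrier L" "\<gamma> v 1 \<in> carrier L" if "v \<in> ?E" for v
    using PiE_mem[of "\<gamma> v" "{..<2}" "\<lambda>_. carrier L"] s.closed[OF that]
    by (simp_all add: L.func_space_def)
  have a: "\<gamma> (u \<oplus>\<^bsub>ground M\<^esub> v) 0 = \<gamma> u 0 \<oplus>\<^bsub>L\<^esub> \<gamma> v 0" "\<gamma> (u \<oplus>\<^bsub>ground M\<^esub> v) 1 = \<gamma> u 1 \<oplus>\<^bsub>L\<^esub> \<gamma> v 1"
    if "u \<in> ?E" "v \<in> ?E" for u v
    using s.add[OF that] by (simp_all add: L.func_space_def)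
  define D where "D u v = \<gamma> u 0 \<otimes>\<^bsub>L\<^esub> \<gamma> v 1 \<ominus>\<^bsub>L\<^esub> \<gamma> u 1 \<otimes>\<^bsub>L\<^esub> \<gamma> v 0" for u v
  show ?thesis
  proof (rule that[of L D])
    show "abelian_group L" by (rule L.abelian_group_axioms)
  next
    fix u v assume uv: "u \<in> ?E" "v \<in> ?E"
    show "D u v \<in> carrier L" using c[OF uv(1)] c[OF uv(2)] by (simp add: D_def)
    have sub: "{u, v} \<subseteq> ?E" using uv by auto
    have "rk M (span {u, v}) = int (s.W.span_dim (\<gamma> ` span {u, v}))"
      using rk[OF span_subspace[OF sub]] by (simp add: \<gamma>_def image_comp)
    also have "s.W.span_dim (\<gamma> ` span {u, v}) = s.W.span_dim (\<gamma> ` {u, v})"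
      by (rule s.W.span_dim_cong[OF s.span_image_cong[OF span_is_subset2[OF sub] sub]])
        (rule span_submodule[OF span_is_submodule[OF sub]])
    also have "\<gamma> ` {u, v} = {\<gamma> u, \<gamma> v}" by simp
    finally have "rk M (span {u, v}) \<le> 1 \<longleftrightarrow> s.W.span_dim {\<gamma> u, \<gamma> v} \<le> 1" by simp
    also have "\<dots> \<longleftrightarrow> \<gamma> u = \<zero>\<^bsub>L.func_space {..<2}\<^esub> \<or> \<gamma> v \<in> s.W.span {\<gamma> u}"
      by (rule s.W.span_dim_pair_le_1_iff[OF L.func_space_fin_dim s.closed[OF uv(1)] s.closed[OF uv(2)]])
    also have "\<dots> \<longleftrightarrow> D u v = \<zero>\<^bsub>L\<^esub>"
      unfolding D_def by (rule L.det_eq_0_iff[OF s.closed[OF uv(1)] s.closed[OF uv(2)], symmetric])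
    finally show "D u v = \<zero>\<^bsub>L\<^esub> \<longleftrightarrow> rk M (span {u, v}) \<le> 1" by simp
  next
    fix u v w assume uvw: "u \<in> ?E" "v \<in> ?E" "w \<in> ?E"
    note cs = c[OF uvw(1)] c[OF uvw(2)] c[OF uvw(3)]
    show "D (u \<oplus>\<^bsub>ground M\<^esub> v) w = D u w \<oplus>\<^bsub>L\<^esub> D v w"
      unfolding D_def a[OF uvw(1,2)] using cs by algebra
    show "D u (v \<oplus>\<^bsub>ground M\<^esub> w) = D u v \<oplus>\<^bsub>L\<^esub> D u w"
      unfolding D_def a[OF uvw(2,3)] using cs by algebra
  qed
qed

text \<open>
  By submodularity, the sum of two subspaces of rank 1 that share a vector \<open>y\<close> of rank 1 has rank 1.
\<close>
lemma rk_span_glue: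
  assumes A: "A \<in> subspaces (ground M)" and B: "B \<in> subspaces (ground M)"
    and le: "rk M A \<le> 1" "rk M B \<le> 1" and y: "y \<in> A" "y \<in> B" "rk M (span {y}) = 1"
    and S: "S \<subseteq> span (A \<union> B)"
  shows "rk M (span S) \<le> 1"
proof -
  have car: "A \<union> B \<subseteq> carrier (ground M)" using subspace_subset A B by auto
  have yE: "{y} \<subseteq> carrier (ground M)" using y(1) car by auto
  have I: "A \<inter> B \<in> subspaces (ground M)" using A B submodule_Int by (auto simp: subspaces_iff)
  have "span {y} \<subseteq> A \<inter> B"
    by (rule span_is_subset) (use y I in \<open>auto simp: subspaces_iff\<close>)
  then have "1 \<le> rk M (A \<inter> B)" using R2[OF span_subspace[OF yE] I] y(3) by simp
  moreover have SE: "S \<subseteq> carrier (ground M)" using S span_is_subset2[OF car] by auto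
  moreover have "rk M (span S) \<le> rk M (span (A \<union> B))"
    by (rule R2[OF span_subspace[OF SE] span_subspace[OF car] span_le_span[OF S car]])
  ultimately show ?thesis using rk_submodular[OF A B] le by linarith
qed

lemma subspace_dim_2:
  assumes "A \<in> subspaces (ground M)" "span_dim A = 2"
  obtains x y where "x \<in> A" "y \<in> A" "x \<noteq> \<zero>\<^bsub>ground M\<^esub>" "y \<notin> span {x}" "A = span {x, y}"
proof -
  have AE: "A \<subseteq> carrier (ground M)" by (rule subspace_subset[OF assms(1)])
  obtain U where U: "U \<subseteq> A" "finite U" "span U = span A" "card U = span_dim A"
    by (rule basis_of_span[OF fin_dim AE])
  then obtain x y where xy: "U = {x, y}" using assms(2) by (auto simp: card_2_iff)
  have A: "A = span {x, y}" using U(3) xy span_submodule assms(1) by (simp add: subspaces_iff)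
  have "span_dim {x, y} = 2" using assms(2) span_dim_cong[of "{x, y}" A] U(3) xy by simp
  then have "\<not> span_dim {x, y} \<le> 1" by simp
  then show ?thesis using span_dim_pair_le_1_iff[OF fin_dim, of x y] that[of x y] A U(1) xy AE by auto
qed

lemma span_dim_pair_eq_2:
  assumes "x \<in> carrier (ground M)" "y \<in> carrier (ground M)" "x \<noteq> \<zero>\<^bsub>ground M\<^esub>" "y \<notin> span {x}"
  shows "span_dim (span {x, y}) = 2"
proof -
  have "span_dim (span {x, y}) = span_dim {x, y}"
    by (rule span_dim_cong[OF span_submodule[OF span_is_submodule]]) (use assms in auto)
  moreover have "span_dim {x, y} \<le> card {x, y}"
    by (rule span_dim_le_card[OF fin_dim]) (use assms in auto)
  moreover have "card {x, y} \<le> 2" by (simp add: card_insert_if)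
  moreover have "\<not> span_dim {x, y} \<le> 1" using span_dim_pair_le_1_iff[OF fin_dim] assms by simp
  ultimately show ?thesis by linarith
qed

text \<open>
  Without loops all subspaces of dimension 1 are independent, so a plane is a circuit as soon as it is
  dependent.
\<close>
lemma circuit_dim_2_iff:
  assumes loopless: "\<And>v. v \<in> carrier (ground M) \<Longrightarrow> v \<noteq> \<zero>\<^bsub>ground M\<^esub> \<Longrightarrow> rk M (span {v}) = 1"
  shows "circuit M C \<and> sdim (ground M) C = 2 \<longleftrightarrow>
    C \<in> subspaces (ground M) \<and> span_dim C = 2 \<and> rk M C \<le> 1"
proof
  assume *: "circuit M C \<and> sdim (ground M) C = 2"
  then have C: "C \<in> subspaces (ground M)" "rk M C \<noteq> int (sdim (ground M) C)"
    by (auto simp: circuit_def dependent_def indep_def)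
  then show "C \<in> subspaces (ground M) \<and> span_dim C = 2 \<and> rk M C \<le> 1"
    using * sdim_eq[OF C(1)] rk_le[OF C(1)] by auto
next
  assume C: "C \<in> subspaces (ground M) \<and> span_dim C = 2 \<and> rk M C \<le> 1"
  have "indep M A" if A: "A \<in> subspaces (ground M)" "A \<subset> C" for A
  proof -
    have "span_dim A < 2"
      using submodule_eqI_span_dim[OF fin_dim, of A C] A C by (auto simp: subspaces_iff)
    moreover have "rk M A \<ge> 1" if "span_dim A \<noteq> 0"
    proof -
      obtain v where v: "v \<in> A" "v \<noteq> \<zero>\<^bsub>ground M\<^esub>"
        using \<open>span_dim A \<noteq> 0\<close> span_dim_eq_0_iff[OF fin_dim subspace_subset[OF A(1)]] by auto
      have vE: "v \<in> carrier (ground M)" using v subspace_subset[OF A(1)] by auto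
      have "span {v} \<subseteq> A" by (rule span_is_subset) (use v A in \<open>auto simp: subspaces_iff\<close>)
      then show ?thesis using R2[OF span_subspace A(1), of "{v}"] vE loopless[OF vE v(2)] by auto
    qed
    ultimately show ?thesis
      unfolding indep_def using A rk_le[OF A(1)] rk_nonneg[OF A(1)] sdim_eq[OF A(1)] by fastforce
  qed
  then show "circuit M C \<and> sdim (ground M) C = 2"
    using C sdim_eq[of C] by (auto simp: circuit_def dependent_def indep_def)
qed

end

section \<open>Lines of rank one over the field with two elements\<close>

text \<open>
  These rules would rewrite the operations inside the record \<open>class_ring\<close> over \<open>bit\<close>, and hence the
  spans that are taken over it.
\<close>
declare add_bit_eq_xor [simp del] mult_bit_eq_and [simp del]

text \<open>
  What the conditions on the four minors say about the rank function: there are no loops, and \<open>E1\<close> and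
  \<open>E2\<close> are flats of rank 1, that is, the rank rises as soon as a vector is added to them.
\<close>
locale binary_split_matroid = q_matroid M for M :: "(bit, 'v) qmatroid" +
  fixes E1 E2 :: "'v set"
  assumes E1: "E1 \<in> subspaces (ground M)" and E2: "E2 \<in> subspaces (ground M)"
    and sum: "E1 <+>\<^bsub>ground M\<^esub> E2 = carrier (ground M)" and int: "E1 \<inter> E2 = {\<zero>\<^bsub>ground M\<^esub>}"
    and dim1: "span_dim E1 = 2" and dim2: "span_dim E2 = 2"
    and rk1: "rk M E1 = 1" and rk2: "rk M E2 = 1"
    and flat1: "\<And>v. v \<in> carrier (ground M) \<Longrightarrow> v \<notin> E1 \<Longrightarrow> rk M (span (insert v E1)) = 2"
    and flat2: "\<And>v. v \<in> carrier (ground M) \<Longrightarrow> v \<notin> E2 \<Longrightarrow> rk M (span (insert v E2)) = 2"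
    and loopless: "\<And>v. v \<in> carrier (ground M) \<Longrightarrow> v \<noteq> \<zero>\<^bsub>ground M\<^esub> \<Longrightarrow> rk M (span {v}) = 1"
begin

abbreviation add_V (infixl "\<oplus>" 65) where "u \<oplus> v \<equiv> u \<oplus>\<^bsub>ground M\<^esub> v"
abbreviation zero_V ("\<zero>") where "\<zero> \<equiv> \<zero>\<^bsub>ground M\<^esub>"
abbreviation E where "E \<equiv> carrier (ground M)"

lemma add_self: "v \<in> E \<Longrightarrow> v \<oplus> v = \<zero>"
proof -
  assume v: "v \<in> E"
  have "v \<oplus> v = 1 \<odot>\<^bsub>ground M\<^esub> v \<oplus> 1 \<odot>\<^bsub>ground M\<^esub> v"
    using smult_one[OF v] by simp
  also have "\<dots> = (1 + 1) \<odot>\<^bsub>ground M\<^esub> v"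
    using smult_l_distr[of 1 1 v] v by simp
  also have "\<dots> = \<zero>" using lmult_0[OF v] by simp
  finally show ?thesis .
qed

lemma add_self_left: "u \<in> E \<Longrightarrow> v \<in> E \<Longrightarrow> u \<oplus> (u \<oplus> v) = v"
  by (simp add: add_self flip: M.a_assoc)

lemma add_eq_zero_iff: "u \<in> E \<Longrightarrow> v \<in> E \<Longrightarrow> u \<oplus> v = \<zero> \<longleftrightarrow> u = v"
  using add_self add_self_left[of u v] by auto

lemma subspace_add: "A \<in> subspaces (ground M) \<Longrightarrow> u \<in> A \<Longrightarrow> v \<in> A \<Longrightarrow> u \<oplus> v \<in> A"
  by (auto simp: subspaces_iff intro: submodule.m_closed)

lemma subspace_zero: "A \<in> subspaces (ground M) \<Longrightarrow> \<zero> \<in> A"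
  by (auto simp: subspaces_iff intro: submodule.zero_closed)

lemma in_E1: "v \<in> E1 \<Longrightarrow> v \<in> E" and in_E2: "v \<in> E2 \<Longrightarrow> v \<in> E"
  using E1 E2 subspace_subset by auto

lemma span1: "v \<in> E \<Longrightarrow> span {v} = {\<zero>, v}"
proof -
  assume v: "v \<in> E"
  have "c \<odot>\<^bsub>ground M\<^esub> v = (if c = 0 then \<zero> else v)" for c
    using lmult_0[OF v] smult_one[OF v] by (cases c) simp_all
  then show ?thesis unfolding span_singleton[OF v] by (auto intro: exI[of _ 0] exI[of _ 1])
qed

lemma span2: "u \<in> E \<Longrightarrow> v \<in> E \<Longrightarrow> span {u, v} = {\<zero>, u, v, u \<oplus> v}"
proof
  assume uv: "u \<in> E" "v \<in> E"
  have S: "span {u, v} \<in> subspaces (ground M)" by (rule span_subspace) (use uv in auto)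
  have "u \<in> span {u, v}" "v \<in> span {u, v}" using in_own_span[of "{u, v}"] uv by auto
  then show "{\<zero>, u, v, u \<oplus> v} \<subseteq> span {u, v}" using subspace_add[OF S] subspace_zero[OF S] by auto
  have sm: "c \<odot>\<^bsub>ground M\<^esub> x \<in> {\<zero>, u, v, u \<oplus> v}" if "x \<in> {\<zero>, u, v, u \<oplus> v}" for c x
  proof -
    have x: "x \<in> E" using that uv by auto
    have "c \<odot>\<^bsub>ground M\<^esub> x = \<zero> \<or> c \<odot>\<^bsub>ground M\<^esub> x = x"
      using lmult_0[OF x] smult_one[OF x] by (cases c) simp_all
    then show ?thesis using that by blast
  qed
  have "submodule class_ring {\<zero>, u, v, u \<oplus> v} (ground M)"
  proof (rule submodule.intro[OF module_axioms])
    fix x y assume "x \<in> {\<zero>, u, v, u \<oplus> v}" "y \<in> {\<zero>, u, v, u \<oplus> v}"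
    then show "x \<oplus> y \<in> {\<zero>, u, v, u \<oplus> v}"
      using uv by (auto simp: M.a_ac add_self add_self_left)
  qed (use uv sm in auto)
  then show "span {u, v} \<subseteq> {\<zero>, u, v, u \<oplus> v}" by (rule span_is_subset[rotated]) auto
qed

lemma in_span2: "u \<in> E \<Longrightarrow> v \<in> E \<Longrightarrow> u \<in> span {u, v}" "u \<in> E \<Longrightarrow> v \<in> E \<Longrightarrow> v \<in> span {u, v}"
  by (simp_all add: span2)

text \<open>
  The circuits of dimension 2 are planes, hence lines of the projective space of the ground space.
\<close>
definition lines :: "'v set set" where
  "lines = {C \<in> subspaces (ground M). span_dim C = 2 \<and> rk M C \<le> 1}"

lemma lines_eq_circuits: "lines = {C. circuit M C \<and> sdim (ground M) C = 2}"
  unfolding lines_def using circuit_dim_2_iff[OF loopless] by auto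

lemma E1_line: "E1 \<in> lines" and E2_line: "E2 \<in> lines"
  using E1 E2 dim1 dim2 rk1 rk2 by (auto simp: lines_def)

lemma line_subspace: "C \<in> lines \<Longrightarrow> C \<in> subspaces (ground M)"
  by (simp add: lines_def)

lemma line_subset: "C \<in> lines \<Longrightarrow> v \<in> C \<Longrightarrow> v \<in> E"
  using line_subspace subspace_subset by blast

lemma rk_pair_in_line: "C \<in> lines \<Longrightarrow> u \<in> C \<Longrightarrow> v \<in> C \<Longrightarrow> rk M (span {u, v}) \<le> 1"
proof -
  assume C: "C \<in> lines" and uv: "u \<in> C" "v \<in> C"
  have "span {u, v} \<subseteq> C"
    by (rule span_is_subset) (use C uv in \<open>auto simp: lines_def subspaces_iff\<close>)
  then have "rk M (span {u, v}) \<le> rk M C"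
    using R2[OF span_subspace line_subspace[OF C]] line_subset[OF C] uv by auto
  then show ?thesis using C by (simp add: lines_def)
qed

lemma pair_line:
  assumes "u \<in> E" "v \<in> E" "u \<noteq> \<zero>" "v \<noteq> \<zero>" "u \<noteq> v" "rk M (span {u, v}) \<le> 1"
  shows "span {u, v} \<in> lines"
  unfolding lines_def using span_subspace[of "{u, v}"] span_dim_pair_eq_2[of u v] span1 assms by auto

lemma line_through:
  assumes C: "C \<in> lines" and v: "v \<in> C" "v \<noteq> \<zero>"
  obtains w where "w \<in> C" "w \<noteq> \<zero>" "w \<noteq> v" "C = span {v, w}"
proof -
  obtain x y where xy: "x \<in> C" "y \<in> C" "x \<noteq> \<zero>" "y \<notin> span {x}" "C = span {x, y}"
    using C subspace_dim_2 unfolding lines_def by blast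
  note c = line_subset[OF C xy(1)] line_subset[OF C xy(2)]
  have y: "y \<noteq> \<zero>" "y \<noteq> x" using xy(4) span1[OF c(1)] by auto
  have Cs: "C = {\<zero>, x, y, x \<oplus> y}" using xy(5) span2[OF c] by simp
  consider "v = x" | "v = y" | "v = x \<oplus> y" using v Cs by auto
  then show ?thesis
  proof cases
    case 1 then show ?thesis using that[of y] xy y by auto
  next
    case 2 then show ?thesis using that[of x] xy y by (auto simp: insert_commute)
  next
    case 3
    have "span {v, x} = {\<zero>, v, x, y}"
      using span2[of v x] c 3 by (simp add: M.a_ac add_self_left)
    also have "\<dots> = C" using Cs 3 by auto
    finally have "C = span {v, x}" ..
    moreover have "x \<noteq> v" using 3 c y add_self_left[of x y] add_self[of x] by auto
    ultimately show ?thesis using that[of x] xy by auto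
  qed
qed

lemma line_eq_span:
  assumes C: "C \<in> lines" and uv: "u \<in> C" "v \<in> C" "u \<noteq> \<zero>" "v \<noteq> \<zero>" "u \<noteq> v"
  shows "C = span {u, v}"
proof -
  note c = line_subset[OF C uv(1)] line_subset[OF C uv(2)]
  have "span {u, v} \<subseteq> C"
    by (rule span_is_subset) (use C uv in \<open>auto simp: lines_def subspaces_iff\<close>)
  moreover have "span_dim (span {u, v}) = 2"
    using span_dim_pair_eq_2[OF c uv(3)] span1[OF c(1)] uv by auto
  ultimately show ?thesis
    using submodule_eqI_span_dim[OF fin_dim, of "span {u, v}" C] C span_subspace[of "{u, v}"] c
    by (auto simp: lines_def subspaces_iff)
qed

lemma decomposition:
  assumes "v \<in> E"
  obtains e f where "e \<in> E1" "f \<in> E2" "v = e \<oplus> f"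
  using assms unfolding sum[symmetric] set_add_def' by blast

text \<open>
  The vectors that together with \<open>u\<close> span a subspace of rank 1 form a subspace, the flat of \<open>u\<close>.
\<close>
lemma parallel_add:
  assumes "u \<in> E" "v \<in> E" "w \<in> E" "u \<noteq> \<zero>" "rk M (span {u, v}) \<le> 1" "rk M (span {u, w}) \<le> 1"
  shows "rk M (span {u, v \<oplus> w}) \<le> 1"
proof (rule rk_span_glue)
  show "span {u, v} \<in> subspaces (ground M)" "span {u, w} \<in> subspaces (ground M)"
    using assms by (auto intro!: span_subspace)
  show "u \<in> span {u, v}" "u \<in> span {u, w}" using in_span2 assms(1-3) by auto
  let ?S = "span (span {u, v} \<union> span {u, w})"
  have car: "span {u, v} \<union> span {u, w} \<subseteq> E"
    using span_is_subset2[of "{u, v}"] span_is_subset2[of "{u, w}"] assms(1-3) by auto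
  then have "u \<in> ?S" "v \<in> ?S" "w \<in> ?S"
    using in_own_span[of "{u, v}"] in_own_span[of "{u, w}"] in_own_span[OF car] assms(1-3)
    by auto
  then show "{u, v \<oplus> w} \<subseteq> ?S" using subspace_add[OF span_subspace[OF car]] by auto
qed (use assms loopless in auto)

lemma flat_lines:
  assumes C: "C = E1 \<or> C = E2" and e: "e \<in> C" "e \<noteq> \<zero>" and u: "u \<in> E" and P: "rk M (span {e, u}) \<le> 1"
  shows "u \<in> C"
proof (rule ccontr)
  assume n: "u \<notin> C"
  have Cl: "C \<in> lines" using C E1_line E2_line by auto
  have eE: "e \<in> E" by (rule line_subset[OF Cl e(1)])
  have CE: "C \<subseteq> E" using line_subset[OF Cl] by auto
  have eu: "span {e, u} \<in> subspaces (ground M)" by (rule span_subspace) (use eE u in auto)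
  have "rk M (span (insert u C)) \<le> 1"
  proof (rule rk_span_glue[OF line_subspace[OF Cl] eu])
    show "rk M C \<le> 1" using Cl by (simp add: lines_def)
    show "e \<in> span {e, u}" by (rule in_span2(1)[OF eE u])
    show "rk M (span {e}) = 1" by (rule loopless[OF eE e(2)])
    have "C \<union> span {e, u} \<subseteq> E" using CE subspace_subset[OF eu] by auto
    then show "insert u C \<subseteq> span (C \<union> span {e, u})"
      using in_own_span[of "C \<union> span {e, u}"] in_own_span[of "{e, u}"] eE u by auto
  qed (rule P e)+
  moreover have "rk M (span (insert u C)) = 2" using C flat1[OF u] flat2[OF u] n by auto
  ultimately show False by simp
qed

lemma card_line: "C \<in> lines \<Longrightarrow> card C = 4"
proof -
  assume C: "C \<in> lines"
  obtain x y where xy: "x \<in> C" "y \<in> C" "x \<noteq> \<zero>" "y \<notin> span {x}" "C = span {x, y}"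
    using C subspace_dim_2 unfolding lines_def by blast
  note c = line_subset[OF C xy(1)] line_subset[OF C xy(2)]
  have y: "y \<noteq> \<zero>" "y \<noteq> x" using xy(4) span1[OF c(1)] by auto
  have "x \<oplus> y \<noteq> \<zero>" "x \<oplus> y \<noteq> x" "x \<oplus> y \<noteq> y"
    using add_eq_zero_iff[OF c] add_self_left[OF c] add_self_left[OF c(2,1)] M.a_comm[OF c] add_self y xy c by auto
  then show ?thesis using xy y span2[OF c] by auto
qed

text \<open>
  Suppose that two different lines share \<open>v\<close>. They contain five vectors of the flat of \<open>v\<close>, and \<open>E2\<close> has
  only four elements, so two of the five have the same component in \<open>E2\<close> and their sum is a nonzero
  vector of \<open>E1\<close> in the flat of \<open>v\<close>. As \<open>E1\<close> is itself a flat, it contains \<open>v\<close> and then both lines,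
  which is impossible because lines have the same dimension as \<open>E1\<close>.
\<close>
lemma lines_meet:
  assumes C: "C \<in> lines" and C': "C' \<in> lines" and v: "v \<in> C" "v \<in> C'" "v \<noteq> \<zero>"
  shows "C = C'"
proof (rule ccontr)
  assume ne: "C \<noteq> C'"
  obtain w where w: "w \<in> C" "w \<noteq> \<zero>" "w \<noteq> v" "C = span {v, w}" by (rule line_through[OF C v(1,3)])
  obtain w' where w': "w' \<in> C'" "w' \<noteq> \<zero>" "w' \<noteq> v" "C' = span {v, w'}" by (rule line_through[OF C' v(2,3)])
  note c = line_subset[OF C v(1)] line_subset[OF C w(1)] line_subset[OF C' w'(1)]
  have w'C: "w' \<notin> C"
    using line_eq_span[OF C v(1) _ v(3) w'(2)] w' ne by auto
  have not_flat: False if F: "F = E1 \<or> F = E2" and vF: "v \<in> F" for F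
  proof -
    have Fl: "F \<in> lines" using F E1_line E2_line by auto
    have "w \<in> F" "w' \<in> F"
      using flat_lines[OF F vF v(3) c(2) rk_pair_in_line[OF C v(1) w(1)]]
        flat_lines[OF F vF v(3) c(3) rk_pair_in_line[OF C' v(2) w'(1)]] by auto
    then show False
      using line_eq_span[OF Fl vF _ v(3) w(2)] line_eq_span[OF Fl vF _ v(3) w'(2)] w w' ne by auto
  qed
  define S where "S = insert w' C"
  have "finite C" using card_line[OF C] card.infinite by fastforce
  then have "card S = 5" unfolding S_def using card_line[OF C] w'C by simp
  have SE: "p \<in> E" if "p \<in> S" for p using that line_subset[OF C] c by (auto simp: S_def)
  have P: "rk M (span {v, p}) \<le> 1" if "p \<in> S" for p
    using that rk_pair_in_line[OF C v(1), of p] rk_pair_in_line[OF C' v(2) w'(1)] by (auto simp: S_def)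
  have "\<forall>p\<in>S. \<exists>f. f \<in> E2 \<and> (\<exists>e\<in>E1. p = e \<oplus> f)"
    using decomposition SE by metis
  then obtain \<pi> where \<pi>: "\<And>p. p \<in> S \<Longrightarrow> \<pi> p \<in> E2 \<and> (\<exists>e\<in>E1. p = e \<oplus> \<pi> p)" by metis
  have "card (\<pi> ` S) \<le> card E2"
    using \<pi> card_line[OF E2_line] by (intro card_mono) (auto intro: card_ge_0_finite)
  then have "\<not> inj_on \<pi> S"
    using card_image[of \<pi> S] \<open>card S = 5\<close> card_line[OF E2_line] by auto
  then obtain p q where pq: "p \<in> S" "q \<in> S" "p \<noteq> q" "\<pi> p = \<pi> q" by (auto simp: inj_on_def)
  define f where "f = \<pi> p"
  obtain e where e: "e \<in> E1" "p = e \<oplus> f" unfolding f_def using \<pi>[OF pq(1)] by blast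
  obtain e' where e': "e' \<in> E1" "q = e' \<oplus> f" unfolding f_def pq(4) using \<pi>[OF pq(2)] by blast
  have fE: "f \<in> E" unfolding f_def using \<pi>[OF pq(1)] in_E2 by blast
  have "p \<oplus> q = (e \<oplus> f) \<oplus> (e' \<oplus> f)" unfolding e(2) e'(2) ..
  also have "\<dots> = e \<oplus> e'"
    using in_E1[OF e(1)] in_E1[OF e'(1)] fE by (simp add: M.a_ac add_self add_self_left)
  finally have pqE1: "p \<oplus> q \<in> E1" using subspace_add[OF E1 e(1) e'(1)] by simp
  have pq0: "p \<oplus> q \<noteq> \<zero>" using add_eq_zero_iff[OF SE[OF pq(1)] SE[OF pq(2)]] pq(3) by simp
  have "rk M (span {v, p \<oplus> q}) \<le> 1"
    by (rule parallel_add[OF c(1) SE[OF pq(1)] SE[OF pq(2)] v(3) P[OF pq(1)] P[OF pq(2)]])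
  then have "v \<in> E1"
    using flat_lines[of E1, OF _ pqE1 pq0 c(1)] by (simp add: insert_commute)
  then show False using not_flat[of E1] by simp
qed

text \<open>
  The line \<open>C\<close> meets \<open>E1\<close> and \<open>E2\<close> only in zero, so it projects onto \<open>E1\<close> along \<open>E2\<close> and is the
  graph of an isomorphism from \<open>E1\<close> to \<open>E2\<close>.
\<close>
lemma transversal:
  assumes C: "C \<in> lines" "C \<noteq> E1" "C \<noteq> E2" and e: "e \<in> E1" "e \<noteq> \<zero>"
  obtains f where "f \<in> E2" "f \<noteq> \<zero>" "e \<oplus> f \<in> C"
proof -
  have m1: "v = \<zero>" if "v \<in> C" "v \<in> E1" for v using lines_meet[OF C(1) E1_line] that C(2) by auto
  have m2: "v = \<zero>" if "v \<in> C" "v \<in> E2" for v using lines_meet[OF C(1) E2_line] that C(3) by auto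
  obtain x y where xy: "x \<in> C" "y \<in> C" "x \<noteq> \<zero>" "y \<notin> span {x}" "C = span {x, y}"
    using C subspace_dim_2 unfolding lines_def by blast
  note c = line_subset[OF C(1) xy(1)] line_subset[OF C(1) xy(2)]
  have y: "y \<noteq> \<zero>" "y \<noteq> x" using xy(4) span1[OF c(1)] by auto
  obtain x1 x2 where x: "x1 \<in> E1" "x2 \<in> E2" "x = x1 \<oplus> x2" by (rule decomposition[OF c(1)])
  obtain y1 y2 where yy: "y1 \<in> E1" "y2 \<in> E2" "y = y1 \<oplus> y2" by (rule decomposition[OF c(2)])
  note cc = in_E1[OF x(1)] in_E2[OF x(2)] in_E1[OF yy(1)] in_E2[OF yy(2)]
  have x1: "x1 \<noteq> \<zero>" using m2[OF xy(1)] x cc xy(3) by auto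
  have y1: "y1 \<noteq> \<zero>" using m2[OF xy(2)] yy cc y(1) by auto
  have xyC: "x \<oplus> y \<in> C" by (rule subspace_add[OF line_subspace[OF C(1)] xy(1,2)])
  have xy_eq: "x \<oplus> y = (x1 \<oplus> y1) \<oplus> (x2 \<oplus> y2)" unfolding x(3) yy(3) using cc by (simp add: M.a_ac)
  have "x1 \<noteq> y1"
  proof
    assume "x1 = y1"
    then have "x \<oplus> y \<in> E2" using xy_eq add_self cc subspace_add[OF E2 x(2) yy(2)] by simp
    then have "x \<oplus> y = \<zero>" using m2 xyC by simp
    then show False using add_eq_zero_iff[OF c] y by auto
  qed
  then have "E1 = {\<zero>, x1, y1, x1 \<oplus> y1}"
    using line_eq_span[OF E1_line x(1) yy(1) x1 y1] span2[OF cc(1,3)] by simp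
  then have "\<exists>f\<in>E2. e \<oplus> f \<in> C"
    using e x yy xy xyC xy_eq subspace_add[OF E2 x(2) yy(2)] by auto
  then obtain f where f: "f \<in> E2" "e \<oplus> f \<in> C" by auto
  have "f \<noteq> \<zero>" using f m1[of e] e in_E1[OF e(1)] by auto
  then show ?thesis using that f by blast
qed

text \<open>
  Let \<open>C\<close> and \<open>C'\<close> be the graphs of isomorphisms \<open>T\<close> and \<open>T'\<close> from \<open>E1\<close> to \<open>E2\<close>. As \<open>D\<close> vanishes on
  \<open>E1\<close> and on \<open>E2\<close>, the condition \<open>D (a + T a) (b + T b) = 0\<close> that the graph of \<open>T\<close> has rank 1 reads
  \<open>D a (T b) + D (T a) b = 0\<close>, which is additive in \<open>T\<close>. So the graph of \<open>T + T'\<close> has rank 1 as well.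
  It differs from the other four lines: \<open>T\<close> and \<open>T'\<close> are nonzero and, by \<open>lines_meet\<close>, differ at
  the vector \<open>a\<close>.
\<close>
lemma fifth_line:
  fixes L :: "('l, 'm) ring_scheme" and D :: "'v \<Rightarrow> 'v \<Rightarrow> 'l"
  assumes L: "abelian_group L"
    and D_closed: "\<And>u v. u \<in> E \<Longrightarrow> v \<in> E \<Longrightarrow> D u v \<in> carrier L"
    and D_add_left: "\<And>u v w. u \<in> E \<Longrightarrow> v \<in> E \<Longrightarrow> w \<in> E \<Longrightarrow> D (u \<oplus> v) w = D u w \<oplus>\<^bsub>L\<^esub> D v w"
    and D_add_right: "\<And>u v w. u \<in> E \<Longrightarrow> v \<in> E \<Longrightarrow> w \<in> E \<Longrightarrow> D u (v \<oplus> w) = D u v \<oplus>\<^bsub>L\<^esub> D u w"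
    and D_zero: "\<And>u v. u \<in> E \<Longrightarrow> v \<in> E \<Longrightarrow> D u v = \<zero>\<^bsub>L\<^esub> \<longleftrightarrow> rk M (span {u, v}) \<le> 1"
    and C: "C \<in> lines" "C \<noteq> E1" "C \<noteq> E2" and C': "C' \<in> lines" "C' \<noteq> E1" "C' \<noteq> E2" and ne: "C \<noteq> C'"
  shows "\<exists>B\<in>lines. B \<notin> {E1, E2, C, C'}"
proof -
  interpret L: abelian_group L by (rule L)
  have m: "v = \<zero>" if "A \<in> lines" "B \<in> lines" "A \<noteq> B" "v \<in> A" "v \<in> B" for v A B
    using lines_meet that by blast
  obtain a b where ab: "a \<in> E1" "b \<in> E1" "a \<noteq> \<zero>" "b \<notin> span {a}" "E1 = span {a, b}"
    using subspace_dim_2[OF E1 dim1] by blast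
  have b: "b \<noteq> \<zero>" "b \<noteq> a" using ab(4) span1[OF in_E1[OF ab(1)]] by auto
  obtain c where c: "c \<in> E2" "c \<noteq> \<zero>" "a \<oplus> c \<in> C" by (rule transversal[OF C ab(1,3)])
  obtain d where d: "d \<in> E2" "d \<noteq> \<zero>" "b \<oplus> d \<in> C" by (rule transversal[OF C ab(2) b(1)])
  obtain c' where c': "c' \<in> E2" "c' \<noteq> \<zero>" "a \<oplus> c' \<in> C'" by (rule transversal[OF C' ab(1,3)])
  obtain d' where d': "d' \<in> E2" "d' \<noteq> \<zero>" "b \<oplus> d' \<in> C'" by (rule transversal[OF C' ab(2) b(1)])
  note car = in_E1[OF ab(1)] in_E1[OF ab(2)] in_E2[OF c(1)] in_E2[OF d(1)] in_E2[OF c'(1)] in_E2[OF d'(1)]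
  have comp: "e = \<zero> \<and> f = \<zero>" if "e \<in> E1" "f \<in> E2" "e \<oplus> f = \<zero>" for e f
    using that int add_eq_zero_iff[OF in_E1[OF that(1)] in_E2[OF that(2)]] by auto
  have cross: "D (a \<oplus> x) (b \<oplus> y) = D a y \<oplus>\<^bsub>L\<^esub> D x b" if xy: "x \<in> E2" "y \<in> E2" for x y
  proof -
    note xc = in_E2[OF xy(1)] in_E2[OF xy(2)]
    have "D a b = \<zero>\<^bsub>L\<^esub>" "D x y = \<zero>\<^bsub>L\<^esub>"
      using D_zero car xc rk_pair_in_line[OF E1_line ab(1,2)] rk_pair_in_line[OF E2_line xy] by auto
    then show ?thesis using car xc D_closed by (simp add: D_add_left D_add_right L.a_comm)
  qed
  have "D (a \<oplus> c) (b \<oplus> d) = \<zero>\<^bsub>L\<^esub>" "D (a \<oplus> c') (b \<oplus> d') = \<zero>\<^bsub>L\<^esub>"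
    using D_zero car rk_pair_in_line[OF C(1) c(3) d(3)] rk_pair_in_line[OF C'(1) c'(3) d'(3)] by auto
  then have 1: "D a d \<oplus>\<^bsub>L\<^esub> D c b = \<zero>\<^bsub>L\<^esub>" and 2: "D a d' \<oplus>\<^bsub>L\<^esub> D c' b = \<zero>\<^bsub>L\<^esub>"
    using cross c d c' d' by auto
  define p where "p = a \<oplus> (c \<oplus> c')"
  define q where "q = b \<oplus> (d \<oplus> d')"
  have cc: "c \<oplus> c' \<in> E2" "d \<oplus> d' \<in> E2" using subspace_add[OF E2] c d c' d' by auto
  have pq: "p \<in> E" "q \<in> E" using car by (auto simp: p_def q_def)
  have "D p q = D a (d \<oplus> d') \<oplus>\<^bsub>L\<^esub> D (c \<oplus> c') b"
    unfolding p_def q_def by (rule cross[OF cc])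
  also have "\<dots> = (D a d \<oplus>\<^bsub>L\<^esub> D c b) \<oplus>\<^bsub>L\<^esub> (D a d' \<oplus>\<^bsub>L\<^esub> D c' b)"
    using car D_closed by (simp add: D_add_left D_add_right L.a_ac)
  also have "\<dots> = \<zero>\<^bsub>L\<^esub>" using 1 2 by simp
  finally have rk: "rk M (span {p, q}) \<le> 1" using D_zero pq by simp
  have p0: "p \<noteq> \<zero>" using comp[OF ab(1) cc(1)] ab(3) by (auto simp: p_def)
  have q0: "q \<noteq> \<zero>" using comp[OF ab(2) cc(2)] b(1) by (auto simp: q_def)
  have pq_ne: "p \<noteq> q"
  proof
    assume "p = q"
    then have "p \<oplus> q = \<zero>" using add_self[OF pq(2)] by simp
    moreover have "p \<oplus> q = (a \<oplus> b) \<oplus> ((c \<oplus> c') \<oplus> (d \<oplus> d'))"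
      unfolding p_def q_def using car by (simp add: M.a_ac)
    ultimately have "(a \<oplus> b) \<oplus> ((c \<oplus> c') \<oplus> (d \<oplus> d')) = \<zero>" by simp
    then have "a \<oplus> b = \<zero>"
      using comp[OF subspace_add[OF E1 ab(1,2)] subspace_add[OF E2 cc]] by simp
    then show False using add_eq_zero_iff[OF car(1,2)] b by auto
  qed
  have line: "span {p, q} \<in> lines" by (rule pair_line[OF pq p0 q0 pq_ne rk])
  have pS: "p \<in> span {p, q}" using span2[OF pq] by simp
  have ac: "a \<oplus> c \<noteq> \<zero>" using comp[OF ab(1) c(1)] ab(3) by auto
  have "c \<noteq> c'" using m[OF C(1) C'(1) ne, of "a \<oplus> c"] c(3) c'(3) ac by auto
  then have cc0: "c \<oplus> c' \<noteq> \<zero>" using add_eq_zero_iff car by auto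
  have "p \<notin> E1"
  proof
    assume "p \<in> E1"
    then have "a \<oplus> p \<in> E1" by (rule subspace_add[OF E1 ab(1)])
    moreover have "a \<oplus> p = c \<oplus> c'" unfolding p_def using car by (simp add: add_self_left)
    ultimately show False using cc cc0 int by auto
  qed
  moreover have "p \<notin> E2"
  proof
    assume "p \<in> E2"
    then have "p \<oplus> (c \<oplus> c') \<in> E2" using subspace_add[OF E2] cc by auto
    moreover have "p \<oplus> (c \<oplus> c') = a"
      unfolding p_def using car by (simp add: M.a_assoc add_self)
    ultimately show False using ab int by auto
  qed
  moreover have "p \<notin> C"
  proof
    assume "p \<in> C"
    then have "(a \<oplus> c) \<oplus> p \<in> C" using subspace_add[OF line_subspace[OF C(1)] c(3)] by auto
    moreover have "(a \<oplus> c) \<oplus> p = c'" unfolding p_def using car by (simp add: M.a_ac add_self add_self_left)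
    ultimately show False using m[OF C(1) E2_line C(3), of c'] c' by auto
  qed
  moreover have "p \<notin> C'"
  proof
    assume "p \<in> C'"
    then have "(a \<oplus> c') \<oplus> p \<in> C'" using subspace_add[OF line_subspace[OF C'(1)] c'(3)] by auto
    moreover have "(a \<oplus> c') \<oplus> p = c" unfolding p_def using car by (simp add: M.a_ac add_self add_self_left)
    ultimately show False using m[OF C'(1) E2_line C'(3), of c] c by auto
  qed
  ultimately show ?thesis using line pS by blast
qed

lemma not_representable:
  assumes r: "qrank M = 2" and four: "card {C. circuit M C \<and> sdim (ground M) C = 2} = 4"
  shows "\<not> representable TYPE('l) M"
proof
  assume rep: "representable TYPE('l) M"
  obtain L :: "'l ring" and D :: "'v \<Rightarrow> 'v \<Rightarrow> 'l" where LD: "abelian_group L"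
    "\<And>u v. u \<in> E \<Longrightarrow> v \<in> E \<Longrightarrow> D u v \<in> carrier L"
    "\<And>u v w. u \<in> E \<Longrightarrow> v \<in> E \<Longrightarrow> w \<in> E \<Longrightarrow> D (u \<oplus> v) w = D u w \<oplus>\<^bsub>L\<^esub> D v w"
    "\<And>u v w. u \<in> E \<Longrightarrow> v \<in> E \<Longrightarrow> w \<in> E \<Longrightarrow> D u (v \<oplus> w) = D u v \<oplus>\<^bsub>L\<^esub> D u w"
    "\<And>u v. u \<in> E \<Longrightarrow> v \<in> E \<Longrightarrow> D u v = \<zero>\<^bsub>L\<^esub> \<longleftrightarrow> rk M (span {u, v}) \<le> 1"
    by (rule representation_form[OF r rep]) blast
  have card: "card lines = 4" using four by (simp add: lines_eq_circuits)
  then have fin: "finite lines" by (metis card.infinite zero_neq_numeral)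
  have "E1 \<noteq> E2"
  proof
    assume "E1 = E2"
    then have "span_dim E1 = 0"
      using int span_dim_eq_0_iff[OF fin_dim subspace_subset[OF E1]] by auto
    then show False using dim1 by simp
  qed
  then have "card (lines - {E1, E2}) = 2"
    using card fin E1_line E2_line by (simp add: card_Diff_subset)
  then obtain C C' where C: "lines - {E1, E2} = {C, C'}" "C \<noteq> C'" by (auto simp: card_2_iff)
  then have CC: "C \<in> lines - {E1, E2}" "C' \<in> lines - {E1, E2}" by blast+
  have "\<exists>B\<in>lines. B \<notin> {E1, E2, C, C'}"
    by (rule fifth_line[OF LD]) (use CC C(2) in blast)+
  then show False using C(1) by blast
qed

end

section \<open>Minors that are uniform of rank one\<close>

lemma zero_subspace_vectorspace:
  assumes "vectorspace (class_ring :: 'k::field ring) V"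
  shows "{\<zero>\<^bsub>V\<^esub>} \<in> subspaces V"
proof -
  interpret vectorspace "class_ring :: 'k ring" V by (rule assms)
  show ?thesis
    using span_is_subspace[of "{}"] span_empty by (simp add: subspaces_def)
qed

lemma subspaces_vectorspace: "A \<in> subspaces V \<Longrightarrow> vectorspace class_ring V"
  by (simp add: subspaces_def VectorSpace.subspace_def)

lemma subspaces_submodule: "A \<in> subspaces V \<Longrightarrow> submodule class_ring A V"
  by (simp add: subspaces_def VectorSpace.subspace_def)

text \<open>
  A lattice isomorphism preserves the zero subspace, and all other subspaces have rank 1 in a uniform
  q-matroid of rank 1.
\<close>
lemma qiso_uniform_1_rk:
  fixes N :: "('k::field, 'w) qmatroid"
  assumes iso: "qiso N (uniform TYPE('k) 1 n)"
    and A: "A \<in> subspaces (ground N)" "A \<noteq> {\<zero>\<^bsub>ground N\<^esub>}"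
  shows "rk N A = 1"
proof -
  let ?V = "module_vec TYPE('k) n"
  interpret V: vec_space "TYPE('k)" n .
  obtain \<Phi> where bij: "bij_betw \<Phi> (subspaces (ground N)) (subspaces ?V)"
    and int: "\<And>A B. A \<in> subspaces (ground N) \<Longrightarrow> B \<in> subspaces (ground N) \<Longrightarrow> \<Phi> (A \<inter> B) = \<Phi> A \<inter> \<Phi> B"
    and rk: "\<And>A. A \<in> subspaces (ground N) \<Longrightarrow> rk N A = min (int (sdim ?V (\<Phi> A))) 1"
    using iso unfolding qiso_def by (auto simp: uniform_def)
  have zN: "{\<zero>\<^bsub>ground N\<^esub>} \<in> subspaces (ground N)"
    by (rule zero_subspace_vectorspace[OF subspaces_vectorspace[OF A(1)]])
  have zV: "{\<zero>\<^bsub>?V\<^esub>} \<in> subspaces ?V" by (rule zero_subspace_vectorspace[OF vec_vs])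
  have sub: "\<Phi> B \<in> subspaces ?V" if "B \<in> subspaces (ground N)" for B
    using bij_betwE[OF bij] that by blast
  have "{\<zero>\<^bsub>?V\<^esub>} \<in> \<Phi> ` subspaces (ground N)" using zV bij by (simp only: bij_betw_def)
  then obtain B where B: "B \<in> subspaces (ground N)" "\<Phi> B = {\<zero>\<^bsub>?V\<^esub>}" by (metis imageE)
  have "{\<zero>\<^bsub>ground N\<^esub>} \<inter> B = {\<zero>\<^bsub>ground N\<^esub>}"
    using submodule.zero_closed[OF subspaces_submodule[OF B(1)]] by auto
  then have "\<Phi> {\<zero>\<^bsub>ground N\<^esub>} \<subseteq> {\<zero>\<^bsub>?V\<^esub>}" using int[OF zN B(1)] B(2) by auto
  moreover have "\<zero>\<^bsub>?V\<^esub> \<in> \<Phi> {\<zero>\<^bsub>ground N\<^esub>}"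
    by (rule submodule.zero_closed[OF subspaces_submodule[OF sub[OF zN]]])
  ultimately have "\<Phi> {\<zero>\<^bsub>ground N\<^esub>} = {\<zero>\<^bsub>?V\<^esub>}" by auto
  then have ne: "\<Phi> A \<noteq> {\<zero>\<^bsub>?V\<^esub>}"
    using inj_onD[OF bij_betw_imp_inj_on[OF bij] _ A(1) zN] A(2) by auto
  have "submodule class_ring (\<Phi> A) ?V" by (rule subspaces_submodule[OF sub[OF A(1)]])
  moreover have "\<zero>\<^bsub>?V\<^esub> \<in> \<Phi> A" by (rule submodule.zero_closed[OF calculation])
  moreover have "\<Phi> A \<subseteq> carrier_vec n" using submodule.subset[OF calculation(1)] by (simp add: module_vec_simps)
  ultimately have "sdim ?V (\<Phi> A) \<noteq> 0"
    unfolding sdim_def using V.span_dim_submodule[of "\<Phi> A"] V.span_dim_eq_0_iff[OF V.fin_dim, of "\<Phi> A"] ne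
    by (auto simp: module_vec_simps)
  then show ?thesis using rk[OF A(1)] by auto
qed

context q_matroid
begin

lemma restriction_uniform_rk:
  assumes X: "X \<in> subspaces (ground M)" and iso: "qiso (restriction M X) (uniform TYPE('k) 1 n)"
    and A: "A \<in> subspaces (ground M)" "A \<subseteq> X" "A \<noteq> {\<zero>\<^bsub>ground M\<^esub>}"
  shows "rk M A = 1"
proof -
  have "VectorSpace.subspace class_ring X (ground M)" using X by (simp add: subspaces_def)
  then have vsX: "vectorspace class_ring (vs X)" by (rule subspace_is_vs)
  have "submodule class_ring A (vs X)"
    using subspaces_submodule[OF A(1)] A(2) vsX
    unfolding submodule_def vectorspace_def by auto
  then have "A \<in> subspaces (ground (restriction M X))"
    using vsX by (simp add: subspaces_def VectorSpace.subspace_def restriction_def)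
  from qiso_uniform_1_rk[OF iso this] show ?thesis using A(3) by (simp add: restriction_def)
qed

text \<open>
  The subspace of the quotient that corresponds to \<open>A\<close> consists of the cosets of the elements of \<open>A\<close>.
\<close>
lemma contraction_uniform_rk:
  assumes X: "X \<in> subspaces (ground M)" and iso: "qiso (contraction M X) (uniform TYPE('k) 1 n)"
    and A: "A \<in> subspaces (ground M)" "X \<subset> A"
  shows "rk M A = rk M X + 1"
proof -
  let ?Q = "quotient_space (ground M) X"
  note sX = subspaces_submodule[OF X] and sA = subspaces_submodule[OF A(1)]
  have XE: "X \<subseteq> carrier (ground M)" and AE: "A \<subseteq> carrier (ground M)"
    using subspace_subset X A by auto
  interpret X: abelian_subgroup X "ground M"
  proof (rule abelian_subgroupI3)
    show "additive_subgroup X (ground M)"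
    proof (rule additive_subgroup.intro, rule M.add.subgroupI)
      fix x assume x: "x \<in> X"
      then have "(\<ominus>\<^bsub>class_ring\<^esub> \<one>\<^bsub>class_ring\<^esub>) \<odot>\<^bsub>ground M\<^esub> x \<in> X"
        using submodule.smult_closed[OF sX] by simp
      then show "\<ominus>\<^bsub>ground M\<^esub> x \<in> X"
        using smult_minus_1[of x] x XE by auto
    qed (use XE submodule.m_closed[OF sX] submodule.zero_closed[OF sX] in auto)
  qed (rule M.abelian_group_axioms)
  have mem: "y \<in> X +>\<^bsub>ground M\<^esub> a \<longleftrightarrow> (\<exists>x\<in>X. y = x \<oplus>\<^bsub>ground M\<^esub> a)" for y a
    by (auto simp: a_r_coset_def')
  let ?B = "(\<lambda>a. X +>\<^bsub>ground M\<^esub> a) ` A"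
  have zero: "X = X +>\<^bsub>ground M\<^esub> \<zero>\<^bsub>ground M\<^esub>" using XE by (auto simp: a_r_coset_def')
  \<comment> \<open>A subspace lives in a vector space by definition, and the isomorphism provides subspaces of the quotient.\<close>
  have vsQ: "vectorspace class_ring ?Q"
  proof -
    obtain C where "C \<in> subspaces (ground (contraction M X))"
      using iso zero_subspace_vectorspace[OF vec_vs[where 'a = 'k, of n]]
      by (auto simp: qiso_def bij_betw_def uniform_def)
    then show ?thesis using subspaces_vectorspace by (simp add: contraction_def)
  qed
  have sm: "X <+>\<^bsub>ground M\<^esub> (\<lambda>v. c \<odot>\<^bsub>ground M\<^esub> v) ` (X +>\<^bsub>ground M\<^esub> a) = X +>\<^bsub>ground M\<^esub> (c \<odot>\<^bsub>ground M\<^esub> a)"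
    if a: "a \<in> carrier (ground M)" for c a
  proof (intro equalityI subsetI)
    fix y assume "y \<in> X <+>\<^bsub>ground M\<^esub> (\<lambda>v. c \<odot>\<^bsub>ground M\<^esub> v) ` (X +>\<^bsub>ground M\<^esub> a)"
    then obtain x x' where x: "x \<in> X" "x' \<in> X" "y = x \<oplus>\<^bsub>ground M\<^esub> c \<odot>\<^bsub>ground M\<^esub> (x' \<oplus>\<^bsub>ground M\<^esub> a)"
      by (auto simp: set_add_def' mem)
    then have "y = (x \<oplus>\<^bsub>ground M\<^esub> c \<odot>\<^bsub>ground M\<^esub> x') \<oplus>\<^bsub>ground M\<^esub> c \<odot>\<^bsub>ground M\<^esub> a"
      using a XE smult_r_distr[of c x' a] by (auto simp: M.a_assoc subset_iff)
    moreover have "x \<oplus>\<^bsub>ground M\<^esub> c \<odot>\<^bsub>ground M\<^esub> x' \<in> X"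
      using x submodule.m_closed[OF sX] submodule.smult_closed[OF sX] by simp
    ultimately show "y \<in> X +>\<^bsub>ground M\<^esub> (c \<odot>\<^bsub>ground M\<^esub> a)" unfolding mem by blast
  next
    fix y assume "y \<in> X +>\<^bsub>ground M\<^esub> (c \<odot>\<^bsub>ground M\<^esub> a)"
    then obtain x where x: "x \<in> X" "y = x \<oplus>\<^bsub>ground M\<^esub> c \<odot>\<^bsub>ground M\<^esub> a" by (auto simp: mem)
    moreover have "a \<in> X +>\<^bsub>ground M\<^esub> a" using X.a_rcos_self[OF a] .
    ultimately show "y \<in> X <+>\<^bsub>ground M\<^esub> (\<lambda>v. c \<odot>\<^bsub>ground M\<^esub> v) ` (X +>\<^bsub>ground M\<^esub> a)"
      by (auto simp: set_add_def')
  qed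
  have "submodule class_ring ?B ?Q"
  proof (rule submodule.intro)
    show "Module.module class_ring ?Q" using vsQ by (simp add: vectorspace_def)
    show "?B \<subseteq> carrier ?Q" using AE by (auto simp: quotient_space_def A_RCOSETS_def')
    show "\<zero>\<^bsub>?Q\<^esub> \<in> ?B" using zero submodule.zero_closed[OF sA] by (auto simp: quotient_space_def)
  next
    fix C C' assume "C \<in> ?B" "C' \<in> ?B"
    then obtain a a' where a: "a \<in> A" "a' \<in> A" "C = X +>\<^bsub>ground M\<^esub> a" "C' = X +>\<^bsub>ground M\<^esub> a'" by auto
    then have "C \<oplus>\<^bsub>?Q\<^esub> C' = X +>\<^bsub>ground M\<^esub> (a \<oplus>\<^bsub>ground M\<^esub> a')"
      using X.a_rcos_sum[of a a'] AE by (auto simp: quotient_space_def)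
    then show "C \<oplus>\<^bsub>?Q\<^esub> C' \<in> ?B" using submodule.m_closed[OF sA a(1,2)] by blast
  next
    fix c :: 'k and C assume "C \<in> ?B"
    then obtain a where a: "a \<in> A" "C = X +>\<^bsub>ground M\<^esub> a" by auto
    then have "c \<odot>\<^bsub>?Q\<^esub> C = X +>\<^bsub>ground M\<^esub> (c \<odot>\<^bsub>ground M\<^esub> a)"
      using sm[of a c] AE by (auto simp: quotient_space_def)
    then show "c \<odot>\<^bsub>?Q\<^esub> C \<in> ?B" using submodule.smult_closed[OF sA _ a(1)] by auto
  qed
  then have B: "?B \<in> subspaces (ground (contraction M X))"
    using vsQ by (simp add: subspaces_def VectorSpace.subspace_def contraction_def)
  have U: "\<Union> ?B = A"
  proof (intro equalityI subsetI)
    fix y assume "y \<in> \<Union> ?B"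
    then obtain a x where "a \<in> A" "x \<in> X" "y = x \<oplus>\<^bsub>ground M\<^esub> a" by (auto simp: mem)
    then show "y \<in> A" using A(2) submodule.m_closed[OF sA] by auto
  next
    fix y assume "y \<in> A"
    then show "y \<in> \<Union> ?B" using X.a_rcos_self[of y] AE by blast
  qed
  have "?B \<noteq> {X}"
  proof
    assume "?B = {X}"
    then have "\<Union> ?B = X" by simp
    then show False using U A(2) by simp
  qed
  then have "?B \<noteq> {\<zero>\<^bsub>ground (contraction M X)\<^esub>}"
    by (simp add: contraction_def quotient_space_def)
  from qiso_uniform_1_rk[OF iso B this] show ?thesis
    using U by (simp add: contraction_def)
qed

end

text \<open>
  Vectors of \<open>E2\<close> are not loops because the restriction to \<open>E2\<close> is uniform of rank 1. A vector outside
  \<open>E2\<close> is not a loop because adding it to \<open>E2\<close> raises the rank.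
\<close>
lemma binary_split_matroidI:
  fixes M :: "(bit, 'v) qmatroid"
  assumes M: "q_matroid M"
    and E1: "E1 \<in> subspaces (ground M)" and E2: "E2 \<in> subspaces (ground M)"
    and sum: "E1 <+>\<^bsub>ground M\<^esub> E2 = carrier (ground M)" and int: "E1 \<inter> E2 = {\<zero>\<^bsub>ground M\<^esub>}"
    and dim: "sdim (ground M) E1 = 2" "sdim (ground M) E2 = 2"
    and res1: "qiso (restriction M E1) (uniform TYPE(bit) 1 2)"
    and con2: "qiso (contraction M E2) (uniform TYPE(bit) 1 2)"
    and res2: "qiso (restriction M E2) (uniform TYPE(bit) 1 2)"
    and con1: "qiso (contraction M E1) (uniform TYPE(bit) 1 2)"
  shows "binary_split_matroid M E1 E2"
proof -
  interpret q_matroid M by (rule M)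
  have d: "span_dim E1 = 2" "span_dim E2 = 2" using dim sdim_eq E1 E2 by auto
  have ne: "X \<noteq> {\<zero>\<^bsub>ground M\<^esub>}" if "X \<in> subspaces (ground M)" "span_dim X = 2" for X
    using span_dim_eq_0_iff[OF fin_dim subspace_subset[OF that(1)]] that(2) by auto
  have rk1: "rk M E1 = 1" by (rule restriction_uniform_rk[OF E1 res1 E1 subset_refl ne[OF E1 d(1)]])
  have rk2: "rk M E2 = 1" by (rule restriction_uniform_rk[OF E2 res2 E2 subset_refl ne[OF E2 d(2)]])
  have flat: "rk M (span (insert v X)) = 2"
    if X: "X \<in> subspaces (ground M)" "rk M X = 1" "qiso (contraction M X) (uniform TYPE(bit) 1 2)"
      and v: "v \<in> carrier (ground M)" "v \<notin> X" for X v
  proof -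
    have car: "insert v X \<subseteq> carrier (ground M)" using v subspace_subset[OF X(1)] by auto
    have "X \<subset> span (insert v X)" using in_own_span[OF car] v by auto
    from contraction_uniform_rk[OF X(1,3) span_subspace[OF car] this] show ?thesis using X(2) by simp
  qed
  have loopless: "rk M (span {v}) = 1" if v: "v \<in> carrier (ground M)" "v \<noteq> \<zero>\<^bsub>ground M\<^esub>" for v
  proof (cases "v \<in> E2")
    case True
    have S: "span {v} \<in> subspaces (ground M)" by (rule span_subspace) (use v in auto)
    have "span {v} \<subseteq> E2" by (rule span_is_subset) (use True subspaces_submodule[OF E2] in auto)
    moreover have "span {v} \<noteq> {\<zero>\<^bsub>ground M\<^esub>}" using span_self[OF v(1)] v(2) by auto
    ultimately show ?thesis by (rule restriction_uniform_rk[OF E2 res2 S])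
  next
    case False
    have S: "span {v} \<in> subspaces (ground M)" by (rule span_subspace) (use v in auto)
    have car: "E2 \<union> span {v} \<subseteq> carrier (ground M)" using subspace_subset E2 S by auto
    have "insert v E2 \<subseteq> E2 \<union> span {v}" using span_self[OF v(1)] by auto
    then have "span (insert v E2) \<subseteq> span (E2 \<union> span {v})" by (rule span_is_monotone)
    then have "2 \<le> rk M (span (E2 \<union> span {v}))"
      using R2[OF span_subspace[of "insert v E2"] span_subspace[OF car]] flat[OF E2 rk2 con2 v(1) False]
        v(1) subspace_subset[OF E2] by auto
    moreover have "0 \<le> rk M (E2 \<inter> span {v})"
      by (rule rk_nonneg) (use submodule_Int E2 S in \<open>auto simp: subspaces_iff\<close>)
    moreover have "rk M (span {v}) \<le> 1"
      using rk_le[OF S] span_dim_le_card[OF fin_dim, of "{v}"] v(1)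
        span_dim_cong[OF span_submodule[OF span_is_submodule[of "{v}"]]] by auto
    ultimately show ?thesis using rk_submodular[OF E2 S] rk2 by linarith
  qed
  show ?thesis
    by unfold_locales (fact E1 E2 sum int d rk1 rk2 | rule flat[OF E1 rk1 con1] flat[OF E2 rk2 con2] loopless, assumption+)+
qed

section \<open>A smallest non-representable q-matroid\<close>

theorem corollary20:
  fixes M :: "(bit, bit vec) qmatroid" and E1 E2 :: "bit vec set"
  assumes "q_matroid M"
    and "ground M = module_vec TYPE(bit) 4"
    and "E1 \<in> subspaces (ground M)" and "E2 \<in> subspaces (ground M)"
    and "E1 <+>\<^bsub>ground M\<^esub> E2 = carrier (ground M)" and "E1 \<inter> E2 = {\<zero>\<^bsub>ground M\<^esub>}"
    and "sdim (ground M) E1 = 2" and "sdim (ground M) E2 = 2"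
    and "qrank M = 2"
    and "qiso (restriction M E1) (uniform TYPE(bit) 1 2)"
    and "qiso (contraction M E2) (uniform TYPE(bit) 1 2)"
    and "qiso (restriction M E2) (uniform TYPE(bit) 1 2)"
    and "qiso (contraction M E1) (uniform TYPE(bit) 1 2)"
    and "card {C. circuit M C \<and> sdim (ground M) C = 2} = 4"
  shows "\<not> representable TYPE('l) M \<and>
    (\<forall>N :: ('k::field, 'v) qmatroid.
       q_matroid N \<and> qdim N \<le> 3 \<longrightarrow> representable TYPE('k poly fract) N)"
proof (intro conjI allI impI)
  have "binary_split_matroid M E1 E2"
    by (rule binary_split_matroidI[OF assms(1,3-8,10-13)])
  then show "\<not> representable TYPE('l) M"
    by (rule binary_split_matroid.not_representable[OF _ assms(9,14)])
next
  fix N :: "('k, 'v) qmatroid"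
  assume N: "q_matroid N \<and> qdim N \<le> 3"
  then show "representable TYPE('k poly fract) N"
    using q_matroid.representable_dim_le_3[of N] by simp
qed

end
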